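(* Let $(A_j)_{j\ge1}$ be a sequence of non-negative real random variables and $B$ a non-negative real random variable with $\mathbb{P}(B=0)<1$. Let $((A_{t,j})_{j\ge1},B_t)_{t\in\mathbb{Z}}$ be a family of non-negative random variables satisfying either (A1) or (A2) (see context), and let $X$ be the limit in law, as $t\to\infty$, with values in $[0,\infty]$, of the sequence $(X_t)_{t\ge 0}$ defined by $$X_t=\sum_{j=1}^\infty A_{t,j}X_{t-j}+B_t\quad(t\ge0),\qquad X_{-1}=X_{-2}=\cdots=0 .$$ Let $\phi_1,\tilde\phi_1,\phi_2,\tilde\phi_2$ be the functions defined in the context, and let $\theta>0$. 1. Assume that either $\theta\ge2$ and $\phi_2(\theta)\ge0$, or $\theta\le2$ and $\tilde\phi_2(\theta)\ge0$. Then $\mathbb{E}[X^\theta]=\infty$. 2. Assume the following: (a) either $\theta\le2$, $\phi_1(\theta/2)<0$ and $\phi_2(\theta)<0$; or $\theta\ge2$, $\tilde\phi_1(\theta/2)<0$ and $\tilde\phi_2(\theta)<0$; (b) (required only in the case (A1)) $\displaystyle\sum_{i,j\ge1}\mathbb{E}\big[A_i^{\theta/2}A_j^{\theta/2}\big]^{\min(1,2/\theta)}<\infty$; (c) $\mathbb{E}[B^\theta]<\infty$. Then $\mathbb{E}[X^\theta]<\infty$.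
   Context: Arbitrary dependencies among the random variables $(A_j)_{j\ge1}$ and $B$ are allowed, except that $B$ is independent of $(A_j)_{j\ge1}$ under (A2). (A1): $((A_{t,j})_{j\ge1},B_t)_{t\in\mathbb{Z}}$ are i.i.d. (over $t$) copies of the random sequence $((A_j)_{j\ge1},B)$. (A2): $((A_{t+j,j})_{j\ge1})_{t\in\mathbb{Z}}$ are i.i.d. (over $t$) copies of the random sequence $(A_j)_{j\ge1}$; moreover $B$ is independent of $(A_j)_{j\ge1}$, that is, $(B_t)_{t\in\mathbb{Z}}$ are i.i.d. copies of $B$, and the family $(B_t)_{t\in\mathbb{Z}}$ is independent of the family $(A_{t,j})_{t\in\mathbb{Z},j\ge1}$. Under (A1) or (A2) the limit in law $X$ exists (as a $[0,\infty]$-valued random variable) and has the law of $$\tilde X=\sum_{n\ge0}\ \sum_{0=t_0<t_1<\cdots<t_n}\tilde A_{t_0,t_1-t_0}\cdots\tilde A_{t_{n-1},t_n-t_{n-1}}B_{-t_n},\qquad \tilde A_{t,j}:=A_{-t,j}\quad (t\in\mathbb{Z},\,j\ge1).$$ Sequences: let $\mathscr{T}$ be the set of finite integer sequences $\boldsymbol t=(t_0,\ldots,t_n)$ with $n\ge0$ and $0=t_0<t_1<\cdots<t_n$; write $n(\boldsymbol t)=n$ and $\tilde A_{\boldsymbol t}=\tilde A_{t_0,t_1-t_0}\cdots\tilde A_{t_{n-1},t_n-t_{n-1}}$, with $\tilde A_{(0)}=1$. Closed pairs: $\mathscr{C}$ is the set of pairs $(\boldsymbol s,\boldsymbol t)\in\mathscr{T}\times\mathscr{T}$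 such that $n(\boldsymbol s)>0$, $n(\boldsymbol t)>0$, $s_{n(\boldsymbol s)}=t_{n(\boldsymbol t)}$, and $s_i\ne t_j$ for all $0<i<n(\boldsymbol s)$, $0<j<n(\boldsymbol t)$. Functions, for $\theta>0$: $$\phi_1(\theta)=\log\sum_{j=1}^\infty\mathbb{E}[A_j^\theta],\qquad \tilde\phi_1(\theta)=\log\sum_{j=1}^\infty\mathbb{E}[A_j^\theta]^{1/\theta},$$ $$\phi_2(\theta)=\log\sum_{(\boldsymbol s,\boldsymbol t)\in\mathscr{C}}\mathbb{E}\big[\tilde A_{\boldsymbol s}^{\theta/2}\tilde A_{\boldsymbol t}^{\theta/2}\big],\qquad \tilde\phi_2(\theta)=\log\sum_{(\boldsymbol s,\boldsymbol t)\in\mathscr{C}}\mathbb{E}\big[\tilde A_{\boldsymbol s}^{\theta/2}\tilde A_{\boldsymbol t}^{\theta/2}\big]^{2/\theta}.$$ Conventions: expectations of non-negative random variables and sums of non-negative terms take values in $[0,\infty]$; $\infty^{r}=\infty$ for $r>0$; $\log 0=-\infty$, $\log\infty=+\infty$. *)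

theory Defs
  imports "HOL-Probability.Probability"
begin

text \<open>Real powers and logarithm on \<open>[0,\<infinity>]\<close>, with \<open>\<infinity> powr r = \<infinity>\<close>, \<open>log 0 = -\<infinity>\<close> and
  \<open>log \<infinity> = \<infinity>\<close>. The power is only meant for exponents \<open>r > 0\<close>.\<close>

definition epowr :: "ennreal \<Rightarrow> real \<Rightarrow> ennreal" where
  "epowr x r = (if x = \<top> then \<top> else ennreal (enn2real x powr r))"

definition elog :: "ennreal \<Rightarrow> ereal" where
  "elog x = (if x = 0 then -\<infinity> else if x = \<top> then \<infinity> else ereal (ln (enn2real x)))"

text \<open>Conventions: the sequence \<open>(A\<^sub>j)\<close> is a function on \<^typ>\<open>nat\<close> of which only the values at
  \<open>j \<ge> 1\<close> are used. The generic sequence \<open>(A\<^sub>j), B\<close> lives on a space \<open>P\<close> and the family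
  \<open>(A\<^bsub>t,j\<^esub>), (B\<^sub>t)\<close> on a space \<open>M\<close>; the two spaces may differ. Below, \<open>\<A>\<close> and \<open>\<B>\<close> denote
  the family, \<open>A\<close> and \<open>B\<close> the generic sequence.\<close>

abbreviation seq_space :: "(nat \<Rightarrow> real) measure" where
  "seq_space \<equiv> PiM {1..} (\<lambda>_. borel)"

text \<open>The library's \<^const>\<open>prob_space.indep_var\<close> requires both random variables to have the same
  value type; the following is its analogue for two different value types.\<close>

definition indep_rv ::
  "'w measure \<Rightarrow> 'x measure \<Rightarrow> ('w \<Rightarrow> 'x) \<Rightarrow> 'y measure \<Rightarrow> ('w \<Rightarrow> 'y) \<Rightarrow> bool" where
  "indep_rv M S X T Y \<longleftrightarrow>
     X \<in> measurable M S \<and> Y \<in> measurable M T \<and>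
     prob_space.indep_set M {X -` U \<inter> space M |U. U \<in> sets S} {Y -` V \<inter> space M |V. V \<in> sets T}"

definition assumption_A1 ::
  "'a measure \<Rightarrow> (nat \<Rightarrow> 'a \<Rightarrow> real) \<Rightarrow> ('a \<Rightarrow> real) \<Rightarrow>
   'b measure \<Rightarrow> (int \<Rightarrow> nat \<Rightarrow> 'b \<Rightarrow> real) \<Rightarrow> (int \<Rightarrow> 'b \<Rightarrow> real) \<Rightarrow> bool" where
  "assumption_A1 P A B M \<A> \<B> \<longleftrightarrow>
     prob_space.indep_vars M (\<lambda>_. seq_space \<Otimes>\<^sub>M borel)
       (\<lambda>t \<omega>. (\<lambda>j\<in>{1..}. \<A> t j \<omega>, \<B> t \<omega>)) UNIV \<and>
     (\<forall>t. distr M (seq_space \<Otimes>\<^sub>M borel) (\<lambda>\<omega>. (\<lambda>j\<in>{1..}. \<A> t j \<omega>, \<B> t \<omega>)) =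
          distr P (seq_space \<Otimes>\<^sub>M borel) (\<lambda>\<omega>. (\<lambda>j\<in>{1..}. A j \<omega>, B \<omega>)))"

definition assumption_A2 ::
  "'a measure \<Rightarrow> (nat \<Rightarrow> 'a \<Rightarrow> real) \<Rightarrow> ('a \<Rightarrow> real) \<Rightarrow>
   'b measure \<Rightarrow> (int \<Rightarrow> nat \<Rightarrow> 'b \<Rightarrow> real) \<Rightarrow> (int \<Rightarrow> 'b \<Rightarrow> real) \<Rightarrow> bool" where
  "assumption_A2 P A B M \<A> \<B> \<longleftrightarrow>
     prob_space.indep_vars M (\<lambda>_. seq_space) (\<lambda>t \<omega>. \<lambda>j\<in>{1..}. \<A> (t + int j) j \<omega>) UNIV \<and>
     (\<forall>t. distr M seq_space (\<lambda>\<omega>. \<lambda>j\<in>{1..}. \<A> (t + int j) j \<omega>) =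
          distr P seq_space (\<lambda>\<omega>. \<lambda>j\<in>{1..}. A j \<omega>)) \<and>
     indep_rv P borel B seq_space (\<lambda>\<omega>. \<lambda>j\<in>{1..}. A j \<omega>) \<and>
     prob_space.indep_vars M (\<lambda>_. borel) \<B> UNIV \<and>
     (\<forall>t. distr M borel (\<B> t) = distr P borel B) \<and>
     indep_rv M
       (PiM UNIV (\<lambda>_. borel)) (\<lambda>\<omega>. \<lambda>t\<in>UNIV. \<B> t \<omega>)
       (PiM (UNIV \<times> {1..}) (\<lambda>_. borel)) (\<lambda>\<omega>. \<lambda>(t, j)\<in>UNIV \<times> {1..}. \<A> t j \<omega>)"

text \<open>The series in the recursion has finitely many nonzero terms, since \<open>X\<close> vanishes at
  negative times.\<close>

definition solves_recursion ::
  "'b measure \<Rightarrow> (int \<Rightarrow> nat \<Rightarrow> 'b \<Rightarrow> real) \<Rightarrow> (int \<Rightarrow> 'b \<Rightarrow> real) \<Rightarrow>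
   (int \<Rightarrow> 'b \<Rightarrow> real) \<Rightarrow> bool" where
  "solves_recursion M \<A> \<B> X \<longleftrightarrow>
     (\<forall>\<omega>\<in>space M.
        (\<forall>t<0. X t \<omega> = 0) \<and>
        (\<forall>t\<ge>0. X t \<omega> = (\<Sum>\<^sub>\<infinity>j\<in>{1..}. \<A> t j \<omega> * X (t - int j) \<omega>) + \<B> t \<omega>))"

text \<open>Convergence in law of \<open>[0,\<infinity>]\<close>-valued random variables, where \<open>[0,\<infinity>]\<close> carries its usual
  (compact) topology; test functions are real-valued, bounded and continuous on \<open>[0,\<infinity>]\<close>.\<close>

definition converges_in_law ::
  "'b measure \<Rightarrow> (nat \<Rightarrow> 'b \<Rightarrow> ennreal) \<Rightarrow> 'c measure \<Rightarrow> ('c \<Rightarrow> ennreal) \<Rightarrow> bool" where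
  "converges_in_law M Y N X \<longleftrightarrow>
     (\<forall>f :: ennreal \<Rightarrow> real. continuous_on UNIV f \<and> bounded (range f) \<longrightarrow>
        (\<lambda>n. \<integral>\<omega>. f (Y n \<omega>) \<partial>M) \<longlonglongrightarrow> (\<integral>\<omega>. f (X \<omega>) \<partial>N))"

text \<open>The set \<open>\<T>\<close> of sequences \<open>0 = t\<^sub>0 < \<dots> < t\<^sub>n\<close>; \<open>n(t)\<close> is the number of steps, one less than
  the length of the list.\<close>

definition seqs :: "int list set" where
  "seqs = {t. t \<noteq> [] \<and> t ! 0 = 0 \<and> sorted_wrt (<) t}"

definition nsteps :: "int list \<Rightarrow> nat" where
  "nsteps t = length t - 1"

definition closed_pairs :: "(int list \<times> int list) set" where
  "closed_pairs = {(s, t). s \<in> seqs \<and> t \<in> seqs \<and> nsteps s > 0 \<and> nsteps t > 0 \<and>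
     s ! nsteps s = t ! nsteps t \<and>
     (\<forall>i j. 0 < i \<and> i < nsteps s \<and> 0 < j \<and> j < nsteps t \<longrightarrow> s ! i \<noteq> t ! j)}"

definition reversed :: "(int \<Rightarrow> nat \<Rightarrow> 'b \<Rightarrow> real) \<Rightarrow> int \<Rightarrow> nat \<Rightarrow> 'b \<Rightarrow> real" where
  "reversed \<A> t j = \<A> (- t) j"

definition path_prod :: "(int \<Rightarrow> nat \<Rightarrow> 'b \<Rightarrow> real) \<Rightarrow> int list \<Rightarrow> 'b \<Rightarrow> real" where
  "path_prod \<A> t \<omega> =
     (\<Prod>i<nsteps t. reversed \<A> (t ! i) (nat (t ! Suc i - t ! i)) \<omega>)"

definition phi1 :: "'a measure \<Rightarrow> (nat \<Rightarrow> 'a \<Rightarrow> real) \<Rightarrow> real \<Rightarrow> ereal" where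
  "phi1 P A \<theta> = elog (\<Sum>\<^sub>\<infinity>j\<in>{1..}. \<integral>\<^sup>+\<omega>. ennreal (A j \<omega> powr \<theta>) \<partial>P)"

definition phi1_tilde :: "'a measure \<Rightarrow> (nat \<Rightarrow> 'a \<Rightarrow> real) \<Rightarrow> real \<Rightarrow> ereal" where
  "phi1_tilde P A \<theta> =
     elog (\<Sum>\<^sub>\<infinity>j\<in>{1..}. epowr (\<integral>\<^sup>+\<omega>. ennreal (A j \<omega> powr \<theta>) \<partial>P) (1 / \<theta>))"

definition phi2 :: "'b measure \<Rightarrow> (int \<Rightarrow> nat \<Rightarrow> 'b \<Rightarrow> real) \<Rightarrow> real \<Rightarrow> ereal" where
  "phi2 M \<A> \<theta> =
     elog (\<Sum>\<^sub>\<infinity>(s, t)\<in>closed_pairs.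
       \<integral>\<^sup>+\<omega>. ennreal (path_prod \<A> s \<omega> powr (\<theta> / 2) * path_prod \<A> t \<omega> powr (\<theta> / 2)) \<partial>M)"

definition phi2_tilde :: "'b measure \<Rightarrow> (int \<Rightarrow> nat \<Rightarrow> 'b \<Rightarrow> real) \<Rightarrow> real \<Rightarrow> ereal" where
  "phi2_tilde M \<A> \<theta> =
     elog (\<Sum>\<^sub>\<infinity>(s, t)\<in>closed_pairs.
       epowr (\<integral>\<^sup>+\<omega>. ennreal (path_prod \<A> s \<omega> powr (\<theta> / 2) * path_prod \<A> t \<omega> powr (\<theta> / 2)) \<partial>M)
         (2 / \<theta>))"

end

theory Submission
  imports Defs
begin

text \<open>In reversed time, \<open>X\<^sub>N\<close> has the law of the sum \<open>x\<^sub>N\<close> over all paths from \<open>0\<close> of length at most \<open>N\<close> of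
  the product of the weights along the path and of \<open>B\<close> at its end point. A pair of paths either has
  no common point besides \<open>0\<close>, or splits uniquely at its first such point \<open>c\<close> into a closed pair and an
  arbitrary pair of paths from \<open>c\<close>. Hence
  \<open>x\<^sub>N\<^sup>2 = (disjoint pairs) + (\<Sum> closed pairs (s, t). A\<^sub>s A\<^sub>t x\<^bsub>N-c\<^esub>(c)\<^sup>2)\<close>, where the two factors in
  the sum are independent and \<open>x\<^sub>n(c)\<close> has the law of \<open>x\<^sub>n\<close>.
  For \<open>p \<le> 1\<close> the reverse Minkowski inequality gives \<open>\<xi> \<ge> \<parallel>B\<^sup>2\<parallel> + \<rho> \<xi>\<close> for the supremum \<open>\<xi>\<close> of the norms
  of \<open>x\<^sub>N\<^sup>2\<close> of order \<open>p\<close>, where \<open>\<rho>\<close> is the sum over the closed pairs, so that \<open>\<xi> = \<infinity>\<close> if \<open>\<rho> \<ge> 1\<close>.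
  For \<open>p \<ge> 1\<close> the Minkowski inequality bounds these norms if \<open>\<rho> < 1\<close>; along a disjoint pair only the
  two first weights can be dependent.\<close>

section \<open>Norms of order \<open>p\<close>\<close>

text \<open>The upper bound is self-referential: an inequality \<open>x \<le> A + s * x\<close> with
  \<open>s < 1\<close> says nothing when \<open>x\<close> is infinite. Finiteness of the norm for
  each fixed \<open>N\<close> is therefore established beforehand, by a finite sum over the first
  step. The lower bound is read for the supremum over \<open>N\<close>, because a closed pair of
  length \<open>c\<close> shortens the remaining horizon to \<open>N - c\<close>. Two edges can be
  dependent only if they share their start under (A1), or their end under (A2). Two nontrivial paths
  forming a disjoint pair share only the start 0, so condition (b) concerns the first weights and
  the case (A1). The remaining weights factorise, and \<open>phi1\<close> or
  \<open>phi1_tilde\<close> being negative sums each tail like a geometric series. Time reversal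
  also gives access to the limit: the solution of the recursion need not be monotone in time, but
  the path sum with the same law grows with \<open>N\<close> pointwise. Truncated moments thus
  increase to their limits, and convergence in law compares moments in both directions.\<close>

lemma epowr_top [simp]: "epowr \<top> r = \<top>"
  by (simp add: epowr_def)

lemma epowr_ennreal: "0 \<le> x \<Longrightarrow> epowr (ennreal x) r = ennreal (x powr r)"
  by (simp add: epowr_def)

lemma epowr_0 [simp]: "epowr 0 r = 0"
  by (simp add: epowr_def)

lemma epowr_1 [simp]: "epowr x 1 = x"
  by (cases x) (auto simp: epowr_def)

lemma epowr_mono: "x \<le> y \<Longrightarrow> 0 \<le> r \<Longrightarrow> epowr x r \<le> epowr y r"
  by (cases x; cases y) (auto simp: epowr_ennreal top_unique intro!: ennreal_leI powr_mono2)

text \<open>The mixed case \<open>0 * \<top> = 0\<close> is consistent because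
  \<open>0 powr r = 0\<close> for every \<open>r\<close>.\<close>

lemma epowr_mult: "epowr (x * y) r = epowr x r * epowr y r"
proof (cases x; cases y)
  fix a b :: real assume "0 \<le> a" "x = ennreal a" "0 \<le> b" "y = ennreal b"
  then show ?thesis by (simp add: epowr_ennreal powr_mult flip: ennreal_mult)
qed (auto simp: epowr_ennreal ennreal_mult_top ennreal_top_mult)

lemma epowr_epowr: "epowr (epowr x r) s = epowr x (r * s)"
  by (cases x) (auto simp: epowr_ennreal powr_powr)

text \<open>Trades a real bound on a norm for one on the moment, the form in which convexity is
  applied.\<close>

lemma epowr_inverse_le_iff:
  assumes "0 < p" "0 \<le> a"
  shows "epowr x (1 / p) \<le> ennreal a \<longleftrightarrow> x \<le> ennreal (a powr p)"
proof
  assume "epowr x (1 / p) \<le> ennreal a"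
  then have "epowr (epowr x (1 / p)) p \<le> epowr (ennreal a) p"
    using assms by (intro epowr_mono) auto
  then show "x \<le> ennreal (a powr p)"
    using assms by (simp add: epowr_epowr epowr_ennreal)
next
  assume "x \<le> ennreal (a powr p)"
  then have "epowr x (1 / p) \<le> epowr (ennreal (a powr p)) (1 / p)"
    using assms by (intro epowr_mono) auto
  then show "epowr x (1 / p) \<le> ennreal a"
    using assms by (simp add: epowr_ennreal powr_powr)
qed

lemma le_epowr_inverse_iff:
  assumes "0 < p" "0 \<le> a"
  shows "ennreal a \<le> epowr x (1 / p) \<longleftrightarrow> ennreal (a powr p) \<le> x"
proof
  assume "ennreal a \<le> epowr x (1 / p)"
  then have "epowr (ennreal a) p \<le> epowr (epowr x (1 / p)) p"
    using assms by (intro epowr_mono) auto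
  then show "ennreal (a powr p) \<le> x"
    using assms by (simp add: epowr_epowr epowr_ennreal)
next
  assume "ennreal (a powr p) \<le> x"
  then have "epowr (ennreal (a powr p)) (1 / p) \<le> epowr x (1 / p)"
    using assms by (intro epowr_mono) auto
  then show "ennreal a \<le> epowr x (1 / p)"
    using assms by (simp add: epowr_ennreal powr_powr)
qed

text \<open>Convexity is applied to positive \<open>u\<close> and \<open>v\<close>. If one of them
  is zero, the claim becomes \<open>(w * z) powr p \<le> w * z powr p\<close> for a weight
  \<open>w\<close> in (0,1], which follows from \<open>w powr p \<le> w\<close>.\<close>

lemma powr_weighted_mean_le:
  fixes u v l m p :: real
  assumes "1 \<le> p" "0 \<le> u" "0 \<le> v" "0 < l" "0 < m" "l + m = 1"
  shows "(l * u + m * v) powr p \<le> l * u powr p + m * v powr p"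
proof -
  have scaled: "(w * z) powr p \<le> w * z powr p" if "0 < w" "w \<le> 1" "0 \<le> z" for w z :: real
  proof -
    have "w powr p \<le> w"
      using that assms powr_mono'[of 1 p w] by simp
    then show ?thesis using that by (simp add: powr_mult mult_right_mono)
  qed
  consider "u = 0" | "v = 0" | "0 < u" "0 < v" using assms by linarith
  then show ?thesis
  proof cases
    case 1 then show ?thesis using scaled[of m v] assms by simp
  next
    case 2 then show ?thesis using scaled[of l u] assms by simp
  next
    case 3
    have l: "l = 1 - m" using assms by simp
    show ?thesis
      using convex_onD[OF powr_convex[OF assms(1)], of m u v] 3 assms unfolding l by simp
  qed
qed

text \<open>The convex case for the exponent \<open>1 / p\<close>, applied to
  \<open>u powr p\<close> and \<open>v powr p\<close> and then raised to the power
  \<open>p\<close>.\<close>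

lemma powr_weighted_mean_ge:
  fixes u v l m p :: real
  assumes "0 < p" "p \<le> 1" "0 \<le> u" "0 \<le> v" "0 < l" "0 < m" "l + m = 1"
  shows "l * u powr p + m * v powr p \<le> (l * u + m * v) powr p"
proof -
  have "(l * u powr p + m * v powr p) powr (1 / p) \<le> l * u + m * v"
    using powr_weighted_mean_le[of "1 / p" "u powr p" "v powr p" l m] assms
    by (simp add: powr_powr)
  then have "((l * u powr p + m * v powr p) powr (1 / p)) powr p \<le> (l * u + m * v) powr p"
    using assms by (intro powr_mono2) auto
  then show ?thesis using assms by (simp add: powr_powr)
qed

definition moment :: "'a measure \<Rightarrow> real \<Rightarrow> ('a \<Rightarrow> real) \<Rightarrow> ennreal" where
  "moment M p f = (\<integral>\<^sup>+\<omega>. ennreal (f \<omega> powr p) \<partial>M)"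

text \<open>For \<open>p < 1\<close> this is not a norm: on nonnegative functions Minkowski's
  inequality is reversed.\<close>

definition Lp_norm :: "'a measure \<Rightarrow> real \<Rightarrow> ('a \<Rightarrow> real) \<Rightarrow> ennreal" where
  "Lp_norm M p f = epowr (moment M p f) (1 / p)"

lemma moment_mono:
  assumes "0 < p" "\<And>\<omega>. \<omega> \<in> space M \<Longrightarrow> 0 \<le> f \<omega>" "\<And>\<omega>. \<omega> \<in> space M \<Longrightarrow> f \<omega> \<le> g \<omega>"
  shows "moment M p f \<le> moment M p g"
  unfolding moment_def using assms by (intro nn_integral_mono ennreal_leI powr_mono2) auto

lemma Lp_norm_mono:
  assumes "0 < p" "\<And>\<omega>. \<omega> \<in> space M \<Longrightarrow> 0 \<le> f \<omega>" "\<And>\<omega>. \<omega> \<in> space M \<Longrightarrow> f \<omega> \<le> g \<omega>"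
  shows "Lp_norm M p f \<le> Lp_norm M p g"
  unfolding Lp_norm_def using assms by (intro epowr_mono moment_mono) auto

lemma Lp_norm_zero: "0 < p \<Longrightarrow> Lp_norm M p (\<lambda>_. 0) = 0"
  by (simp add: Lp_norm_def moment_def)

lemma Lp_norm_cmult:
  assumes "0 < p" "0 \<le> c" "f \<in> borel_measurable M" "\<And>\<omega>. \<omega> \<in> space M \<Longrightarrow> 0 \<le> f \<omega>"
  shows "Lp_norm M p (\<lambda>\<omega>. c * f \<omega>) = ennreal c * Lp_norm M p f"
proof -
  have "moment M p (\<lambda>\<omega>. c * f \<omega>) = (\<integral>\<^sup>+\<omega>. ennreal (c powr p) * ennreal (f \<omega> powr p) \<partial>M)"
    unfolding moment_def using assms
    by (intro nn_integral_cong) (simp add: powr_mult flip: ennreal_mult)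
  also have "\<dots> = ennreal (c powr p) * moment M p f"
    unfolding moment_def using assms by (intro nn_integral_cmult) measurable
  finally show ?thesis
    using assms by (simp add: Lp_norm_def epowr_mult epowr_ennreal powr_powr)
qed

lemma nn_integral_weighted_powr:
  assumes [measurable]: "f \<in> borel_measurable M" "g \<in> borel_measurable M"
    and "0 \<le> a" "0 \<le> b"
  shows "(\<integral>\<^sup>+\<omega>. ennreal (a * f \<omega> powr p + b * g \<omega> powr p) \<partial>M) =
    ennreal a * moment M p f + ennreal b * moment M p g"
proof -
  have "(\<integral>\<^sup>+\<omega>. ennreal (a * f \<omega> powr p + b * g \<omega> powr p) \<partial>M) =
    (\<integral>\<^sup>+\<omega>. (ennreal a * ennreal (f \<omega> powr p) + ennreal b * ennreal (g \<omega> powr p)) \<partial>M)"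
    using assms by (intro nn_integral_cong) (simp add: ennreal_mult)
  also have "\<dots> = ennreal a * moment M p f + ennreal b * moment M p g"
    unfolding moment_def by (simp add: nn_integral_add nn_integral_cmult)
  finally show ?thesis .
qed

text \<open>Convexity of \<open>x \<mapsto> x powr p\<close>, applied to \<open>f / a\<close> and \<open>g / b\<close> with weights proportional
  to the bounds \<open>a\<close> and \<open>b\<close> of the norms.\<close>

lemma
  assumes [measurable]: "f \<in> borel_measurable M" "g \<in> borel_measurable M"
    and nonneg: "\<And>\<omega>. \<omega> \<in> space M \<Longrightarrow> 0 \<le> f \<omega>" "\<And>\<omega>. \<omega> \<in> space M \<Longrightarrow> 0 \<le> g \<omega>"
    and ab: "0 < a" "0 < b"
  shows moment_add_le: "1 \<le> p \<Longrightarrow> moment M p f \<le> ennreal (a powr p) \<Longrightarrow>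
      moment M p g \<le> ennreal (b powr p) \<Longrightarrow>
      moment M p (\<lambda>\<omega>. f \<omega> + g \<omega>) \<le> ennreal ((a + b) powr p)"
    and moment_add_ge: "0 < p \<Longrightarrow> p \<le> 1 \<Longrightarrow> ennreal (a powr p) \<le> moment M p f \<Longrightarrow>
      ennreal (b powr p) \<le> moment M p g \<Longrightarrow>
      ennreal ((a + b) powr p) \<le> moment M p (\<lambda>\<omega>. f \<omega> + g \<omega>)"
proof -
  define l m where "l = a / (a + b)" and "m = b / (a + b)"
  have lm: "0 < l" "0 < m" "l + m = 1"
    using ab by (auto simp: l_def m_def simp flip: add_divide_distrib)
  define s where "s = (a + b) powr p"
  \<comment> \<open>Scaled so that \<open>c * a powr p + d * b powr p = s\<close>; a pointwise
    comparison of \<open>(f + g) powr p\<close> with \<open>c * f powr p + d * g powr p\<close> then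
    integrates to the claim.\<close>
  define c d where "c = s * l / a powr p" and "d = s * m / b powr p"
  have s: "s > 0" using ab by (simp add: s_def)
  have cd: "0 \<le> c" "0 \<le> d" using ab lm s by (auto simp: c_def d_def)
  have sum: "f \<omega> + g \<omega> = (a + b) * (l * (f \<omega> / a) + m * (g \<omega> / b))" for \<omega>
  proof -
    have "(a + b) * (l * (f \<omega> / a)) = f \<omega>" "(a + b) * (m * (g \<omega> / b)) = g \<omega>"
      using ab by (simp_all add: l_def m_def)
    then show ?thesis by (simp only: distrib_left)
  qed
  have sump: "(f \<omega> + g \<omega>) powr p = s * (l * (f \<omega> / a) + m * (g \<omega> / b)) powr p"
    if "\<omega> \<in> space M" for \<omega>
    using ab lm nonneg[OF that] unfolding sum s_def by (subst powr_mult) auto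
  have right: "c * f \<omega> powr p + d * g \<omega> powr p =
      s * (l * (f \<omega> / a) powr p + m * (g \<omega> / b) powr p)" if "\<omega> \<in> space M" for \<omega>
    using ab nonneg[OF that] by (simp add: c_def d_def powr_divide field_simps)
  have total: "ennreal c * ennreal (a powr p) + ennreal d * ennreal (b powr p) = ennreal s"
  proof -
    have "c * a powr p + d * b powr p = s"
      using ab lm by (simp add: c_def d_def flip: distrib_left)
    then show ?thesis using cd by (simp flip: ennreal_mult ennreal_plus)
  qed
  show "moment M p (\<lambda>\<omega>. f \<omega> + g \<omega>) \<le> ennreal ((a + b) powr p)"
    if p: "1 \<le> p" and *: "moment M p f \<le> ennreal (a powr p)" "moment M p g \<le> ennreal (b powr p)"
  proof -
    have "moment M p (\<lambda>\<omega>. f \<omega> + g \<omega>) \<le> (\<integral>\<^sup>+\<omega>. ennreal (c * f \<omega> powr p + d * g \<omega> powr p) \<partial>M)"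
      unfolding moment_def
    proof (intro nn_integral_mono ennreal_leI)
      fix \<omega> assume w: "\<omega> \<in> space M"
      show "(f \<omega> + g \<omega>) powr p \<le> c * f \<omega> powr p + d * g \<omega> powr p"
        unfolding sump[OF w] right[OF w]
        using p ab lm s nonneg[OF w] by (intro mult_left_mono powr_weighted_mean_le) auto
    qed
    also have "\<dots> = ennreal c * moment M p f + ennreal d * moment M p g"
      using cd by (intro nn_integral_weighted_powr) auto
    also have "\<dots> \<le> ennreal c * ennreal (a powr p) + ennreal d * ennreal (b powr p)"
      using * by (intro add_mono mult_left_mono) auto
    finally show ?thesis unfolding total s_def .
  qed
  show "ennreal ((a + b) powr p) \<le> moment M p (\<lambda>\<omega>. f \<omega> + g \<omega>)"
    if p: "0 < p" "p \<le> 1"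
      and *: "ennreal (a powr p) \<le> moment M p f" "ennreal (b powr p) \<le> moment M p g"
  proof -
    have "ennreal s \<le> ennreal c * moment M p f + ennreal d * moment M p g"
      unfolding total[symmetric] using * by (intro add_mono mult_left_mono) auto
    also have "\<dots> = (\<integral>\<^sup>+\<omega>. ennreal (c * f \<omega> powr p + d * g \<omega> powr p) \<partial>M)"
      using cd by (intro nn_integral_weighted_powr[symmetric]) auto
    also have "\<dots> \<le> moment M p (\<lambda>\<omega>. f \<omega> + g \<omega>)"
      unfolding moment_def
    proof (intro nn_integral_mono ennreal_leI)
      fix \<omega> assume w: "\<omega> \<in> space M"
      show "c * f \<omega> powr p + d * g \<omega> powr p \<le> (f \<omega> + g \<omega>) powr p"
        unfolding sump[OF w] right[OF w]
        using p ab lm s nonneg[OF w] by (intro mult_left_mono powr_weighted_mean_ge) auto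
    qed
    finally show ?thesis unfolding s_def .
  qed
qed

lemma Lp_norm_add_le:
  assumes [measurable]: "f \<in> borel_measurable M" "g \<in> borel_measurable M"
    and nonneg: "\<And>\<omega>. \<omega> \<in> space M \<Longrightarrow> 0 \<le> f \<omega>" "\<And>\<omega>. \<omega> \<in> space M \<Longrightarrow> 0 \<le> g \<omega>"
    and p: "1 \<le> p"
  shows "Lp_norm M p (\<lambda>\<omega>. f \<omega> + g \<omega>) \<le> Lp_norm M p f + Lp_norm M p g"
proof (cases "Lp_norm M p f"; cases "Lp_norm M p g")
  fix x y assume xy: "0 \<le> x" "Lp_norm M p f = ennreal x" "0 \<le> y" "Lp_norm M p g = ennreal y"
  show ?thesis
  proof (rule ennreal_le_epsilon)
    \<comment> \<open>The bounds \<open>a\<close> and \<open>b\<close> must be positive although the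
      norms may vanish; \<open>e\<close> provides the room.\<close>
    fix e :: real assume e: "0 < e"
    define a b where "a = x + e / 2" and "b = y + e / 2"
    have "Lp_norm M p f \<le> ennreal a" "Lp_norm M p g \<le> ennreal b" "0 < a" "0 < b"
      using xy e by (auto simp: a_def b_def intro!: ennreal_leI)
    then have "moment M p (\<lambda>\<omega>. f \<omega> + g \<omega>) \<le> ennreal ((a + b) powr p)"
      using p by (intro moment_add_le nonneg) (auto simp: Lp_norm_def epowr_inverse_le_iff)
    then have "Lp_norm M p (\<lambda>\<omega>. f \<omega> + g \<omega>) \<le> ennreal (a + b)"
      using p \<open>0 < a\<close> \<open>0 < b\<close> by (simp add: Lp_norm_def epowr_inverse_le_iff del: ennreal_plus)
    also have "a + b = x + y + e" by (simp add: a_def b_def)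
    finally show "Lp_norm M p (\<lambda>\<omega>. f \<omega> + g \<omega>) \<le> Lp_norm M p f + Lp_norm M p g + ennreal e"
      using xy e by simp
  qed
qed auto

lemma Lp_norm_add_ge:
  assumes [measurable]: "f \<in> borel_measurable M" "g \<in> borel_measurable M"
    and nonneg: "\<And>\<omega>. \<omega> \<in> space M \<Longrightarrow> 0 \<le> f \<omega>" "\<And>\<omega>. \<omega> \<in> space M \<Longrightarrow> 0 \<le> g \<omega>"
    and p: "0 < p" "p \<le> 1"
  shows "Lp_norm M p f + Lp_norm M p g \<le> Lp_norm M p (\<lambda>\<omega>. f \<omega> + g \<omega>)"
proof -
  let ?h = "\<lambda>\<omega>. f \<omega> + g \<omega>"
  have fh: "Lp_norm M p f \<le> Lp_norm M p ?h" and gh: "Lp_norm M p g \<le> Lp_norm M p ?h"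
    using p nonneg by (auto intro!: Lp_norm_mono)
  show ?thesis
  proof (cases "Lp_norm M p f"; cases "Lp_norm M p g")
    fix x y assume xy: "0 \<le> x" "Lp_norm M p f = ennreal x" "0 \<le> y" "Lp_norm M p g = ennreal y"
    \<comment> \<open>A zero norm cannot serve as a positive bound; monotonicity alone settles that
      case.\<close>
    consider "x = 0" | "y = 0" | "0 < x" "0 < y" using xy by linarith
    then show ?thesis
    proof cases
      case 1 then show ?thesis using xy gh by simp
    next
      case 2 then show ?thesis using xy fh by simp
    next
      case 3
      have "ennreal x \<le> Lp_norm M p f" "ennreal y \<le> Lp_norm M p g" using xy by auto
      then have "ennreal ((x + y) powr p) \<le> moment M p ?h"
        using p 3 by (intro moment_add_ge nonneg) (auto simp: Lp_norm_def le_epowr_inverse_iff)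
      then show ?thesis using p xy by (simp add: Lp_norm_def le_epowr_inverse_iff flip: ennreal_plus)
    qed
  qed (use fh gh in \<open>auto simp: top_unique\<close>)
qed

lemma Lp_norm_sum_le:
  assumes "finite I" "1 \<le> p" "\<And>i. i \<in> I \<Longrightarrow> f i \<in> borel_measurable M"
    and "\<And>i \<omega>. i \<in> I \<Longrightarrow> \<omega> \<in> space M \<Longrightarrow> 0 \<le> f i \<omega>"
  shows "Lp_norm M p (\<lambda>\<omega>. \<Sum>i\<in>I. f i \<omega>) \<le> (\<Sum>i\<in>I. Lp_norm M p (f i))"
  using assms
proof (induction I rule: finite_induct)
  case (insert i I)
  then have "Lp_norm M p (\<lambda>\<omega>. \<Sum>i\<in>insert i I. f i \<omega>) \<le>
      Lp_norm M p (f i) + Lp_norm M p (\<lambda>\<omega>. \<Sum>i\<in>I. f i \<omega>)"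
    by (simp, intro Lp_norm_add_le) (auto intro!: sum_nonneg)
  also have "\<dots> \<le> Lp_norm M p (f i) + (\<Sum>i\<in>I. Lp_norm M p (f i))"
    using insert by (intro add_left_mono insert.IH) auto
  finally show ?case using insert by simp
qed (simp add: Lp_norm_zero)

lemma Lp_norm_sum_ge:
  assumes "finite I" "0 < p" "p \<le> 1" "\<And>i. i \<in> I \<Longrightarrow> f i \<in> borel_measurable M"
    and "\<And>i \<omega>. i \<in> I \<Longrightarrow> \<omega> \<in> space M \<Longrightarrow> 0 \<le> f i \<omega>"
  shows "(\<Sum>i\<in>I. Lp_norm M p (f i)) \<le> Lp_norm M p (\<lambda>\<omega>. \<Sum>i\<in>I. f i \<omega>)"
  using assms
proof (induction I rule: finite_induct)
  case (insert i I)
  have "(\<Sum>i\<in>insert i I. Lp_norm M p (f i)) \<le>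
      Lp_norm M p (f i) + Lp_norm M p (\<lambda>\<omega>. \<Sum>i\<in>I. f i \<omega>)"
    using insert by (simp add: add_left_mono)
  also have "\<dots> \<le> Lp_norm M p (\<lambda>\<omega>. \<Sum>i\<in>insert i I. f i \<omega>)"
    using insert by (simp, intro Lp_norm_add_ge) (auto intro!: sum_nonneg)
  finally show ?case .
qed (simp add: Lp_norm_zero)

text \<open>After division by the sum every term is at most 1, so its \<open>q\<close>-th power is
  at most the term itself.\<close>

lemma sum_powr_le_powr_sum:
  fixes f :: "'a \<Rightarrow> real"
  assumes "1 \<le> q" "\<And>i. i \<in> I \<Longrightarrow> 0 \<le> f i"
  shows "(\<Sum>i\<in>I. f i powr q) \<le> (\<Sum>i\<in>I. f i) powr q"
proof (cases "(\<Sum>i\<in>I. f i) = 0 \<or> infinite I")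
  case False
  define s where "s = (\<Sum>i\<in>I. f i)"
  have s: "0 < s" using False assms sum_nonneg[of I f] by (auto simp: s_def less_le)
  have "f i powr q \<le> s powr q * (f i / s)" if i: "i \<in> I" for i
  proof -
    have "f i \<le> s" using False i assms(2) unfolding s_def by (intro member_le_sum) auto
    then have "(f i / s) powr q \<le> f i / s"
      using powr_mono'[of 1 q "f i / s"] assms i s by (cases "f i = 0") auto
    then show ?thesis using s assms(2)[OF i] by (simp add: powr_divide field_simps)
  qed
  then have "(\<Sum>i\<in>I. f i powr q) \<le> (\<Sum>i\<in>I. s powr q * (f i / s))"
    by (intro sum_mono) auto
  also have "\<dots> = s powr q"
    using s unfolding sum_distrib_left[symmetric] sum_divide_distrib[symmetric] s_def[symmetric] by simp
  finally show ?thesis by (simp add: s_def)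
next
  case True
  then have "infinite I \<or> (\<forall>i\<in>I. f i = 0)"
    using assms by (auto simp: sum_nonneg_eq_0_iff)
  then show ?thesis by auto
qed

text \<open>The previous inequality for the exponent \<open>1 / q\<close>, applied to the terms
  \<open>f i powr q\<close>.\<close>

lemma powr_sum_le_sum_powr:
  fixes f :: "'a \<Rightarrow> real"
  assumes "0 < q" "q \<le> 1" "\<And>i. i \<in> I \<Longrightarrow> 0 \<le> f i"
  shows "(\<Sum>i\<in>I. f i) powr q \<le> (\<Sum>i\<in>I. f i powr q)"
proof -
  have "(\<Sum>i\<in>I. f i) = (\<Sum>i\<in>I. (f i powr q) powr (1 / q))"
    using assms by (intro sum.cong) (auto simp: powr_powr)
  also have "\<dots> \<le> (\<Sum>i\<in>I. f i powr q) powr (1 / q)"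
    using assms by (intro sum_powr_le_powr_sum) auto
  finally have "(\<Sum>i\<in>I. f i) powr q \<le> ((\<Sum>i\<in>I. f i powr q) powr (1 / q)) powr q"
    using assms by (intro powr_mono2 sum_nonneg) auto
  then show ?thesis using assms by (simp add: powr_powr sum_nonneg)
qed

section \<open>Pairs of paths\<close>

text \<open>A path is encoded by its starting point \<open>u\<close> and the list of its positive increments, so that
  concatenation of paths is \<^const>\<open>append\<close>.\<close>

fun wt :: "(int \<Rightarrow> nat \<Rightarrow> real) \<Rightarrow> int \<Rightarrow> nat list \<Rightarrow> real" where
  "wt \<alpha> u [] = 1"
| "wt \<alpha> u (j # js) = \<alpha> u j * wt \<alpha> (u + int j) js"

definition steps :: "nat list set" where
  "steps = {js. 0 \<notin> set js}"

definition steps_upto :: "nat \<Rightarrow> nat list set" where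
  "steps_upto N = {js. 0 \<notin> set js \<and> sum_list js \<le> N}"

definition path_sum :: "(int \<Rightarrow> nat \<Rightarrow> real) \<Rightarrow> (int \<Rightarrow> real) \<Rightarrow> nat \<Rightarrow> int \<Rightarrow> real" where
  "path_sum \<alpha> \<beta> N u = (\<Sum>js\<in>steps_upto N. wt \<alpha> u js * \<beta> (u + int (sum_list js)))"

text \<open>For a path, these are the points other than its start, measured from the start; the end
  point belongs to them unless the path is trivial.\<close>

definition psums :: "nat list \<Rightarrow> nat set" where
  "psums js = {sum_list xs |xs ys. js = xs @ ys \<and> xs \<noteq> []}"

text \<open>Membership of the end in the intersection forces both lists to be nonempty. With
  positive increments an interior point never equals the common end, so the condition amounts to
  having no common interior point.\<close>

definition closed_steps :: "(nat list \<times> nat list) set" where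
  "closed_steps = {(x, y). x \<in> steps \<and> y \<in> steps \<and> sum_list x = sum_list y \<and>
     psums x \<inter> psums y = {sum_list x}}"

definition closed_upto :: "nat \<Rightarrow> (nat list \<times> nat list) set" where
  "closed_upto N = {(x, y) \<in> closed_steps. sum_list x \<le> N}"

text \<open>Pairs with a trivial path are included, in particular \<open>([], [])\<close>.\<close>

definition disjoint_upto :: "nat \<Rightarrow> (nat list \<times> nat list) set" where
  "disjoint_upto N = {(x, y) \<in> steps_upto N \<times> steps_upto N. psums x \<inter> psums y = {}}"

lemma wt_append: "wt \<alpha> u (x @ y) = wt \<alpha> u x * wt \<alpha> (u + int (sum_list x)) y"
  by (induction x arbitrary: u) (auto simp: algebra_simps)

lemma wt_nonneg: "(\<And>u j. 1 \<le> j \<Longrightarrow> 0 \<le> \<alpha> u j) \<Longrightarrow> js \<in> steps \<Longrightarrow> 0 \<le> wt \<alpha> u js"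
  by (induction js arbitrary: u) (auto simp: steps_def)

lemma wt_powr:
  "(\<And>u j. 1 \<le> j \<Longrightarrow> 0 \<le> \<alpha> u j) \<Longrightarrow> js \<in> steps \<Longrightarrow>
    wt (\<lambda>u j. \<alpha> u j powr q) u js = wt \<alpha> u js powr q"
proof (induction js arbitrary: u)
  case (Cons j js)
  then have "0 \<le> \<alpha> u j" "0 \<le> wt \<alpha> (u + int j) js"
    by (auto simp: steps_def intro!: wt_nonneg)
  with Cons show ?case by (simp add: powr_mult steps_def)
qed auto

lemma steps_upto_steps: "js \<in> steps_upto N \<Longrightarrow> js \<in> steps"
  by (simp add: steps_upto_def steps_def)

lemma length_le_sum_list: "0 \<notin> set js \<Longrightarrow> length js \<le> sum_list js"
  for js :: "nat list"
proof (induction js)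
  case (Cons a js)
  then show ?case by (cases a) auto
qed auto

lemma finite_steps_upto [simp]: "finite (steps_upto N)"
proof (rule finite_subset)
  show "steps_upto N \<subseteq> {js. set js \<subseteq> {..N} \<and> length js \<le> N}"
  proof
    fix js assume js: "js \<in> steps_upto N"
    have "j \<le> N" if "j \<in> set js" for j
      using member_le_sum_list[OF that] js by (simp add: steps_upto_def)
    then show "js \<in> {js. set js \<subseteq> {..N} \<and> length js \<le> N}"
      using js length_le_sum_list[of js] by (auto simp: steps_upto_def)
  qed
qed (rule finite_lists_length_le, simp)

lemma steps_upto_eq:
  "steps_upto N = insert [] (\<Union>j\<in>{1..N}. (#) j ` steps_upto (N - j))"
proof (intro set_eqI iffI)
  fix js assume "js \<in> steps_upto N"
  then show "js \<in> insert [] (\<Union>j\<in>{1..N}. (#) j ` steps_upto (N - j))"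
  proof (cases js)
    case (Cons j ks)
    then have "j \<in> {1..N}" "ks \<in> steps_upto (N - j)"
      using \<open>js \<in> steps_upto N\<close> by (auto simp: steps_upto_def)
    then show ?thesis using Cons by blast
  qed simp
qed (auto simp: steps_upto_def)

lemma sum_steps_upto:
  fixes f :: "nat list \<Rightarrow> 'a :: comm_monoid_add"
  shows "(\<Sum>js\<in>steps_upto N. f js) = f [] + (\<Sum>j=1..N. \<Sum>js\<in>steps_upto (N - j). f (j # js))"
proof -
  have "(\<Sum>js\<in>steps_upto N. f js) =
      f [] + (\<Sum>js\<in>(\<Union>j\<in>{1..N}. (#) j ` steps_upto (N - j)). f js)"
    by (subst steps_upto_eq, subst sum.insert) auto
  also have "(\<Sum>js\<in>(\<Union>j\<in>{1..N}. (#) j ` steps_upto (N - j)). f js) =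
      (\<Sum>j=1..N. \<Sum>js\<in>(#) j ` steps_upto (N - j). f js)"
    by (rule sum.UNION_disjoint) auto
  also have "\<dots> = (\<Sum>j=1..N. \<Sum>js\<in>steps_upto (N - j). f (j # js))"
    by (simp add: sum.reindex)
  finally show ?thesis .
qed

lemma path_sum_eq:
  "path_sum \<alpha> \<beta> N u = \<beta> u + (\<Sum>j=1..N. \<alpha> u j * path_sum \<alpha> \<beta> (N - j) (u + int j))"
  unfolding path_sum_def
  by (subst sum_steps_upto) (simp add: sum_distrib_left algebra_simps)

lemma path_sum_nonneg:
  "(\<And>u j. 1 \<le> j \<Longrightarrow> 0 \<le> \<alpha> u j) \<Longrightarrow> (\<And>u. 0 \<le> \<beta> u) \<Longrightarrow> 0 \<le> path_sum \<alpha> \<beta> N u"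
  unfolding path_sum_def by (auto intro!: sum_nonneg mult_nonneg_nonneg wt_nonneg steps_upto_steps)

lemma path_sum_mono:
  assumes "\<And>u j. 1 \<le> j \<Longrightarrow> 0 \<le> \<alpha> u j" "\<And>u. 0 \<le> \<beta> u" "N \<le> N'"
  shows "path_sum \<alpha> \<beta> N u \<le> path_sum \<alpha> \<beta> N' u"
  unfolding path_sum_def
proof (rule sum_mono2)
  show "steps_upto N \<subseteq> steps_upto N'" using assms(3) by (auto simp: steps_upto_def)
qed (use assms in \<open>auto intro!: mult_nonneg_nonneg wt_nonneg steps_upto_steps\<close>)

text \<open>Subadditivity of \<open>x powr q\<close> over the paths, and multiplicativity along each
  path: the bound is again a path sum, with powered weights.\<close>

lemma path_sum_powr_le:
  assumes a: "\<And>u j. 1 \<le> j \<Longrightarrow> 0 \<le> \<alpha> u j" "\<And>u. 0 \<le> \<beta> u" and q: "0 < q" "q \<le> 1"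
  shows "path_sum \<alpha> \<beta> N u powr q \<le> path_sum (\<lambda>u j. \<alpha> u j powr q) (\<lambda>u. \<beta> u powr q) N u"
proof -
  have "path_sum \<alpha> \<beta> N u powr q \<le>
      (\<Sum>js\<in>steps_upto N. (wt \<alpha> u js * \<beta> (u + int (sum_list js))) powr q)"
    unfolding path_sum_def using assms
    by (intro powr_sum_le_sum_powr) (auto intro!: mult_nonneg_nonneg wt_nonneg steps_upto_steps)
  also have "\<dots> = path_sum (\<lambda>u j. \<alpha> u j powr q) (\<lambda>u. \<beta> u powr q) N u"
    unfolding path_sum_def
    by (intro sum.cong refl) (use a in \<open>simp add: wt_powr wt_nonneg powr_mult steps_upto_steps\<close>)
  finally show ?thesis .
qed

text \<open>Powers with \<open>q \<ge> 1\<close> are superadditive, so the powered weights now give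
  a lower bound.\<close>

lemma path_sum_powr_ge:
  assumes a: "\<And>u j. 1 \<le> j \<Longrightarrow> 0 \<le> \<alpha> u j" "\<And>u. 0 \<le> \<beta> u" and q: "1 \<le> q"
  shows "path_sum (\<lambda>u j. \<alpha> u j powr q) (\<lambda>u. \<beta> u powr q) N u \<le> path_sum \<alpha> \<beta> N u powr q"
proof -
  have "path_sum (\<lambda>u j. \<alpha> u j powr q) (\<lambda>u. \<beta> u powr q) N u =
      (\<Sum>js\<in>steps_upto N. (wt \<alpha> u js * \<beta> (u + int (sum_list js))) powr q)"
    unfolding path_sum_def
    by (intro sum.cong refl) (use a in \<open>simp add: wt_powr wt_nonneg powr_mult steps_upto_steps\<close>)
  also have "\<dots> \<le> path_sum \<alpha> \<beta> N u powr q"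
    unfolding path_sum_def using assms
    by (intro sum_powr_le_powr_sum) (auto intro!: mult_nonneg_nonneg wt_nonneg steps_upto_steps)
  finally show ?thesis .
qed

section \<open>Splitting a pair of paths at its first common point\<close>

lemma psums_Nil [simp]: "psums [] = {}"
  by (auto simp: psums_def)

lemma psums_Cons [simp]: "psums (j # js) = insert j ((+) j ` psums js)"
proof (intro set_eqI iffI)
  fix m assume "m \<in> psums (j # js)"
  then obtain xs ys where xs: "j # js = xs @ ys" "xs \<noteq> []" "m = sum_list xs"
    by (auto simp: psums_def)
  then obtain xs' where xs': "xs = j # xs'" "js = xs' @ ys" by (cases xs) auto
  show "m \<in> insert j ((+) j ` psums js)"
  proof (cases "xs' = []")
    case False
    then have "sum_list xs' \<in> psums js" using xs' by (auto simp: psums_def)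
    then show ?thesis using xs xs' by auto
  qed (use xs xs' in auto)
next
  fix m assume "m \<in> insert j ((+) j ` psums js)"
  then consider "m = j" | xs ys where "js = xs @ ys" "m = j + sum_list xs"
    by (auto simp: psums_def)
  then show "m \<in> psums (j # js)"
  proof cases
    case 1
    then show ?thesis unfolding psums_def by (intro CollectI exI[of _ "[j]"] exI[of _ js]) auto
  next
    case 2
    then show ?thesis
      unfolding psums_def by (intro CollectI exI[of _ "j # xs"] exI[of _ ys]) auto
  qed
qed

lemma psums_append: "psums (x @ y) = psums x \<union> (+) (sum_list x) ` psums y"
proof (induction x)
  case (Cons a x)
  show ?case by (simp add: Cons image_Un image_image add.assoc)
qed simp

lemma psums_pos: "js \<in> steps \<Longrightarrow> m \<in> psums js \<Longrightarrow> 0 < m"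
  by (cases js) (auto simp: steps_def)

lemma psums_le_sum_list: "m \<in> psums js \<Longrightarrow> m \<le> sum_list js"
  by (auto simp: psums_def)

lemma sum_list_in_psums: "js \<noteq> [] \<Longrightarrow> sum_list js \<in> psums js"
  unfolding psums_def by (intro CollectI exI[of _ js] exI[of _ "[]"]) auto

text \<open>Positive entries make prefix sums strictly increasing, so the sum of a prefix determines
  where the list is cut.\<close>

lemma append_eq_append_sum_list_unique:
  fixes x y :: "nat list"
  assumes "x @ y = x' @ y'" "sum_list x = sum_list x'" "x @ y \<in> steps"
  shows "x = x' \<and> y = y'"
proof -
  have "us = []" if "us \<in> steps" "sum_list us = 0" for us
    using that by (cases us) (auto simp: steps_def)
  then show ?thesis
    using assms by (auto simp: append_eq_append_conv2 steps_def)
qed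

text \<open>A common point that is not on both heads lies on at least one tail, hence beyond the
  common end of the heads. Together with the next lemma this makes \<open>sum_list x\<close> the
  least common partial sum, which is why the splitting is unique.\<close>

lemma closed_steps_append_inter:
  assumes "(x, y) \<in> closed_steps" "js \<in> steps" "ks \<in> steps"
    and "m \<in> psums (x @ js) \<inter> psums (y @ ks)"
  shows "sum_list x \<le> m"
proof -
  have s: "sum_list x = sum_list y" "psums x \<inter> psums y = {sum_list x}"
    using assms by (auto simp: closed_steps_def)
  show ?thesis
  proof (cases "m \<in> psums x \<and> m \<in> psums y")
    case True
    then have "m \<in> psums x \<inter> psums y" by simp
    then show ?thesis using s(2) by simp
  next
    case False
    then show ?thesis using assms(4) s(1) by (auto simp: psums_append)
  qed
qed

lemma closed_steps_sum_in:
  assumes "(x, y) \<in> closed_steps"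
  shows "sum_list x \<in> psums (x @ js) \<inter> psums (y @ ks)"
  using assms by (auto simp: closed_steps_def psums_append)

text \<open>The cut is made at the least common partial sum; minimality leaves the heads without an
  earlier common point.\<close>

lemma common_psum_split:
  assumes "js \<in> steps" "ks \<in> steps" "psums js \<inter> psums ks \<noteq> {}"
  obtains x y js' ks' where "js = x @ js'" "ks = y @ ks'" "(x, y) \<in> closed_steps"
proof -
  define c where "c = (LEAST m. m \<in> psums js \<inter> psums ks)"
  obtain m where "m \<in> psums js \<inter> psums ks" using assms(3) by blast
  then have c: "c \<in> psums js \<inter> psums ks"
    unfolding c_def by (rule LeastI[of "\<lambda>m. m \<in> psums js \<inter> psums ks"])
  have least: "c \<le> m" if "m \<in> psums js \<inter> psums ks" for m
    unfolding c_def using that by (rule Least_le[of "\<lambda>m. m \<in> psums js \<inter> psums ks"])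
  from c obtain x js' where x: "js = x @ js'" "x \<noteq> []" "c = sum_list x"
    by (auto simp: psums_def)
  from c obtain y ks' where y: "ks = y @ ks'" "y \<noteq> []" "c = sum_list y"
    by (auto simp: psums_def)
  have "psums x \<inter> psums y = {c}"
  proof (intro set_eqI iffI)
    fix m assume m: "m \<in> psums x \<inter> psums y"
    then have "c \<le> m" using x y by (intro least) (auto simp: psums_append)
    moreover have "m \<le> c" using m x psums_le_sum_list by auto
    ultimately show "m \<in> {c}" by simp
  qed (use sum_list_in_psums[of x] sum_list_in_psums[of y] x y in auto)
  then have "(x, y) \<in> closed_steps"
    using assms x y by (auto simp: closed_steps_def steps_def)
  with x y that show thesis by blast
qed

lemma finite_closed_upto [simp]: "finite (closed_upto N)"
proof (rule finite_subset)
  show "closed_upto N \<subseteq> steps_upto N \<times> steps_upto N"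
    by (auto simp: closed_upto_def closed_steps_def steps_def steps_upto_def)
qed simp

lemma closed_upto_closed: "x \<in> closed_upto N \<Longrightarrow> x \<in> closed_steps"
  by (auto simp: closed_upto_def)

lemma finite_disjoint_upto [simp]: "finite (disjoint_upto N)"
  by (rule finite_subset[of _ "steps_upto N \<times> steps_upto N"]) (auto simp: disjoint_upto_def)

lemma sum_step_pairs:
  fixes f :: "nat list \<times> nat list \<Rightarrow> 'a :: comm_monoid_add"
  shows "(\<Sum>z\<in>steps_upto N \<times> steps_upto N. f z) = (\<Sum>z\<in>disjoint_upto N. f z) +
    (\<Sum>(x, y)\<in>closed_upto N.
       \<Sum>(js, ks)\<in>steps_upto (N - sum_list x) \<times> steps_upto (N - sum_list x). f (x @ js, y @ ks))"
proof -
  let ?S = "steps_upto N \<times> steps_upto N"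
  let ?T = "SIGMA z:closed_upto N. steps_upto (N - sum_list (fst z)) \<times> steps_upto (N - sum_list (fst z))"
  let ?g = "\<lambda>((x, y), (js, ks)). (x @ js, y @ ks)"
  have bij: "bij_betw ?g ?T (?S - disjoint_upto N)"
    unfolding bij_betw_def
  proof
    \<comment> \<open>Both closed pairs end at the least common partial sum of the same two lists,
      so the cuts coincide.\<close>
    show "inj_on ?g ?T"
    proof (rule inj_onI)
      fix z w assume zw: "z \<in> ?T" "w \<in> ?T" "?g z = ?g w"
      obtain x y js ks where z: "z = ((x, y), js, ks)" by (metis surj_pair)
      obtain x' y' js' ks' where w: "w = ((x', y'), js', ks')" by (metis surj_pair)
      from zw have h: "(x, y) \<in> closed_upto N" "(x', y') \<in> closed_upto N"
        "js \<in> steps_upto (N - sum_list (fst (x, y)))" "ks \<in> steps_upto (N - sum_list (fst (x, y)))"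
        "js' \<in> steps_upto (N - sum_list (fst (x', y')))" "ks' \<in> steps_upto (N - sum_list (fst (x', y')))"
        and e: "x @ js = x' @ js'" "y @ ks = y' @ ks'"
        unfolding z w by auto
      note cl = h(1,2)[THEN closed_upto_closed] and st = h(3-6)[THEN steps_upto_steps]
      have "sum_list x \<le> sum_list x'"
        using closed_steps_append_inter[OF cl(1) st(1,2)] closed_steps_sum_in[OF cl(2), of js' ks']
        unfolding e by blast
      moreover have "sum_list x' \<le> sum_list x"
        using closed_steps_append_inter[OF cl(2) st(3,4)] closed_steps_sum_in[OF cl(1), of js ks]
        unfolding e by blast
      ultimately have "sum_list x = sum_list x'" by simp
      moreover from this cl have "sum_list y = sum_list y'"
        by (auto simp: closed_steps_def)
      moreover have "x @ js \<in> steps" "y @ ks \<in> steps"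
        using cl(1) st by (auto simp: closed_steps_def steps_def)
      ultimately show "z = w"
        unfolding z w using append_eq_append_sum_list_unique[OF e(1)] append_eq_append_sum_list_unique[OF e(2)]
        by simp
    qed
    show "?g ` ?T = ?S - disjoint_upto N"
    proof (intro set_eqI iffI)
      fix z assume "z \<in> ?g ` ?T"
      then obtain x y js ks where z: "z = (x @ js, y @ ks)" "(x, y) \<in> closed_upto N"
        "js \<in> steps_upto (N - sum_list x)" "ks \<in> steps_upto (N - sum_list x)" by auto
      have "z \<notin> disjoint_upto N"
        using closed_steps_sum_in[OF closed_upto_closed[OF z(2)], of js ks] z(1)
        by (auto simp: disjoint_upto_def)
      moreover have "z \<in> ?S"
        using z by (auto simp: closed_upto_def closed_steps_def steps_def steps_upto_def)
      ultimately show "z \<in> ?S - disjoint_upto N" by simp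
    next
      fix z assume z: "z \<in> ?S - disjoint_upto N"
      then obtain js ks where e: "z = (js, ks)" by (cases z)
      from z e have st: "js \<in> steps" "ks \<in> steps" "psums js \<inter> psums ks \<noteq> {}"
        by (auto simp: disjoint_upto_def intro: steps_upto_steps)
      obtain x y js' ks' where s: "js = x @ js'" "ks = y @ ks'" "(x, y) \<in> closed_steps"
        using common_psum_split[OF st] .
      have "sum_list x = sum_list y" using s by (auto simp: closed_steps_def)
      then have "((x, y), (js', ks')) \<in> ?T"
        using z s unfolding e by (auto simp: closed_upto_def steps_upto_def)
      then show "z \<in> ?g ` ?T" unfolding e s
        by (rule image_eqI[where x = "((x, y), (js', ks'))", rotated]) simp
    qed
  qed
  have "(\<Sum>z\<in>?S. f z) = (\<Sum>z\<in>disjoint_upto N. f z) + (\<Sum>z\<in>?S - disjoint_upto N. f z)"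
    by (subst sum.subset_diff[of "disjoint_upto N" ?S]) (auto simp: disjoint_upto_def add.commute)
  also have "(\<Sum>z\<in>?S - disjoint_upto N. f z) = (\<Sum>z\<in>?T. f (?g z))"
    by (rule sum.reindex_bij_betw[OF bij, symmetric])
  also have "\<dots> = (\<Sum>z\<in>closed_upto N. \<Sum>w\<in>steps_upto (N - sum_list (fst z)) \<times> steps_upto (N - sum_list (fst z)). f (?g (z, w)))"
    by (subst sum.Sigma) (auto simp: case_prod_unfold)
  also have "\<dots> = (\<Sum>(x, y)\<in>closed_upto N. \<Sum>(js, ks)\<in>steps_upto (N - sum_list x) \<times> steps_upto (N - sum_list x). f (x @ js, y @ ks))"
    by (simp add: case_prod_unfold)
  finally show ?thesis .
qed

lemma sum_times_square:
  fixes g :: "'a \<Rightarrow> 'b :: comm_semiring_1"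
  shows "(\<Sum>(x, y)\<in>S \<times> S. c * (g x * g y)) = c * (\<Sum>x\<in>S. g x)\<^sup>2"
  unfolding power2_eq_square sum_product sum.cartesian_product
  by (simp add: sum_distrib_left case_prod_unfold)

text \<open>After the common point both tails range freely over all paths from there, so their
  double sum is a perfect square.\<close>

lemma path_sum_square:
  "(path_sum \<alpha> \<beta> N u)\<^sup>2 =
    (\<Sum>(js, ks)\<in>disjoint_upto N. (wt \<alpha> u js * \<beta> (u + int (sum_list js))) *
        (wt \<alpha> u ks * \<beta> (u + int (sum_list ks)))) +
    (\<Sum>(x, y)\<in>closed_upto N. wt \<alpha> u x * wt \<alpha> u y *
        (path_sum \<alpha> \<beta> (N - sum_list x) (u + int (sum_list x)))\<^sup>2)"
proof -
  let ?w = "\<lambda>js. wt \<alpha> u js * \<beta> (u + int (sum_list js))"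
  have "(path_sum \<alpha> \<beta> N u)\<^sup>2 = (\<Sum>(js, ks)\<in>steps_upto N \<times> steps_upto N. ?w js * ?w ks)"
    by (simp add: path_sum_def power2_eq_square sum_product sum.cartesian_product)
  also have "\<dots> = (\<Sum>(js, ks)\<in>disjoint_upto N. ?w js * ?w ks) +
     (\<Sum>(x, y)\<in>closed_upto N. \<Sum>(js, ks)\<in>steps_upto (N - sum_list x) \<times> steps_upto (N - sum_list x).
        ?w (x @ js) * ?w (y @ ks))"
    by (subst sum_step_pairs) (simp add: case_prod_unfold)
  also have "(\<Sum>(x, y)\<in>closed_upto N. \<Sum>(js, ks)\<in>steps_upto (N - sum_list x) \<times> steps_upto (N - sum_list x).
        ?w (x @ js) * ?w (y @ ks)) =
     (\<Sum>(x, y)\<in>closed_upto N. wt \<alpha> u x * wt \<alpha> u y *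
        (path_sum \<alpha> \<beta> (N - sum_list x) (u + int (sum_list x)))\<^sup>2)"
  proof (intro sum.cong refl, clarify)
    fix x y assume "(x, y) \<in> closed_upto N"
    then have s: "sum_list y = sum_list x" by (auto simp: closed_upto_def closed_steps_def)
    have "(\<Sum>(js, ks)\<in>steps_upto (N - sum_list x) \<times> steps_upto (N - sum_list x). ?w (x @ js) * ?w (y @ ks)) =
        (\<Sum>(js, ks)\<in>steps_upto (N - sum_list x) \<times> steps_upto (N - sum_list x).
          (wt \<alpha> u x * wt \<alpha> u y) *
          ((wt \<alpha> (u + int (sum_list x)) js * \<beta> (u + int (sum_list x) + int (sum_list js))) *
           (wt \<alpha> (u + int (sum_list x)) ks * \<beta> (u + int (sum_list x) + int (sum_list ks)))))"
      by (intro sum.cong refl) (auto simp: wt_append s algebra_simps)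
    also have "\<dots> = wt \<alpha> u x * wt \<alpha> u y *
        (path_sum \<alpha> \<beta> (N - sum_list x) (u + int (sum_list x)))\<^sup>2"
      unfolding path_sum_def by (rule sum_times_square)
    finally show "(\<Sum>(js, ks)\<in>steps_upto (N - sum_list x) \<times> steps_upto (N - sum_list x). ?w (x @ js) * ?w (y @ ks)) = \<dots>" .
  qed
  finally show ?thesis .
qed

section \<open>Increment lists and the sequences in \<open>seqs\<close>\<close>

fun points :: "int \<Rightarrow> nat list \<Rightarrow> int list" where
  "points u [] = [u]"
| "points u (j # js) = u # points (u + int j) js"

lemma length_points [simp]: "length (points u js) = Suc (length js)"
  by (induction js arbitrary: u) auto

lemma nsteps_points [simp]: "nsteps (points u js) = length js"
  by (simp add: nsteps_def)

lemma nth_points: "i \<le> length js \<Longrightarrow> points u js ! i = u + int (sum_list (take i js))"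
proof (induction js arbitrary: u i)
  case (Cons j js)
  then show ?case by (cases i) auto
qed auto

lemma hd_points [simp]: "hd (points u js) = u"
  by (cases js) auto

lemma points_neq_Nil [simp]: "points u js \<noteq> []"
  by (cases js) auto

lemma points_ge: "v \<in> set (points u js) \<Longrightarrow> u \<le> v"
  by (induction js arbitrary: u) force+

lemma sorted_points: "js \<in> steps \<Longrightarrow> sorted_wrt (<) (points u js)"
proof (induction js arbitrary: u)
  case (Cons j js)
  then have "0 < j" by (auto simp: steps_def)
  then show ?case using Cons by (auto simp: steps_def dest!: points_ge)
qed auto

lemma points_inj: "points u js = points u ks \<Longrightarrow> js = ks"
proof (induction js arbitrary: u ks)
  case Nil
  then show ?case by (metis list.inject neq_Nil_conv points.simps points_neq_Nil)
next
  case (Cons j js)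
  then obtain k ks' where ks: "ks = k # ks'"
    by (metis list.inject neq_Nil_conv points.simps points_neq_Nil)
  have *: "points (u + int j) js = points (u + int k) ks'" using Cons.prems ks by simp
  then have "hd (points (u + int j) js) = hd (points (u + int k) ks')" by simp
  then have "j = k" by simp
  with * Cons.IH ks show ?case by simp
qed

lemma points_surj:
  assumes "sorted_wrt (<) (u # t)"
  shows "\<exists>js\<in>steps. u # t = points u js"
  using assms
proof (induction t arbitrary: u)
  case Nil
  have "[] \<in> steps" by (simp add: steps_def)
  then show ?case by (intro bexI[of _ "[]"]) auto
next
  case (Cons v t)
  then have "sorted_wrt (<) (v # t)" by simp
  from Cons.IH[OF this] obtain js where js: "js \<in> steps" "v # t = points v js" by blast
  have "u < v" using Cons.prems by simp
  then show ?case using js by (intro bexI[of _ "nat (v - u) # js"]) (auto simp: steps_def)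
qed

lemma bij_betw_points: "bij_betw (points 0) steps seqs"
  unfolding bij_betw_def
proof
  show "inj_on (points 0) steps" by (auto intro: inj_onI points_inj)
  show "points 0 ` steps = seqs"
  proof (intro set_eqI iffI)
    fix t assume "t \<in> points 0 ` steps"
    then show "t \<in> seqs"
      by (auto simp: seqs_def sorted_points nth_points)
  next
    fix t assume "t \<in> seqs"
    then obtain t' where "t = 0 # t'" "sorted_wrt (<) (0 # t')"
      by (cases t) (auto simp: seqs_def)
    then show "t \<in> points 0 ` steps" using points_surj[of 0 t'] by auto
  qed
qed

lemma psums_eq_take: "psums js = (\<lambda>i. sum_list (take i js)) ` {0<..length js}"
proof (intro set_eqI iffI)
  fix m assume "m \<in> psums js"
  then obtain xs ys where "js = xs @ ys" "xs \<noteq> []" "m = sum_list xs" by (auto simp: psums_def)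
  then show "m \<in> (\<lambda>i. sum_list (take i js)) ` {0<..length js}"
    by (intro image_eqI[of _ _ "length xs"]) auto
next
  fix m assume "m \<in> (\<lambda>i. sum_list (take i js)) ` {0<..length js}"
  then obtain i where i: "0 < i" "i \<le> length js" "m = sum_list (take i js)" by auto
  then show "m \<in> psums js"
    unfolding psums_def by (intro CollectI exI[of _ "take i js"] exI[of _ "drop i js"]) auto
qed

lemma sum_list_take_less:
  assumes "js \<in> steps" "i < length js"
  shows "sum_list (take i js) < sum_list js"
proof -
  have "sum_list js = sum_list (take i js) + sum_list (drop i js)"
    by (metis append_take_drop_id sum_list_append)
  moreover have "0 < sum_list (drop i js)"
    using psums_pos[of "drop i js" "sum_list (drop i js)"] sum_list_in_psums[of "drop i js"] assms
    by (auto simp: steps_def dest: in_set_dropD)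
  ultimately show ?thesis by simp
qed

text \<open>\<open>closed_pairs\<close> compares interior indices only. Equal partial sums of a
  closed pair therefore have one index equal to the length, so their value is the common end;
  conversely an interior partial sum lies strictly below the end.\<close>

lemma closed_steps_iff:
  assumes st: "x \<in> steps" "y \<in> steps"
  shows "(points 0 x, points 0 y) \<in> closed_pairs \<longleftrightarrow> (x, y) \<in> closed_steps"
proof -
  have sq: "points 0 x \<in> seqs" "points 0 y \<in> seqs"
    using bij_betw_points st by (auto simp: bij_betw_def)
  have "(points 0 x, points 0 y) \<in> closed_pairs \<longleftrightarrow>
      x \<noteq> [] \<and> y \<noteq> [] \<and> sum_list x = sum_list y \<and>
      (\<forall>i j. 0 < i \<and> i < length x \<and> 0 < j \<and> j < length y \<longrightarrow>
         sum_list (take i x) \<noteq> sum_list (take j y))"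
    using sq by (auto simp: closed_pairs_def nth_points)
  also have "\<dots> \<longleftrightarrow> sum_list x = sum_list y \<and> psums x \<inter> psums y = {sum_list x}"
  proof (intro iffI conjI; (elim conjE)?)
    assume h: "x \<noteq> []" "y \<noteq> []" "sum_list x = sum_list y"
      "\<forall>i j. 0 < i \<and> i < length x \<and> 0 < j \<and> j < length y \<longrightarrow>
         sum_list (take i x) \<noteq> sum_list (take j y)"
    show "psums x \<inter> psums y = {sum_list x}"
    proof (intro set_eqI iffI)
      fix m assume "m \<in> psums x \<inter> psums y"
      then obtain i j where ij: "0 < i" "i \<le> length x" "m = sum_list (take i x)"
        "0 < j" "j \<le> length y" "m = sum_list (take j y)"
        by (auto simp: psums_eq_take)
      then have "i = length x \<or> j = length y" using h(4) by (metis le_neq_implies_less)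
      then show "m \<in> {sum_list x}" using ij h by auto
    qed (use sum_list_in_psums[of x] sum_list_in_psums[of y] h in auto)
  next
    assume h: "sum_list x = sum_list y" "psums x \<inter> psums y = {sum_list x}"
    show "x \<noteq> []" "y \<noteq> []" using h(2) by auto
    show "\<forall>i j. 0 < i \<and> i < length x \<and> 0 < j \<and> j < length y \<longrightarrow>
         sum_list (take i x) \<noteq> sum_list (take j y)"
    proof (intro allI impI notI)
      fix i j assume ij: "0 < i \<and> i < length x \<and> 0 < j \<and> j < length y"
        and e: "sum_list (take i x) = sum_list (take j y)"
      from ij have "sum_list (take i x) \<in> psums x" "sum_list (take j y) \<in> psums y"
        unfolding psums_eq_take by auto
      with e have "sum_list (take i x) \<in> psums x \<inter> psums y" by simp
      then show False using h sum_list_take_less[OF st(1), of i] ij by auto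
    qed
  qed auto
  finally show ?thesis using st by (simp add: closed_steps_def)
qed

text \<open>Lets the sums defining \<open>phi2\<close> and \<open>phi2_tilde\<close> run over
  \<open>closed_steps\<close>.\<close>

lemma bij_betw_closed: "bij_betw (map_prod (points 0) (points 0)) closed_steps closed_pairs"
  unfolding bij_betw_def
proof
  show "inj_on (map_prod (points 0) (points 0)) closed_steps"
    by (auto intro!: inj_onI dest!: points_inj)
  show "map_prod (points 0) (points 0) ` closed_steps = closed_pairs"
  proof (intro set_eqI iffI)
    fix z assume "z \<in> map_prod (points 0) (points 0) ` closed_steps"
    then obtain x y where "z = (points 0 x, points 0 y)" "(x, y) \<in> closed_steps" by auto
    then show "z \<in> closed_pairs" using closed_steps_iff[of x y] by (auto simp: closed_steps_def)
  next
    fix z assume z: "z \<in> closed_pairs"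
    then obtain s t where st: "z = (s, t)" "s \<in> seqs" "t \<in> seqs" by (auto simp: closed_pairs_def)
    then have "s \<in> points 0 ` steps" "t \<in> points 0 ` steps"
      using bij_betw_points by (auto simp: bij_betw_def)
    then obtain x y where "x \<in> steps" "y \<in> steps" "s = points 0 x" "t = points 0 y" by blast
    then show "z \<in> map_prod (points 0) (points 0) ` closed_steps"
      using closed_steps_iff[of x y] z st by (auto intro!: image_eqI[of _ _ "(x, y)"])
  qed
qed

lemma prod_points:
  "(\<Prod>i<length js. \<alpha> (points u js ! i) (nat (points u js ! Suc i - points u js ! i))) = wt \<alpha> u js"
proof (induction js arbitrary: u)
  case (Cons j js)
  have "points (u + int j) js ! 0 = u + int j" by (simp add: nth_points)
  with Cons[of "u + int j"] show ?case
    by (simp add: prod.lessThan_Suc_shift del: prod.lessThan_Suc)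
qed simp

lemma path_prod_points:
  "path_prod \<A> (points 0 js) \<omega> = wt (\<lambda>u j. \<A> (- u) j \<omega>) 0 js"
  unfolding path_prod_def reversed_def using prod_points[of "\<lambda>u j. \<A> (- u) j \<omega>" 0 js] by simp

section \<open>Independence along paths\<close>

abbreviation env_space :: "((int \<times> nat \<Rightarrow> real) \<times> (int \<Rightarrow> real)) measure" where
  "env_space \<equiv> PiM (UNIV \<times> {1..}) (\<lambda>_. borel) \<Otimes>\<^sub>M PiM UNIV (\<lambda>_. borel)"

text \<open>The environment as seen from the point \<open>c\<close>; stationarity means that its law
  is the same for all \<open>c\<close>.\<close>

definition env :: "(int \<Rightarrow> nat \<Rightarrow> 'w \<Rightarrow> real) \<Rightarrow> (int \<Rightarrow> 'w \<Rightarrow> real) \<Rightarrow> int \<Rightarrow> 'w \<Rightarrow>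
    (int \<times> nat \<Rightarrow> real) \<times> (int \<Rightarrow> real)" where
  "env a b c \<omega> = (\<lambda>(u, j)\<in>UNIV \<times> {1..}. a (u + c) j \<omega>, \<lambda>u\<in>UNIV. b (u + c) \<omega>)"

lemma wt_cong:
  "(\<And>u j. 1 \<le> j \<Longrightarrow> \<alpha> (u + c) j = \<alpha>' (u + d) j) \<Longrightarrow> js \<in> steps \<Longrightarrow>
    wt \<alpha> (u + c) js = wt \<alpha>' (u + d) js"
proof (induction js arbitrary: u)
  case (Cons j js)
  then have j: "1 \<le> j" "js \<in> steps" by (auto simp: steps_def)
  have "wt \<alpha> (u + int j + c) js = wt \<alpha>' (u + int j + d) js"
    using Cons j by blast
  then show ?case using Cons.prems(1)[OF j(1), of u] by (simp add: algebra_simps)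
qed simp

lemma wt_measurable:
  "(\<And>u j. 1 \<le> j \<Longrightarrow> a u j \<in> borel_measurable M) \<Longrightarrow> js \<in> steps \<Longrightarrow>
    (\<lambda>\<omega>. wt (\<lambda>u j. a u j \<omega>) u js) \<in> borel_measurable M"
proof (induction js arbitrary: u)
  case (Cons j js)
  then have [measurable]: "(\<lambda>\<omega>. wt (\<lambda>u j. a u j \<omega>) (u + int j) js) \<in> borel_measurable M"
    "a u j \<in> borel_measurable M" by (auto simp: steps_def)
  show ?case by simp
qed simp

lemma path_sum_measurable:
  assumes "\<And>u j. 1 \<le> j \<Longrightarrow> a u j \<in> borel_measurable M" "\<And>u. b u \<in> borel_measurable M"
  shows "(\<lambda>\<omega>. path_sum (\<lambda>u j. a u j \<omega>) (\<lambda>u. b u \<omega>) N u) \<in> borel_measurable M"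
  unfolding path_sum_def
  by (intro borel_measurable_sum borel_measurable_times wt_measurable assms steps_upto_steps)

text \<open>A path sum from \<open>c\<close> is a function of the environment seen from
  \<open>c\<close> that does not depend on \<open>c\<close>, so its law inherits
  stationarity.\<close>

lemma env_path_sum:
  "path_sum (\<lambda>u j. a u j \<omega>) (\<lambda>u. b u \<omega>) N c =
    path_sum (\<lambda>u j. fst (env a b c \<omega>) (u, j)) (snd (env a b c \<omega>)) N 0"
  unfolding path_sum_def
proof (intro sum.cong refl arg_cong2[where f = "(*)"])
  fix js assume "js \<in> steps_upto N"
  then have "js \<in> steps" by (rule steps_upto_steps)
  then show "wt (\<lambda>u j. a u j \<omega>) c js = wt (\<lambda>u j. fst (env a b c \<omega>) (u, j)) 0 js"
    using wt_cong[of "\<lambda>u j. a u j \<omega>" c "\<lambda>u j. fst (env a b c \<omega>) (u, j)" 0 js 0]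
    by (simp add: env_def)
qed (simp add: env_def add.commute)

lemma env_component_measurable:
  shows "1 \<le> j \<Longrightarrow> (\<lambda>z. fst z (u, j)) \<in> borel_measurable env_space"
    and "(\<lambda>z. snd z u) \<in> borel_measurable env_space"
proof -
  show "(\<lambda>z. fst z (u, j)) \<in> borel_measurable env_space" if "1 \<le> j"
    by (rule measurable_compose[OF measurable_fst measurable_component_singleton]) (use that in auto)
  show "(\<lambda>z. snd z u) \<in> borel_measurable env_space"
    by (rule measurable_compose[OF measurable_snd measurable_component_singleton]) auto
qed

lemma env_path_sum_measurable:
  "(\<lambda>z. path_sum (\<lambda>u j. fst z (u, j)) (snd z) N 0) \<in> borel_measurable env_space"
  using path_sum_measurable[of "\<lambda>u j z. fst z (u, j)" env_space "\<lambda>u z. snd z u" N 0]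
    env_component_measurable by simp

lemma env_measurable:
  assumes "\<And>u j. 1 \<le> j \<Longrightarrow> a u j \<in> borel_measurable M" "\<And>u. b u \<in> borel_measurable M"
  shows "env a b c \<in> measurable M env_space"
  unfolding env_def[abs_def] using assms
  by (intro measurable_Pair measurable_restrict) (auto simp: split_beta)

text \<open>The indices of the \<sigma>-algebras on which the weight of the path and
  \<open>b\<close> at its end point depend.\<close>

fun keys :: "(int \<Rightarrow> nat \<Rightarrow> 'k) \<Rightarrow> (int \<Rightarrow> 'k) \<Rightarrow> int \<Rightarrow> nat list \<Rightarrow> 'k set" where
  "keys ka kb u [] = {kb u}"
| "keys ka kb u (j # js) = insert (ka u j) (keys ka kb (u + int j) js)"

definition path_points :: "int \<Rightarrow> nat list \<Rightarrow> int set" where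
  "path_points u js = (\<lambda>m. u + int m) ` insert 0 (psums js)"

lemma path_points_Nil [simp]: "path_points u [] = {u}"
  by (simp add: path_points_def)

lemma path_points_Cons [simp]:
  "path_points u (j # js) = insert u (path_points (u + int j) js)"
  by (simp add: path_points_def image_image algebra_simps)

lemma path_points_ge: "v \<in> path_points u js \<Longrightarrow> u \<le> v"
  by (auto simp: path_points_def)

lemma start_in_path_points [simp]: "u \<in> path_points u js"
  by (simp add: path_points_def)

lemma keys_cases:
  assumes "k \<in> keys ka kb u js" "js \<in> steps"
  obtains s j where "k = ka s j" "1 \<le> j" "s \<in> path_points u js" "s + int j \<in> path_points u js"
  | e where "k = kb e" "e \<in> path_points u js"
  using assms
proof (induction js arbitrary: u thesis)
  case (Cons j js)
  then have j: "1 \<le> j" "js \<in> steps" by (auto simp: steps_def)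
  show ?case
  proof (cases "k = ka u j")
    case True
    then show ?thesis using Cons.prems(1)[of u j] j by simp
  next
    case False
    then have "k \<in> keys ka kb (u + int j) js" using Cons.prems by simp
    from Cons.IH[OF _ _ this j(2)] Cons.prems(1,2) show ?thesis by auto
  qed
qed auto

text \<open>The variable \<open>a u j\<close> is the weight of the edge from \<open>u\<close> to \<open>u + j\<close> in reversed time. It depends
  on the independent \<open>\<sigma>\<close>-algebra with index \<open>ka u j\<close>, which is determined by the starting point of the
  edge under (A1) and by its end point under (A2).\<close>

locale random_env = prob_space M for M :: "'a measure" +
  fixes S :: "'k \<Rightarrow> 'a set set" and ka :: "int \<Rightarrow> nat \<Rightarrow> 'k" and kb :: "int \<Rightarrow> 'k"
    and a :: "int \<Rightarrow> nat \<Rightarrow> 'a \<Rightarrow> real" and b :: "int \<Rightarrow> 'a \<Rightarrow> real"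
  assumes S_indep: "indep_sets S UNIV"
    and S_stable: "Int_stable (S k)"
    and a_S: "1 \<le> j \<Longrightarrow> a u j \<in> borel_measurable (sigma (space M) (S (ka u j)))"
    and b_S: "b u \<in> borel_measurable (sigma (space M) (S (kb u)))"
    and a_nonneg: "1 \<le> j \<Longrightarrow> \<omega> \<in> space M \<Longrightarrow> 0 \<le> a u j \<omega>"
    and b_nonneg: "\<omega> \<in> space M \<Longrightarrow> 0 \<le> b u \<omega>"
    and ka_eqD: "1 \<le> i \<Longrightarrow> 1 \<le> j \<Longrightarrow> ka u i = ka v j \<Longrightarrow> u = v \<or> u + int i = v + int j"
    and ka_eq_kbD: "1 \<le> i \<Longrightarrow> ka u i = kb v \<Longrightarrow> u = v"
    and kb_eqD: "kb u = kb v \<Longrightarrow> u = v"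
    and stationary: "distr M env_space (env a b c) = distr M env_space (env a b 0)"
begin

text \<open>A carrier for the \<sigma>-algebra generated by the keys in \<open>K\<close>; integrals
  are always taken with respect to \<open>M\<close>.\<close>

definition info :: "'k set \<Rightarrow> 'a measure" where
  "info K = sigma (space M) (\<Union>k\<in>K. S k)"

lemma S_events: "S k \<subseteq> events"
  using S_indep by (auto simp: indep_sets_def)

lemma S_Pow: "S k \<subseteq> Pow (space M)"
  using S_events sets.sets_into_space by blast

lemma space_info [simp]: "space (info K) = space M"
  unfolding info_def using S_Pow by (intro space_measure_of) blast

lemma sets_info: "sets (info K) = sigma_sets (space M) (\<Union>k\<in>K. S k)"
  unfolding info_def using S_Pow by (intro sets_measure_of) blast

lemma info_mono: "f \<in> measurable (info K) N \<Longrightarrow> K \<subseteq> L \<Longrightarrow> f \<in> measurable (info L) N"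
  using measurable_mono1[of "\<Union>k\<in>L. S k" "space M" "\<Union>k\<in>K. S k"] S_Pow
  unfolding info_def by blast

lemma info_events: "f \<in> measurable (info K) N \<Longrightarrow> f \<in> measurable M N"
proof -
  have "sets (info K) \<subseteq> events"
    unfolding sets_info using S_events by (intro sets.sigma_sets_subset) blast
  then show "f \<in> measurable (info K) N \<Longrightarrow> f \<in> measurable M N"
    by (auto simp: measurable_def)
qed

lemma a_info: "1 \<le> j \<Longrightarrow> ka u j \<in> K \<Longrightarrow> a u j \<in> borel_measurable (info K)"
  by (rule info_mono[of _ "{ka u j}"]) (auto simp: info_def a_S)

lemma b_info: "kb u \<in> K \<Longrightarrow> b u \<in> borel_measurable (info K)"
  by (rule info_mono[of _ "{kb u}"]) (auto simp: info_def b_S)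

lemma a_measurable [measurable]: "1 \<le> j \<Longrightarrow> a u j \<in> borel_measurable M"
  by (rule info_events[OF a_info[of _ _ UNIV]]) auto

lemma b_measurable [measurable]: "b u \<in> borel_measurable M"
  by (rule info_events[OF b_info[of _ UNIV]]) auto

text \<open>Independent \<pi>-systems, grouped by disjoint index sets, generate independent
  \<sigma>-algebras; \<open>S_stable\<close> supplies the stability under intersections.\<close>

lemma nn_integral_indep:
  fixes F G :: "'a \<Rightarrow> ennreal"
  assumes F: "F \<in> borel_measurable (info I)" and G: "G \<in> borel_measurable (info J)"
    and IJ: "I \<inter> J = {}"
  shows "(\<integral>\<^sup>+\<omega>. F \<omega> * G \<omega> \<partial>M) = (\<integral>\<^sup>+\<omega>. F \<omega> \<partial>M) * (\<integral>\<^sup>+\<omega>. G \<omega> \<partial>M)"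
proof -
  have "indep_sets (\<lambda>j. sigma_sets (space M) (\<Union>i\<in>case_bool I J j. S i)) UNIV"
  proof (rule indep_sets_collect_sigma)
    show "indep_sets S (\<Union> (range (case_bool I J)))"
      by (rule indep_sets_mono_index[OF _ S_indep]) simp
    show "disjoint_family (case_bool I J)"
      using IJ by (auto simp: disjoint_family_on_def split: bool.split)
  qed (rule S_stable)
  then have "indep_sets (\<lambda>j. {case_bool F G j -` A \<inter> space M |A. A \<in> sets borel}) UNIV"
  proof (rule indep_sets_mono_sets)
    fix j :: bool
    have "case_bool F G j \<in> borel_measurable (info (case_bool I J j))"
      using F G by (cases j) auto
    then show "{case_bool F G j -` A \<inter> space M |A. A \<in> sets borel} \<subseteq>
        sigma_sets (space M) (\<Union>i\<in>case_bool I J j. S i)"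
      unfolding sets_info[symmetric] by (auto dest: measurable_sets)
  qed
  then have "indep_vars (\<lambda>_. borel) (case_bool F G) UNIV"
    unfolding indep_vars_def2
    using info_events[OF F] info_events[OF G] by (auto split: bool.split)
  from indep_vars_nn_integral[OF _ this] show ?thesis
    by (simp add: UNIV_bool mult.commute)
qed

lemma nn_integral_env:
  assumes "G \<in> borel_measurable env_space"
  shows "(\<integral>\<^sup>+\<omega>. G (env a b c \<omega>) \<partial>M) = (\<integral>\<^sup>+\<omega>. G (env a b 0 \<omega>) \<partial>M)"
proof -
  have "env a b c \<in> measurable M env_space" for c by (intro env_measurable) measurable
  then have "(\<integral>\<^sup>+z. G z \<partial>distr M env_space (env a b c)) = (\<integral>\<^sup>+\<omega>. G (env a b c \<omega>) \<partial>M)" for c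
    using assms by (intro nn_integral_distr) auto
  with stationary show ?thesis by metis
qed

definition X :: "nat \<Rightarrow> int \<Rightarrow> 'a \<Rightarrow> real" where
  "X N u \<omega> = path_sum (\<lambda>u j. a u j \<omega>) (\<lambda>u. b u \<omega>) N u"

definition W :: "int \<Rightarrow> nat list \<Rightarrow> 'a \<Rightarrow> real" where
  "W u js \<omega> = wt (\<lambda>u j. a u j \<omega>) u js"

lemma W_Nil [simp]: "W u [] = (\<lambda>_. 1)"
  by (simp add: W_def fun_eq_iff)

lemma W_Cons: "W u (j # js) = (\<lambda>\<omega>. a u j \<omega> * W (u + int j) js \<omega>)"
  by (simp add: W_def fun_eq_iff)

lemma X_nonneg: "\<omega> \<in> space M \<Longrightarrow> 0 \<le> X N u \<omega>"
  unfolding X_def by (intro path_sum_nonneg a_nonneg b_nonneg)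

lemma X_mono: "\<omega> \<in> space M \<Longrightarrow> N \<le> N' \<Longrightarrow> X N u \<omega> \<le> X N' u \<omega>"
  unfolding X_def by (intro path_sum_mono a_nonneg b_nonneg)

lemma W_nonneg: "js \<in> steps \<Longrightarrow> \<omega> \<in> space M \<Longrightarrow> 0 \<le> W u js \<omega>"
  unfolding W_def by (intro wt_nonneg a_nonneg)

lemma X_measurable [measurable]: "X N u \<in> borel_measurable M"
  unfolding X_def[abs_def] by (intro path_sum_measurable) measurable

lemma W_measurable [measurable]: "js \<in> steps \<Longrightarrow> W u js \<in> borel_measurable M"
  unfolding W_def[abs_def] by (intro wt_measurable) measurable

lemma X_stationary:
  fixes g :: "real \<Rightarrow> ennreal"
  assumes "g \<in> borel_measurable borel"
  shows "(\<integral>\<^sup>+\<omega>. g (X N c \<omega>) \<partial>M) = (\<integral>\<^sup>+\<omega>. g (X N 0 \<omega>) \<partial>M)"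
  unfolding X_def env_path_sum
  by (intro nn_integral_env[of "\<lambda>z. g (path_sum (\<lambda>u j. fst z (u, j)) (snd z) N 0)"]
      measurable_compose[OF env_path_sum_measurable assms])

lemma a_stationary: "1 \<le> j \<Longrightarrow> moment M p (a u j) = moment M p (a 0 j)"
  unfolding moment_def
  using nn_integral_env[of "\<lambda>z. ennreal (fst z (0, j) powr p)" u]
    env_component_measurable(1)[of j 0]
  by (simp add: env_def)

lemma b_stationary: "moment M p (b u) = moment M p (b 0)"
  unfolding moment_def
  using nn_integral_env[of "\<lambda>z. ennreal (snd z 0 powr p)" u]
    env_component_measurable(2)[of 0]
  by (simp add: env_def)

section \<open>Independence of the environment before and after a point\<close>

definition past :: "int \<Rightarrow> 'k set" where
  "past c = {ka s j |s j. 1 \<le> j \<and> s + int j \<le> c}"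

definition future :: "int \<Rightarrow> 'k set" where
  "future c = {ka s j |s j. 1 \<le> j \<and> c \<le> s} \<union> {kb s |s. c \<le> s}"

text \<open>An edge ending by \<open>c\<close> and an edge starting at \<open>c\<close> or later
  share neither start nor end; the former also starts strictly before every point whose
  \<open>b\<close> belongs to the future.\<close>

lemma past_future: "past c \<inter> future c = {}"
proof (rule equals0I)
  fix k assume "k \<in> past c \<inter> future c"
  then obtain s j where sj: "k = ka s j" "1 \<le> j" "s + int j \<le> c"
    and "(\<exists>v i. k = ka v i \<and> 1 \<le> i \<and> c \<le> v) \<or> (\<exists>v. k = kb v \<and> c \<le> v)"
    unfolding past_def future_def by blast
  then consider v i where "ka s j = ka v i" "1 \<le> i" "c \<le> v" | v where "ka s j = kb v" "c \<le> v"
    by auto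
  then show False
  proof cases
    case (1 v i)
    then show False using ka_eqD[OF sj(2) 1(2,1)] sj by auto
  next
    case (2 v)
    then show False using ka_eq_kbD[OF sj(2) 2(1)] sj by auto
  qed
qed

lemma W_past: "js \<in> steps \<Longrightarrow> u + int (sum_list js) \<le> c \<Longrightarrow> W u js \<in> borel_measurable (info (past c))"
proof (induction js arbitrary: u)
  case (Cons j js)
  then have j: "1 \<le> j" by (auto simp: steps_def)
  then have "a u j \<in> borel_measurable (info (past c))"
    using Cons.prems by (intro a_info) (auto simp: past_def intro!: exI[of _ u] exI[of _ j])
  moreover have "W (u + int j) js \<in> borel_measurable (info (past c))"
    using Cons by (auto simp: steps_def algebra_simps)
  ultimately show ?case unfolding W_Cons by (rule borel_measurable_times)
qed simp

lemma W_future: "js \<in> steps \<Longrightarrow> c \<le> u \<Longrightarrow> W u js \<in> borel_measurable (info (future c))"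
proof (induction js arbitrary: u)
  case (Cons j js)
  then have j: "1 \<le> j" by (auto simp: steps_def)
  then have "a u j \<in> borel_measurable (info (future c))"
    using Cons.prems by (intro a_info) (auto simp: future_def intro!: exI[of _ u] exI[of _ j])
  moreover have "W (u + int j) js \<in> borel_measurable (info (future c))"
    using Cons by (auto simp: steps_def)
  ultimately show ?case unfolding W_Cons by (rule borel_measurable_times)
qed simp

lemma X_future: "X N c \<in> borel_measurable (info (future c))"
  unfolding X_def[abs_def] path_sum_def W_def[symmetric]
  by (intro borel_measurable_sum borel_measurable_times W_future b_info)
     (auto simp: future_def intro: steps_upto_steps)

text \<open>Independence across \<open>c\<close>, then stationarity of the second factor. The power
  \<open>n\<close> is 2 for closed pairs and 1 for a single first edge.\<close>

lemma moment_past_future: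
  assumes F: "F \<in> borel_measurable (info (past c))" "\<And>\<omega>. \<omega> \<in> space M \<Longrightarrow> 0 \<le> F \<omega>"
  shows "moment M p (\<lambda>\<omega>. F \<omega> * X N c \<omega> ^ n) = moment M p F * moment M p (\<lambda>\<omega>. X N 0 \<omega> ^ n)"
proof -
  have "moment M p (\<lambda>\<omega>. F \<omega> * X N c \<omega> ^ n) =
      (\<integral>\<^sup>+\<omega>. ennreal (F \<omega> powr p) * ennreal ((X N c \<omega> ^ n) powr p) \<partial>M)"
    unfolding moment_def using F X_nonneg
    by (intro nn_integral_cong) (simp add: powr_mult flip: ennreal_mult)
  also have "\<dots> = moment M p F * moment M p (\<lambda>\<omega>. X N c \<omega> ^ n)"
    unfolding moment_def
  proof (rule nn_integral_indep[OF _ _ past_future])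
    show "(\<lambda>\<omega>. ennreal (F \<omega> powr p)) \<in> borel_measurable (info (past c))"
      by (rule measurable_compose[OF F(1)]) simp
    show "(\<lambda>\<omega>. ennreal ((X N c \<omega> ^ n) powr p)) \<in> borel_measurable (info (future c))"
      by (rule measurable_compose[OF X_future, where g = "\<lambda>x. ennreal ((x ^ n) powr p)"]) simp
  qed
  also have "moment M p (\<lambda>\<omega>. X N c \<omega> ^ n) = moment M p (\<lambda>\<omega>. X N 0 \<omega> ^ n)"
    unfolding moment_def by (rule X_stationary) measurable
  finally show ?thesis .
qed

lemma closed_Lp_norm:
  assumes "(x, y) \<in> closed_steps"
  shows "Lp_norm M p (\<lambda>\<omega>. W 0 x \<omega> * W 0 y \<omega> * (X N (int (sum_list x)) \<omega>)\<^sup>2) =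
    Lp_norm M p (\<lambda>\<omega>. W 0 x \<omega> * W 0 y \<omega>) * Lp_norm M p (\<lambda>\<omega>. (X N 0 \<omega>)\<^sup>2)"
proof -
  have xy: "x \<in> steps" "y \<in> steps" "sum_list y = sum_list x"
    using assms by (auto simp: closed_steps_def)
  then have "W 0 x \<in> borel_measurable (info (past (int (sum_list x))))"
    "W 0 y \<in> borel_measurable (info (past (int (sum_list x))))"
    by (auto intro!: W_past)
  then have "(\<lambda>\<omega>. W 0 x \<omega> * W 0 y \<omega>) \<in> borel_measurable (info (past (int (sum_list x))))"
    by measurable
  then show ?thesis unfolding Lp_norm_def
    by (subst moment_past_future) (auto intro!: mult_nonneg_nonneg W_nonneg xy simp: epowr_mult)
qed

section \<open>Factorisation along a path and along a disjoint pair\<close>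

abbreviation K :: "int \<Rightarrow> nat list \<Rightarrow> 'k set" where
  "K \<equiv> keys ka kb"

lemma ka_notin_keys:
  assumes "js \<in> steps" "1 \<le> j" "u \<notin> path_points v js" "u + int j \<notin> path_points v js"
  shows "ka u j \<notin> K v js"
proof
  assume k: "ka u j \<in> K v js"
  show False
    using keys_cases[OF k assms(1)]
  proof cases
    case (1 s l)
    then show False using ka_eqD[OF assms(2) 1(2,1)] assms(3,4) by auto
  next
    case (2 e)
    then show False using ka_eq_kbD[OF assms(2) 2(1)] assms(3) by auto
  qed
qed

text \<open>Later edges start at \<open>u + int j\<close> or beyond and end strictly after it, so
  none shares the start or the end of the first edge.\<close>

lemma ka_start_notin_keys:
  assumes "js \<in> steps" "1 \<le> j"
  shows "ka u j \<notin> K (u + int j) js"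
proof
  assume k: "ka u j \<in> K (u + int j) js"
  show False
    using keys_cases[OF k assms(1)]
  proof cases
    case (1 s l)
    then show False using ka_eqD[OF assms(2) 1(2,1)] path_points_ge[OF 1(3)] assms(2) by auto
  next
    case (2 e)
    then show False using ka_eq_kbD[OF assms(2) 2(1)] path_points_ge[OF 2(2)] assms(2) by auto
  qed
qed

text \<open>By the axioms on keys, a shared key would force a shared point of the two paths.\<close>

lemma keys_disjoint:
  assumes "js \<in> steps" "ks \<in> steps" "path_points u js \<inter> path_points v ks = {}"
  shows "K u js \<inter> K v ks = {}"
proof (rule equals0I)
  fix k assume "k \<in> K u js \<inter> K v ks"
  then have k: "k \<in> K u js" "k \<in> K v ks" by auto
  show False
    using keys_cases[OF k(1) assms(1)]
  proof cases
    case (1 s j)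
    then show False using ka_notin_keys[OF assms(2), of j s v] k assms(3) by auto
  next
    case (2 e)
    show False
      using keys_cases[OF k(2) assms(2)]
    proof cases
      case (1 s j)
      then show False using ka_eq_kbD[of j s e] 2 assms(3) by auto
    next
      case (2 e')
      then show False using kb_eqD[of e e'] \<open>k = kb e\<close> \<open>e \<in> _\<close> assms(3) by auto
    qed
  qed
qed

definition V :: "int \<Rightarrow> nat list \<Rightarrow> 'a \<Rightarrow> real" where
  "V u js \<omega> = W u js \<omega> * b (u + int (sum_list js)) \<omega>"

lemma V_Nil [simp]: "V u [] = b u"
  by (simp add: V_def fun_eq_iff)

lemma V_Cons: "V u (j # js) = (\<lambda>\<omega>. a u j \<omega> * V (u + int j) js \<omega>)"
  by (simp add: V_def W_Cons fun_eq_iff algebra_simps)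

lemma V_nonneg: "js \<in> steps \<Longrightarrow> \<omega> \<in> space M \<Longrightarrow> 0 \<le> V u js \<omega>"
  unfolding V_def by (intro mult_nonneg_nonneg W_nonneg b_nonneg)

lemma V_measurable [measurable]: "js \<in> steps \<Longrightarrow> V u js \<in> borel_measurable M"
  unfolding V_def[abs_def] by measurable

lemma V_keys: "js \<in> steps \<Longrightarrow> K u js \<subseteq> L \<Longrightarrow> V u js \<in> borel_measurable (info L)"
proof (induction js arbitrary: u)
  case Nil
  then show ?case by (auto intro: b_info)
next
  case (Cons j js)
  then have "a u j \<in> borel_measurable (info L)"
    by (intro a_info) (auto simp: steps_def)
  moreover have "V (u + int j) js \<in> borel_measurable (info L)"
    using Cons by (auto simp: steps_def)
  ultimately show ?case unfolding V_Cons by (rule borel_measurable_times)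
qed

text \<open>The moment of \<open>V u js\<close> as it comes out by independence along the path and
  stationarity; the start \<open>u\<close> disappears.\<close>

definition V_moment :: "real \<Rightarrow> nat list \<Rightarrow> ennreal" where
  "V_moment p js = (\<Prod>j\<leftarrow>js. moment M p (a 0 j)) * moment M p (b 0)"

text \<open>The extra factor \<open>R\<close> makes the induction work: the first weight is moved
  into it, the induction hypothesis removes the tail, and the first weight is then separated from
  \<open>R\<close>.\<close>

lemma nn_integral_V_mult:
  assumes "js \<in> steps" "R \<in> borel_measurable (info L)" "L \<inter> K u js = {}"
  shows "(\<integral>\<^sup>+\<omega>. ennreal (V u js \<omega> powr p) * R \<omega> \<partial>M) = V_moment p js * (\<integral>\<^sup>+\<omega>. R \<omega> \<partial>M)"
  using assms
proof (induction js arbitrary: u R L)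
  case Nil
  have "b u \<in> borel_measurable (info {kb u})" by (rule b_info) simp
  then have "(\<integral>\<^sup>+\<omega>. ennreal (V u [] \<omega> powr p) * R \<omega> \<partial>M) =
      moment M p (b u) * (\<integral>\<^sup>+\<omega>. R \<omega> \<partial>M)"
    unfolding moment_def V_Nil using Nil
    by (intro nn_integral_indep[of _ "{kb u}" _ L]) auto
  then show ?case by (simp add: V_moment_def b_stationary[of p u])
next
  case (Cons j js)
  then have j: "1 \<le> j" "js \<in> steps" by (auto simp: steps_def)
  let ?A = "\<lambda>\<omega>. ennreal (a u j \<omega> powr p)"
  have A: "?A \<in> borel_measurable (info {ka u j})"
    by (rule measurable_compose[OF a_info[OF j(1)]]) auto
  have "(\<integral>\<^sup>+\<omega>. ennreal (V u (j # js) \<omega> powr p) * R \<omega> \<partial>M) =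
      (\<integral>\<^sup>+\<omega>. ennreal (V (u + int j) js \<omega> powr p) * (?A \<omega> * R \<omega>) \<partial>M)"
  proof (intro nn_integral_cong)
    fix \<omega> assume "\<omega> \<in> space M"
    then have "0 \<le> a u j \<omega>" "0 \<le> V (u + int j) js \<omega>"
      using j by (auto intro: a_nonneg V_nonneg)
    then show "ennreal (V u (j # js) \<omega> powr p) * R \<omega> =
        ennreal (V (u + int j) js \<omega> powr p) * (?A \<omega> * R \<omega>)"
      by (simp add: V_Cons powr_mult ennreal_mult algebra_simps)
  qed
  also have "\<dots> = V_moment p js * (\<integral>\<^sup>+\<omega>. ?A \<omega> * R \<omega> \<partial>M)"
  proof -
    have "(\<lambda>\<omega>. ?A \<omega> * R \<omega>) \<in> borel_measurable (info (insert (ka u j) L))"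
      using info_mono[OF A, of "insert (ka u j) L"] info_mono[OF Cons.prems(2), of "insert (ka u j) L"]
      by (intro borel_measurable_times_ennreal) auto
    moreover have "insert (ka u j) L \<inter> K (u + int j) js = {}"
      using Cons.prems(3) ka_start_notin_keys[OF j(2,1)] by auto
    ultimately show ?thesis by (rule Cons.IH[OF j(2)])
  qed
  also have "(\<integral>\<^sup>+\<omega>. ?A \<omega> * R \<omega> \<partial>M) = moment M p (a u j) * (\<integral>\<^sup>+\<omega>. R \<omega> \<partial>M)"
    unfolding moment_def using A Cons.prems by (intro nn_integral_indep[of _ "{ka u j}" _ L]) auto
  finally show ?case using j by (simp add: V_moment_def a_stationary[of j p u] algebra_simps)
qed

text \<open>The two first weights may have the same key and stay together as one factor; everything
  else is separated by its keys.\<close>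

lemma moment_V_pair:
  assumes "i # js \<in> steps" "j # ks \<in> steps" and disj: "psums (i # js) \<inter> psums (j # ks) = {}"
  shows "moment M p (\<lambda>\<omega>. V 0 (i # js) \<omega> * V 0 (j # ks) \<omega>) =
    moment M p (\<lambda>\<omega>. a 0 i \<omega> * a 0 j \<omega>) * V_moment p js * V_moment p ks"
proof -
  have ij: "1 \<le> i" "1 \<le> j" and st: "js \<in> steps" "ks \<in> steps"
    using assms by (auto simp: steps_def)
  \<comment> \<open>The points of a tail, its start included, are exactly the partial sums of the
    whole list.\<close>
  have pts: "path_points (int i) js \<inter> path_points (int j) ks = {}"
  proof -
    have "path_points (int n) ns = int ` psums (n # ns)" for n ns
      by (simp add: path_points_def image_image)
    then show ?thesis using disj by (auto simp del: psums_Cons)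
  qed
  let ?A = "\<lambda>\<omega>. ennreal ((a 0 i \<omega> * a 0 j \<omega>) powr p)"
  let ?L = "{ka 0 i, ka 0 j}"
  have L: "?L \<inter> K (int i) js = {}" "?L \<inter> K (int j) ks = {}"
  proof -
    have "int i \<notin> path_points (int j) ks" "int j \<notin> path_points (int i) js"
      using pts start_in_path_points by blast+
    moreover have "0 \<notin> path_points (int j) ks" "0 \<notin> path_points (int i) js"
      using ij by (auto dest: path_points_ge)
    moreover have "ka 0 i \<notin> K (int i) js" "ka 0 j \<notin> K (int j) ks"
      using ka_start_notin_keys[OF st(1) ij(1), of 0] ka_start_notin_keys[OF st(2) ij(2), of 0] by auto
    ultimately show "?L \<inter> K (int i) js = {}" "?L \<inter> K (int j) ks = {}"
      using ka_notin_keys[OF st(2) ij(1), of 0 "int j"] ka_notin_keys[OF st(1) ij(2), of 0 "int i"]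
      by auto
  qed
  have A: "?A \<in> borel_measurable (info ?L)"
    by (rule measurable_compose[OF borel_measurable_times[OF a_info[OF ij(1)] a_info[OF ij(2)]],
          of 0 _ 0 "\<lambda>x. ennreal (x powr p)"]) auto
  let ?VA = "\<lambda>\<omega>. ennreal (V (int j) ks \<omega> powr p) * ?A \<omega>"
  have VA: "?VA \<in> borel_measurable (info (K (int j) ks \<union> ?L))"
    by (intro borel_measurable_times_ennreal info_mono[OF A]
        measurable_compose[OF V_keys[OF st(2)], where g = "\<lambda>x. ennreal (x powr p)"]) auto
  have "moment M p (\<lambda>\<omega>. V 0 (i # js) \<omega> * V 0 (j # ks) \<omega>) =
      (\<integral>\<^sup>+\<omega>. ennreal (V (int i) js \<omega> powr p) * ?VA \<omega> \<partial>M)"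
    unfolding moment_def
  proof (intro nn_integral_cong)
    fix \<omega> assume w: "\<omega> \<in> space M"
    then have "0 \<le> a 0 i \<omega>" "0 \<le> V (int i) js \<omega>" "0 \<le> a 0 j \<omega>" "0 \<le> V (int j) ks \<omega>"
      using ij st by (auto intro: a_nonneg V_nonneg)
    then show "ennreal ((V 0 (i # js) \<omega> * V 0 (j # ks) \<omega>) powr p) =
        ennreal (V (int i) js \<omega> powr p) * ?VA \<omega>"
      by (simp add: V_Cons powr_mult ennreal_mult algebra_simps)
  qed
  also have "\<dots> = V_moment p js * (V_moment p ks * (\<integral>\<^sup>+\<omega>. ?A \<omega> \<partial>M))"
    using keys_disjoint[OF st(2) st(1), of "int j" "int i"] pts L st A VA
    by (subst nn_integral_V_mult[OF st(1) VA], blast, subst nn_integral_V_mult[OF st(2) A]) auto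
  finally show ?thesis by (simp add: moment_def algebra_simps)
qed

end

section \<open>The second moment of the path sum\<close>

lemma sum_le_infsum_ennreal:
  fixes f :: "'a \<Rightarrow> ennreal"
  assumes "finite F" "F \<subseteq> A"
  shows "sum f F \<le> infsum f A"
  by (subst nonneg_infsum_complete) (auto intro!: SUP_upper assms)

lemma member_le_infsum_ennreal:
  fixes f :: "'a \<Rightarrow> ennreal"
  assumes "x \<in> A"
  shows "f x \<le> infsum f A"
  using sum_le_infsum_ennreal[of "{x}" A f] assms by simp

text \<open>Splitting off the first step gives the recursion of a geometric series;
  \<open>1 / (1 - s)\<close> is the fixed point of \<open>x = 1 + s * x\<close>.\<close>

lemma sum_prod_list_steps_le:
  fixes r :: "nat \<Rightarrow> ennreal"
  assumes "\<And>N. (\<Sum>j=1..N. r j) \<le> ennreal s" "0 \<le> s" "s < 1"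
  shows "(\<Sum>js\<in>steps_upto N. \<Prod>j\<leftarrow>js. r j) \<le> ennreal (1 / (1 - s))"
proof (induction N rule: less_induct)
  case (less N)
  have "(\<Sum>js\<in>steps_upto N. \<Prod>j\<leftarrow>js. r j) =
      1 + (\<Sum>j=1..N. r j * (\<Sum>js\<in>steps_upto (N - j). \<Prod>j\<leftarrow>js. r j))"
    by (subst sum_steps_upto) (simp add: sum_distrib_left)
  also have "\<dots> \<le> 1 + (\<Sum>j=1..N. r j * ennreal (1 / (1 - s)))"
    by (intro add_left_mono sum_mono mult_left_mono less.IH) auto
  also have "\<dots> = 1 + (\<Sum>j=1..N. r j) * ennreal (1 / (1 - s))"
    by (simp add: sum_distrib_right)
  also have "\<dots> \<le> 1 + ennreal s * ennreal (1 / (1 - s))"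
    by (intro add_left_mono mult_right_mono assms) auto
  also have "\<dots> = ennreal (1 + s * (1 / (1 - s)))"
    using assms by (subst ennreal_mult[symmetric]) auto
  also have "1 + s * (1 / (1 - s)) = 1 / (1 - s)"
    using assms by (simp add: field_simps)
  finally show ?case .
qed

lemma epowr_prod_list: "epowr (\<Prod>j\<leftarrow>js. f j) r = (\<Prod>j\<leftarrow>js. epowr (f j) r)"
proof (induction js)
  case Nil
  show ?case using epowr_ennreal[of 1 r] by simp
qed (simp add: epowr_mult)

text \<open>Absorption of the right-hand term. Finiteness of \<open>x\<close> matters: for
  \<open>s > 0\<close> the affine inequality holds trivially at \<open>x = \<top>\<close>.\<close>

lemma ennreal_le_of_le_affine:
  assumes "x \<le> ennreal A + ennreal s * x" "x < \<top>" "0 \<le> A" "0 \<le> s" "s < 1"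
  shows "x \<le> ennreal (A / (1 - s))"
proof (cases x)
  case (real y)
  then have "ennreal y \<le> ennreal (A + s * y)"
    using assms by (simp add: ennreal_mult)
  then have "y \<le> A + s * y" using real assms by (subst (asm) ennreal_le_iff) auto
  then show ?thesis using real assms by (auto simp: field_simps intro!: ennreal_leI)
qed (use assms in simp)

lemma moment_power2:
  assumes "\<And>\<omega>. \<omega> \<in> space M \<Longrightarrow> 0 \<le> f \<omega>"
  shows "moment M p (\<lambda>\<omega>. (f \<omega>)\<^sup>2) = moment M (2 * p) f"
  unfolding moment_def
proof (intro nn_integral_cong)
  fix \<omega> assume "\<omega> \<in> space M"
  then have "f \<omega> = 0 \<or> 0 < f \<omega>" using assms by force
  then show "ennreal ((f \<omega>)\<^sup>2 powr p) = ennreal (f \<omega> powr (2 * p))"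
    by (auto simp: powr_powr simp flip: powr_numeral)
qed

lemma Lp_norm_less_top_iff: "Lp_norm M p f < \<top> \<longleftrightarrow> moment M p f < \<top>"
  by (cases "moment M p f") (auto simp: Lp_norm_def epowr_ennreal)

context random_env
begin

abbreviation rho :: "real \<Rightarrow> ennreal" where
  "rho p \<equiv> (\<Sum>\<^sub>\<infinity>(x, y)\<in>closed_steps. Lp_norm M p (\<lambda>\<omega>. W 0 x \<omega> * W 0 y \<omega>))"

abbreviation xi :: "real \<Rightarrow> nat \<Rightarrow> ennreal" where
  "xi p N \<equiv> Lp_norm M p (\<lambda>\<omega>. (X N 0 \<omega>)\<^sup>2)"

lemma X_square:
  "(X N 0 \<omega>)\<^sup>2 = (\<Sum>(x, y)\<in>disjoint_upto N. V 0 x \<omega> * V 0 y \<omega>) +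
    (\<Sum>(x, y)\<in>closed_upto N. W 0 x \<omega> * W 0 y \<omega> * (X (N - sum_list x) (int (sum_list x)) \<omega>)\<^sup>2)"
  using path_sum_square[of "\<lambda>u j. a u j \<omega>" "\<lambda>u. b u \<omega>" N 0] by (simp add: X_def V_def W_def)

lemma xi_mono: "0 < p \<Longrightarrow> N \<le> N' \<Longrightarrow> xi p N \<le> xi p N'"
  by (intro Lp_norm_mono power_mono X_mono X_nonneg) auto

lemma closed_stepsD: "(x, y) \<in> closed_steps \<Longrightarrow> x \<in> steps \<and> y \<in> steps"
  by (auto simp: closed_steps_def)

text \<open>Of the disjoint pairs only \<open>([], [])\<close> is kept, contributing
  \<open>(b 0 \<omega>)\<^sup>2\<close>, and of the closed pairs only those in \<open>F\<close>. The
  reverse Minkowski inequality then separates the terms.\<close>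

lemma xi_ge:
  assumes p: "0 < p" "p \<le> 1" and F: "F \<subseteq> closed_upto N"
  shows "Lp_norm M p (\<lambda>\<omega>. (b 0 \<omega>)\<^sup>2) +
    (\<Sum>(x, y)\<in>F. Lp_norm M p (\<lambda>\<omega>. W 0 x \<omega> * W 0 y \<omega>) * xi p (N - sum_list x)) \<le> xi p N"
proof -
  let ?f = "\<lambda>(x, y) \<omega>. W 0 x \<omega> * W 0 y \<omega> * (X (N - sum_list x) (int (sum_list x)) \<omega>)\<^sup>2"
  have fin: "finite F" using F finite_closed_upto finite_subset by blast
  have cl: "(x, y) \<in> closed_steps" if "(x, y) \<in> F" for x y
    using that F closed_upto_closed by blast
  have fm: "?f z \<in> borel_measurable M" if z: "z \<in> F" for z
  proof (cases z)
    case (Pair x y)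
    then have [measurable]: "x \<in> steps" "y \<in> steps" using z cl closed_stepsD by auto
    show ?thesis unfolding Pair prod.case by measurable
  qed
  have fn: "0 \<le> ?f z \<omega>" if z: "z \<in> closed_upto N" "\<omega> \<in> space M" for z \<omega>
    using z closed_upto_closed[OF z(1)] closed_stepsD
    by (cases z) (auto intro!: mult_nonneg_nonneg W_nonneg)
  have "Lp_norm M p (\<lambda>\<omega>. (b 0 \<omega>)\<^sup>2) +
    (\<Sum>(x, y)\<in>F. Lp_norm M p (\<lambda>\<omega>. W 0 x \<omega> * W 0 y \<omega>) * xi p (N - sum_list x)) =
    Lp_norm M p (\<lambda>\<omega>. (b 0 \<omega>)\<^sup>2) + (\<Sum>z\<in>F. Lp_norm M p (?f z))"
    by (intro arg_cong2[where f = "(+)"] sum.cong refl) (auto simp: closed_Lp_norm cl)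
  also have "\<dots> \<le> Lp_norm M p (\<lambda>\<omega>. (b 0 \<omega>)\<^sup>2) + Lp_norm M p (\<lambda>\<omega>. \<Sum>z\<in>F. ?f z \<omega>)"
    using p fin fm fn F by (intro add_left_mono Lp_norm_sum_ge) auto
  also have "\<dots> \<le> Lp_norm M p (\<lambda>\<omega>. (b 0 \<omega>)\<^sup>2 + (\<Sum>z\<in>F. ?f z \<omega>))"
    using p fn F fm by (intro Lp_norm_add_ge borel_measurable_sum) (auto intro!: sum_nonneg)
  also have "\<dots> \<le> xi p N"
  proof (rule Lp_norm_mono)
    fix \<omega> assume w: "\<omega> \<in> space M"
    show "0 \<le> (b 0 \<omega>)\<^sup>2 + (\<Sum>z\<in>F. ?f z \<omega>)"
      using fn F w by (intro add_nonneg_nonneg sum_nonneg) auto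
    have "([], []) \<in> disjoint_upto N" by (simp add: disjoint_upto_def steps_upto_def)
    moreover have "0 \<le> (case z of (x, y) \<Rightarrow> V 0 x \<omega> * V 0 y \<omega>)" if "z \<in> disjoint_upto N" for z
      using that w by (auto simp: disjoint_upto_def intro!: mult_nonneg_nonneg V_nonneg steps_upto_steps)
    ultimately have "(case ([], []) of (x, y) \<Rightarrow> V 0 x \<omega> * V 0 y \<omega>) \<le>
        (\<Sum>(x, y)\<in>disjoint_upto N. V 0 x \<omega> * V 0 y \<omega>)"
      by (intro member_le_sum) auto
    moreover have "(\<Sum>z\<in>F. ?f z \<omega>) \<le> (\<Sum>z\<in>closed_upto N. ?f z \<omega>)"
      using F fn w by (intro sum_mono2) auto
    ultimately show "(b 0 \<omega>)\<^sup>2 + (\<Sum>z\<in>F. ?f z \<omega>) \<le> (X N 0 \<omega>)\<^sup>2"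
      unfolding X_square by (simp add: power2_eq_square case_prod_unfold)
  qed (rule p)
  finally show ?thesis .
qed

theorem SUP_xi_eq_top:
  assumes p: "0 < p" "p \<le> 1" and rho: "1 \<le> rho p"
    and b: "Lp_norm M p (\<lambda>\<omega>. (b 0 \<omega>)\<^sup>2) \<noteq> 0"
  shows "(SUP N. xi p N) = \<top>"
proof (rule ccontr)
  let ?s = "SUP N. xi p N" and ?b = "Lp_norm M p (\<lambda>\<omega>. (b 0 \<omega>)\<^sup>2)"
  let ?L = "\<lambda>(x, y). Lp_norm M p (\<lambda>\<omega>. W 0 x \<omega> * W 0 y \<omega>)"
  assume fin: "?s \<noteq> \<top>"
  have "?b + sum ?L F * ?s \<le> ?s" if F: "finite F" "F \<subseteq> closed_steps" for F
  proof -
    \<comment> \<open>A bound for the lengths in \<open>F\<close>: with the horizon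
      \<open>N + m\<close>, every tail keeps a horizon of at least \<open>N\<close>.\<close>
    define m where "m = Max ((\<lambda>(x, y). sum_list x) ` F)"
    have m: "sum_list x \<le> m" if "(x, y) \<in> F" for x y
      unfolding m_def using F that by (intro Max_ge) (auto simp: rev_image_eqI)
    have "?b + sum ?L F * xi p N \<le> ?s" for N
    proof -
      have "?b + sum ?L F * xi p N \<le>
        ?b + (\<Sum>(x, y)\<in>F. Lp_norm M p (\<lambda>\<omega>. W 0 x \<omega> * W 0 y \<omega>) * xi p (N + m - sum_list x))"
        unfolding sum_distrib_right
      proof (intro add_left_mono sum_mono, clarify)
        fix x y assume xy: "(x, y) \<in> F"
        show "Lp_norm M p (\<lambda>\<omega>. W 0 x \<omega> * W 0 y \<omega>) * xi p N \<le>
          Lp_norm M p (\<lambda>\<omega>. W 0 x \<omega> * W 0 y \<omega>) * xi p (N + m - sum_list x)"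
          using m[OF xy] by (intro mult_left_mono xi_mono p) auto
      qed
      also have "\<dots> \<le> xi p (N + m)"
        using F m by (intro xi_ge p) (force simp: closed_upto_def)
      also have "\<dots> \<le> ?s" by (rule SUP_upper) simp
      finally show ?thesis .
    qed
    then have "(SUP N. ?b + sum ?L F * xi p N) \<le> ?s" by (rule SUP_least)
    then show ?thesis
      by (simp add: SUP_mult_left_ennreal ennreal_SUP_add_right)
  qed
  then have "(SUP F\<in>{F. finite F \<and> F \<subseteq> closed_steps}. ?b + sum ?L F * ?s) \<le> ?s"
    by (intro SUP_least) auto
  also have "(SUP F\<in>{F. finite F \<and> F \<subseteq> closed_steps}. ?b + sum ?L F * ?s) = ?b + rho p * ?s"
    by (subst nonneg_infsum_complete, simp, subst SUP_mult_right_ennreal,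
        subst ennreal_SUP_add_right) auto
  finally have "?b + rho p * ?s \<le> ?s" .
  moreover have "1 * ?s \<le> rho p * ?s" using rho by (intro mult_right_mono) auto
  \<comment> \<open>As \<open>rho p \<ge> 1\<close>, the finite supremum would exceed itself by
    \<open>?b\<close>, which is not zero.\<close>
  ultimately have "?b + ?s \<le> 0 + ?s" by (metis (no_types, lifting) add_left_mono mult_1 order_trans add_0)
  then show False using b fin by (cases ?b; cases ?s) (auto simp: top_unique simp flip: ennreal_plus)
qed

lemma Lp_norm_V_pair:
  assumes "i # js \<in> steps" "j # ks \<in> steps" "psums (i # js) \<inter> psums (j # ks) = {}"
  shows "Lp_norm M p (\<lambda>\<omega>. V 0 (i # js) \<omega> * V 0 (j # ks) \<omega>) =
    Lp_norm M p (\<lambda>\<omega>. a 0 i \<omega> * a 0 j \<omega>) *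
    (((\<Prod>l\<leftarrow>js. Lp_norm M p (a 0 l)) * Lp_norm M p (b 0)) *
     ((\<Prod>l\<leftarrow>ks. Lp_norm M p (a 0 l)) * Lp_norm M p (b 0)))"
  unfolding Lp_norm_def moment_V_pair[OF assms] V_moment_def
  by (simp add: epowr_mult epowr_prod_list algebra_simps)

text \<open>Disjointness serves to factorise each term and to make the first steps distinct.
  Afterwards the tails are summed freely, each giving a geometric series times the norm of
  \<open>b 0\<close>.\<close>

lemma sum_disjoint_le:
  assumes p: "0 < p"
    and r: "\<And>N. (\<Sum>j=1..N. Lp_norm M p (a 0 j)) \<le> ennreal s" "0 \<le> s" "s < 1"
  shows "(\<Sum>(x, y)\<in>disjoint_upto N \<inter> {(x, y). x \<noteq> [] \<and> y \<noteq> []}.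
      Lp_norm M p (\<lambda>\<omega>. V 0 x \<omega> * V 0 y \<omega>)) \<le>
    (\<Sum>\<^sub>\<infinity>(i, j)\<in>{(i, j). 1 \<le> i \<and> 1 \<le> j \<and> i \<noteq> j}. Lp_norm M p (\<lambda>\<omega>. a 0 i \<omega> * a 0 j \<omega>)) *
    (ennreal (1 / (1 - s)) * Lp_norm M p (b 0))\<^sup>2"
proof -
  define g where "g i j = (if i \<noteq> j then Lp_norm M p (\<lambda>\<omega>. a 0 i \<omega> * a 0 j \<omega>) else 0)" for i j
  define q where "q js = (\<Prod>l\<leftarrow>js. Lp_norm M p (a 0 l)) * Lp_norm M p (b 0)" for js
  define c where "c = ennreal (1 / (1 - s)) * Lp_norm M p (b 0)"
  \<comment> \<open>Zero on pairs with a trivial path, so that the sum can be extended to all pairs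
    of paths.\<close>
  define H where "H x y = (case x of [] \<Rightarrow> 0 | i # js \<Rightarrow> case y of [] \<Rightarrow> 0 | j # ks \<Rightarrow>
    g i j * (q js * q ks))" for x y
  have sum_q: "(\<Sum>js\<in>steps_upto N. q js) \<le> c" for N
    unfolding q_def c_def sum_distrib_right[symmetric]
    by (intro mult_right_mono sum_prod_list_steps_le r) auto
  have product: "(\<Sum>js\<in>S. \<Sum>ks\<in>T. d * (q js * q ks)) = d * ((\<Sum>js\<in>S. q js) * (\<Sum>ks\<in>T. q ks))" for S T d
    by (subst sum_product) (simp only: sum_distrib_left)
  have "(\<Sum>(x, y)\<in>disjoint_upto N \<inter> {(x, y). x \<noteq> [] \<and> y \<noteq> []}.
      Lp_norm M p (\<lambda>\<omega>. V 0 x \<omega> * V 0 y \<omega>)) \<le>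
    (\<Sum>(x, y)\<in>disjoint_upto N \<inter> {(x, y). x \<noteq> [] \<and> y \<noteq> []}. H x y)"
  proof (rule sum_mono, clarify)
    fix x y :: "nat list" assume xy: "(x, y) \<in> disjoint_upto N" "x \<noteq> []" "y \<noteq> []"
    then obtain i js j ks where e: "x = i # js" "y = j # ks" by (meson neq_Nil_conv)
    have "i # js \<in> steps" "j # ks \<in> steps" "psums (i # js) \<inter> psums (j # ks) = {}"
      using xy(1) unfolding e disjoint_upto_def by (auto dest: steps_upto_steps)
    moreover from this(3) have "i \<noteq> j" by auto
    ultimately show "Lp_norm M p (\<lambda>\<omega>. V 0 x \<omega> * V 0 y \<omega>) \<le> H x y"
      unfolding e using Lp_norm_V_pair[of i js j ks p] by (simp add: H_def g_def q_def)
  qed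
  also have "\<dots> \<le> (\<Sum>(x, y)\<in>steps_upto N \<times> steps_upto N. H x y)"
    by (intro sum_mono2) (auto simp: disjoint_upto_def)
  also have "\<dots> = (\<Sum>i=1..N. \<Sum>js\<in>steps_upto (N - i). \<Sum>j=1..N. \<Sum>ks\<in>steps_upto (N - j).
      g i j * (q js * q ks))"
    unfolding sum.cartesian_product[symmetric]
    by (subst sum_steps_upto, subst (2) sum_steps_upto) (simp add: H_def)
  also have "\<dots> = (\<Sum>i=1..N. \<Sum>j=1..N. \<Sum>js\<in>steps_upto (N - i). \<Sum>ks\<in>steps_upto (N - j).
      g i j * (q js * q ks))"
    by (rule sum.cong[OF refl], rule sum.swap)
  also have "\<dots> = (\<Sum>i=1..N. \<Sum>j=1..N. g i j *
      ((\<Sum>js\<in>steps_upto (N - i). q js) * (\<Sum>ks\<in>steps_upto (N - j). q ks)))"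
    by (simp only: product)
  also have "\<dots> \<le> (\<Sum>i=1..N. \<Sum>j=1..N. g i j * (c * c))"
    by (intro sum_mono mult_left_mono mult_mono sum_q) auto
  also have "\<dots> = (\<Sum>(i, j)\<in>{1..N} \<times> {1..N}. g i j) * (c * c)"
    by (simp add: sum_distrib_right sum.cartesian_product case_prod_unfold)
  also have "(\<Sum>(i, j)\<in>{1..N} \<times> {1..N}. g i j) =
      (\<Sum>(i, j)\<in>{1..N} \<times> {1..N} \<inter> {(i, j). i \<noteq> j}. Lp_norm M p (\<lambda>\<omega>. a 0 i \<omega> * a 0 j \<omega>))"
    by (intro sum.mono_neutral_cong_right) (auto simp: g_def)
  also have "\<dots> \<le> (\<Sum>\<^sub>\<infinity>(i, j)\<in>{(i, j). 1 \<le> i \<and> 1 \<le> j \<and> i \<noteq> j}. Lp_norm M p (\<lambda>\<omega>. a 0 i \<omega> * a 0 j \<omega>))"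
    by (intro sum_le_infsum_ennreal) auto
  finally show ?thesis
    by (simp add: c_def power2_eq_square mult_right_mono)
qed

text \<open>Through this closed pair, finiteness of \<open>rho p\<close> yields finite moments of
  order \<open>2 * p\<close> for the single weights.\<close>

lemma single_step_closed: "1 \<le> j \<Longrightarrow> ([j], [j]) \<in> closed_steps"
  by (simp add: closed_steps_def steps_def)

text \<open>The a priori finiteness on which absorption relies. For fixed \<open>N\<close> only
  finitely many first steps occur, so finiteness of \<open>rho p\<close> is enough and no smallness
  is involved.\<close>

lemma moment_X_finite:
  assumes p: "1 \<le> p" and rho: "rho p < \<top>" and b: "moment M (2 * p) (b 0) < \<top>"
  shows "moment M (2 * p) (X N 0) < \<top>"
proof (induction N rule: less_induct)
  case (less N)
  let ?f = "\<lambda>j \<omega>. a 0 j \<omega> * X (N - j) (int j) \<omega>"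
  have X: "X N 0 = (\<lambda>\<omega>. b 0 \<omega> + (\<Sum>j=1..N. ?f j \<omega>))"
    unfolding X_def by (subst path_sum_eq) simp
  have fm: "?f j \<in> borel_measurable M" if "j \<in> {1..N}" for j
    using that by (intro borel_measurable_times) auto
  have fn: "0 \<le> ?f j \<omega>" if "j \<in> {1..N}" "\<omega> \<in> space M" for j \<omega>
    using that by (intro mult_nonneg_nonneg a_nonneg X_nonneg) auto
  have "Lp_norm M (2 * p) (X N 0) \<le> Lp_norm M (2 * p) (b 0) + Lp_norm M (2 * p) (\<lambda>\<omega>. \<Sum>j=1..N. ?f j \<omega>)"
    unfolding X using p fn fm by (intro Lp_norm_add_le borel_measurable_sum) (auto intro!: sum_nonneg b_nonneg)
  also have "\<dots> \<le> Lp_norm M (2 * p) (b 0) + (\<Sum>j=1..N. Lp_norm M (2 * p) (?f j))"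
    using p fm fn by (intro add_left_mono Lp_norm_sum_le) auto
  also have "\<dots> < \<top>"
  proof -
    have "Lp_norm M (2 * p) (?f j) < \<top>" if j: "j \<in> {1..N}" for j
    proof -
      have "a 0 j \<in> borel_measurable (info (past (int j)))"
        using j by (intro a_info) (auto simp: past_def intro!: exI[of _ 0] exI[of _ j])
      then have "moment M (2 * p) (?f j) = moment M (2 * p) (a 0 j) * moment M (2 * p) (X (N - j) 0)"
        using moment_past_future[of "a 0 j" "int j" "2 * p" "N - j" 1] a_nonneg j by simp
      also have "\<dots> < \<top>"
      proof -
        have "Lp_norm M p (\<lambda>\<omega>. W 0 [j] \<omega> * W 0 [j] \<omega>) \<le> rho p"
          using member_le_infsum_ennreal[of "([j], [j])" closed_steps
              "\<lambda>(x, y). Lp_norm M p (\<lambda>\<omega>. W 0 x \<omega> * W 0 y \<omega>)"] single_step_closed j by simp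
        then have "Lp_norm M p (\<lambda>\<omega>. (a 0 j \<omega>)\<^sup>2) < \<top>"
          using rho by (simp add: W_Cons power2_eq_square le_less_trans)
        then have "moment M (2 * p) (a 0 j) < \<top>"
          using j a_nonneg by (subst (asm) Lp_norm_less_top_iff, subst (asm) moment_power2) auto
        moreover have "moment M (2 * p) (X (N - j) 0) < \<top>" using j by (intro less.IH) auto
        ultimately show ?thesis by (rule ennreal_mult_less_top[THEN iffD2, OF disjI2, OF disjI2, OF conjI])
      qed
      finally show ?thesis by (simp add: Lp_norm_less_top_iff)
    qed
    then show ?thesis using b by (simp add: Lp_norm_less_top_iff)
  qed
  finally show ?case by (simp add: Lp_norm_less_top_iff)
qed

text \<open>Pairs of paths one of which is trivial contribute \<open>2 b X\<close>; half of the gap \<open>1 - rho\<close> absorbs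
  this term through \<open>2 b X \<le> k b\<^sup>2 + X\<^sup>2 / k\<close>.\<close>

lemma X_square_le:
  assumes w: "\<omega> \<in> space M" and k: "0 < k"
  shows "(X N 0 \<omega>)\<^sup>2 \<le> k * (b 0 \<omega>)\<^sup>2 + 1 / k * (X N 0 \<omega>)\<^sup>2 +
    ((\<Sum>(x, y)\<in>disjoint_upto N \<inter> {(x, y). x \<noteq> [] \<and> y \<noteq> []}. V 0 x \<omega> * V 0 y \<omega>) +
    (\<Sum>(x, y)\<in>closed_upto N. W 0 x \<omega> * W 0 y \<omega> * (X (N - sum_list x) (int (sum_list x)) \<omega>)\<^sup>2))"
proof -
  let ?D = "disjoint_upto N" and ?E = "disjoint_upto N \<inter> {(x, y). x \<noteq> [] \<and> y \<noteq> []}"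
  let ?v = "\<lambda>(x, y). V 0 x \<omega> * V 0 y \<omega>"
  have v: "0 \<le> ?v z" if "z \<in> steps_upto N \<times> steps_upto N" for z
    using that w by (auto intro!: mult_nonneg_nonneg V_nonneg steps_upto_steps)
  have nil: "[] \<in> steps_upto N" by (simp add: steps_upto_def)
  have XV: "X N 0 \<omega> = (\<Sum>x\<in>steps_upto N. V 0 x \<omega>)"
    by (simp add: X_def path_sum_def V_def W_def)
  have "(\<Sum>z\<in>?D. ?v z) \<le> (\<Sum>z\<in>?E \<union> ({[]} \<times> steps_upto N \<union> steps_upto N \<times> {[]}). ?v z)"
  proof (rule sum_mono2)
    show "finite (?E \<union> ({[]} \<times> steps_upto N \<union> steps_upto N \<times> {[]}))" by simp
    show "?D \<subseteq> ?E \<union> ({[]} \<times> steps_upto N \<union> steps_upto N \<times> {[]})"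
      by (auto simp: disjoint_upto_def)
    show "0 \<le> ?v z" if "z \<in> ?E \<union> ({[]} \<times> steps_upto N \<union> steps_upto N \<times> {[]}) - ?D" for z
      by (rule v) (use that nil in \<open>auto simp: disjoint_upto_def\<close>)
  qed
  \<comment> \<open>The pair \<open>([], [])\<close> is counted in both of the last sums; by
    nonnegativity this only enlarges the bound.\<close>
  also have "\<dots> \<le> (\<Sum>z\<in>?E. ?v z) + ((\<Sum>z\<in>{[]} \<times> steps_upto N. ?v z) + (\<Sum>z\<in>steps_upto N \<times> {[]}. ?v z))"
  proof -
    have sub: "(\<Sum>z\<in>A \<union> B. ?v z) \<le> (\<Sum>z\<in>A. ?v z) + (\<Sum>z\<in>B. ?v z)"
      if "A \<subseteq> steps_upto N \<times> steps_upto N" "B \<subseteq> steps_upto N \<times> steps_upto N" for A B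
    proof -
      have "finite A" "finite B"
        using that finite_subset[OF _ finite_cartesian_product[OF finite_steps_upto finite_steps_upto]]
        by blast+
      then have "(\<Sum>z\<in>A \<union> B. ?v z) + (\<Sum>z\<in>A \<inter> B. ?v z) = (\<Sum>z\<in>A. ?v z) + (\<Sum>z\<in>B. ?v z)"
        by (rule sum.union_inter)
      moreover have "0 \<le> (\<Sum>z\<in>A \<inter> B. ?v z)" using that by (intro sum_nonneg v) auto
      ultimately show ?thesis by linarith
    qed
    show ?thesis
      by (rule order_trans[OF sub add_left_mono[OF sub]]) (use nil in \<open>auto simp: disjoint_upto_def\<close>)
  qed
  also have "(\<Sum>z\<in>{[]} \<times> steps_upto N. ?v z) = b 0 \<omega> * X N 0 \<omega>"
    by (simp add: XV sum_distrib_left flip: sum.cartesian_product)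
  also have "(\<Sum>z\<in>steps_upto N \<times> {[]}. ?v z) = b 0 \<omega> * X N 0 \<omega>"
    by (simp add: XV sum_distrib_left mult.commute flip: sum.cartesian_product)
  finally have "(\<Sum>z\<in>?D. ?v z) \<le> (\<Sum>z\<in>?E. ?v z) + 2 * (b 0 \<omega> * X N 0 \<omega>)" by simp
  moreover have "2 * (b 0 \<omega> * X N 0 \<omega>) \<le> k * (b 0 \<omega>)\<^sup>2 + 1 / k * (X N 0 \<omega>)\<^sup>2"
  proof -
    have "k * (b 0 \<omega>)\<^sup>2 + 1 / k * (X N 0 \<omega>)\<^sup>2 - 2 * (b 0 \<omega> * X N 0 \<omega>) = (k * b 0 \<omega> - X N 0 \<omega>)\<^sup>2 / k"
      using k by (simp add: power2_eq_square field_simps)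
    then show ?thesis using k by (metis diff_ge_0_iff_ge divide_nonneg_pos zero_le_power2)
  qed
  ultimately show ?thesis unfolding X_square[of N \<omega>] by linarith
qed

theorem xi_bounded:
  assumes p: "1 \<le> p" and r: "(\<Sum>\<^sub>\<infinity>j\<in>{1..}. Lp_norm M p (a 0 j)) < 1" and rho: "rho p < 1"
    and g: "(\<Sum>\<^sub>\<infinity>(i, j)\<in>{(i, j). 1 \<le> i \<and> 1 \<le> j \<and> i \<noteq> j}. Lp_norm M p (\<lambda>\<omega>. a 0 i \<omega> * a 0 j \<omega>)) < \<top>"
    and b: "moment M (2 * p) (b 0) < \<top>"
  shows "\<exists>C. \<forall>N. xi p N \<le> ennreal C"
proof -
  obtain s where s: "0 \<le> s" "s < 1" "(\<Sum>\<^sub>\<infinity>j\<in>{1..}. Lp_norm M p (a 0 j)) = ennreal s"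
    using r by (cases "\<Sum>\<^sub>\<infinity>j\<in>{1..}. Lp_norm M p (a 0 j)") (auto simp: ennreal_less_iff simp flip: ennreal_1)
  obtain t where t: "0 \<le> t" "t < 1" "rho p = ennreal t"
    using rho by (cases "rho p") (auto simp: ennreal_less_iff simp flip: ennreal_1)
  have sums: "(\<Sum>j=1..N. Lp_norm M p (a 0 j)) \<le> ennreal s" for N
    unfolding s(3)[symmetric] by (intro sum_le_infsum_ennreal) auto
  let ?g = "\<Sum>\<^sub>\<infinity>(i, j)\<in>{(i, j). 1 \<le> i \<and> 1 \<le> j \<and> i \<noteq> j}. Lp_norm M p (\<lambda>\<omega>. a 0 i \<omega> * a 0 j \<omega>)"
  let ?b2 = "Lp_norm M p (\<lambda>\<omega>. (b 0 \<omega>)\<^sup>2)"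
  \<comment> \<open>Makes \<open>1 / k + t = (1 + t) / 2\<close>, which is still below 1.\<close>
  define k where "k = 2 / (1 - t)"
  have k: "0 < k" "1 / k = (1 - t) / 2" using t by (auto simp: k_def)
  define A where "A = ennreal k * ?b2 + ?g * (ennreal (1 / (1 - s)) * Lp_norm M p (b 0))\<^sup>2"
  have "?b2 < \<top>"
    using b by (simp add: Lp_norm_less_top_iff moment_power2 b_nonneg)
  moreover have "Lp_norm M p (b 0) < \<top>"
  proof -
    \<comment> \<open>The orders \<open>p\<close> and \<open>2 * p\<close> are compared through
      \<open>y \<le> 1 + y\<^sup>2\<close>, the total mass being 1.\<close>
    have "moment M p (b 0) \<le> (\<integral>\<^sup>+\<omega>. 1 + ennreal (b 0 \<omega> powr (2 * p)) \<partial>M)"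
      unfolding moment_def
    proof (intro nn_integral_mono)
      fix \<omega>
      have "2 * (b 0 \<omega> powr p) \<le> 1 + (b 0 \<omega> powr p)\<^sup>2"
        using zero_le_power2[of "b 0 \<omega> powr p - 1"] by (simp add: power2_diff)
      then have "b 0 \<omega> powr p \<le> 1 + (b 0 \<omega> powr p)\<^sup>2"
        using powr_ge_zero[of "b 0 \<omega>" p] by linarith
      also have "(b 0 \<omega> powr p)\<^sup>2 = b 0 \<omega> powr (2 * p)"
        by (simp add: power2_eq_square flip: powr_add)
      finally have "ennreal (b 0 \<omega> powr p) \<le> ennreal (1 + b 0 \<omega> powr (2 * p))" by (rule ennreal_leI)
      then show "ennreal (b 0 \<omega> powr p) \<le> 1 + ennreal (b 0 \<omega> powr (2 * p))" by simp
    qed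
    also have "\<dots> = 1 + moment M (2 * p) (b 0)"
      unfolding moment_def by (subst nn_integral_add) (auto simp: emeasure_space_1)
    also have "\<dots> < \<top>" using b by simp
    finally show ?thesis by (simp add: Lp_norm_less_top_iff)
  qed
  ultimately have "A < \<top>"
    using g by (simp add: A_def ennreal_mult_less_top power2_eq_square)
  then obtain A' where A': "0 \<le> A'" "A = ennreal A'" by (cases A) auto
  have "xi p N \<le> ennreal (A' / (1 - (1 + t) / 2))" for N
  proof (rule ennreal_le_of_le_affine)
    let ?E = "disjoint_upto N \<inter> {(x, y). x \<noteq> [] \<and> y \<noteq> []}"
    let ?v = "\<lambda>(x, y) \<omega>. V 0 x \<omega> * V 0 y \<omega>"
    let ?f = "\<lambda>(x, y) \<omega>. W 0 x \<omega> * W 0 y \<omega> * (X (N - sum_list x) (int (sum_list x)) \<omega>)\<^sup>2"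
    have vm: "?v z \<in> borel_measurable M" if "z \<in> ?E" for z
      using that by (auto simp: disjoint_upto_def intro!: borel_measurable_times V_measurable dest: steps_upto_steps)
    have vn: "0 \<le> ?v z \<omega>" if "z \<in> ?E" "\<omega> \<in> space M" for z \<omega>
      using that by (auto simp: disjoint_upto_def intro!: mult_nonneg_nonneg V_nonneg dest: steps_upto_steps)
    have fm: "?f z \<in> borel_measurable M" if z: "z \<in> closed_upto N" for z
    proof (cases z)
      case (Pair x y)
      then have [measurable]: "x \<in> steps" "y \<in> steps"
        using z closed_upto_closed closed_stepsD by blast+
      show ?thesis unfolding Pair prod.case by measurable
    qed
    have fn: "0 \<le> ?f z \<omega>" if z: "z \<in> closed_upto N" "\<omega> \<in> space M" for z \<omega>
      using z closed_upto_closed[OF z(1)] closed_stepsD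
      by (cases z) (auto intro!: mult_nonneg_nonneg W_nonneg)
    let ?kb = "\<lambda>\<omega>. k * (b 0 \<omega>)\<^sup>2" and ?kX = "\<lambda>\<omega>. 1 / k * (X N 0 \<omega>)\<^sup>2"
    let ?sv = "\<lambda>\<omega>. \<Sum>z\<in>?E. ?v z \<omega>" and ?sf = "\<lambda>\<omega>. \<Sum>z\<in>closed_upto N. ?f z \<omega>"
    have svm [measurable]: "?sv \<in> borel_measurable M" by (intro borel_measurable_sum vm)
    have sfm [measurable]: "?sf \<in> borel_measurable M" by (intro borel_measurable_sum fm)
    have svn: "0 \<le> ?sv \<omega>" "0 \<le> ?sf \<omega>" if w: "\<omega> \<in> space M" for \<omega>
      by (rule sum_nonneg, erule vn[OF _ w], rule sum_nonneg, erule fn[OF _ w])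
    \<comment> \<open>The four terms are the two from absorbing the trivial paths, the disjoint
      pairs of nontrivial paths, and the closed pairs.\<close>
    have "xi p N \<le> Lp_norm M p (\<lambda>\<omega>. (?kb \<omega> + ?kX \<omega>) + (?sv \<omega> + ?sf \<omega>))"
      using p X_square_le[OF _ k(1), of _ N] by (intro Lp_norm_mono) (simp_all add: case_prod_unfold)
    also have "\<dots> \<le> Lp_norm M p (\<lambda>\<omega>. ?kb \<omega> + ?kX \<omega>) + Lp_norm M p (\<lambda>\<omega>. ?sv \<omega> + ?sf \<omega>)"
      using p k svn borel_measurable_add[OF svm sfm]
      by (intro Lp_norm_add_le) (auto intro!: add_nonneg_nonneg)
    also have "\<dots> \<le> (Lp_norm M p ?kb + Lp_norm M p ?kX) + (Lp_norm M p ?sv + Lp_norm M p ?sf)"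
      using p k svn svm sfm by (intro add_mono Lp_norm_add_le) auto
    also have "Lp_norm M p ?kb = ennreal k * ?b2"
      using p k by (intro Lp_norm_cmult) auto
    also have "Lp_norm M p ?kX = ennreal (1 / k) * xi p N"
      using p k by (intro Lp_norm_cmult) auto
    also have "Lp_norm M p ?sv \<le> (\<Sum>z\<in>?E. Lp_norm M p (?v z))"
      using p vm vn by (intro Lp_norm_sum_le) auto
    also have "\<dots> = (\<Sum>(x, y)\<in>?E. Lp_norm M p (\<lambda>\<omega>. V 0 x \<omega> * V 0 y \<omega>))"
      by (simp add: case_prod_unfold)
    also have "\<dots> \<le> ?g * (ennreal (1 / (1 - s)) * Lp_norm M p (b 0))\<^sup>2"
      using p s by (intro sum_disjoint_le sums) auto
    also have "Lp_norm M p ?sf \<le> (\<Sum>z\<in>closed_upto N. Lp_norm M p (?f z))"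
      using p fm fn by (intro Lp_norm_sum_le) auto
    also have "\<dots> \<le> (\<Sum>z\<in>closed_upto N. (\<lambda>(x, y). Lp_norm M p (\<lambda>\<omega>. W 0 x \<omega> * W 0 y \<omega>)) z * xi p N)"
    proof (rule sum_mono, clarify)
      fix x y assume "(x, y) \<in> closed_upto N"
      then have "(x, y) \<in> closed_steps" by (rule closed_upto_closed)
      then show "Lp_norm M p (\<lambda>\<omega>. W 0 x \<omega> * W 0 y \<omega> * (X (N - sum_list x) (int (sum_list x)) \<omega>)\<^sup>2) \<le>
          Lp_norm M p (\<lambda>\<omega>. W 0 x \<omega> * W 0 y \<omega>) * xi p N"
        using p by (simp add: closed_Lp_norm mult_left_mono xi_mono)
    qed
    also have "\<dots> \<le> rho p * xi p N"
      unfolding sum_distrib_right[symmetric]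
      by (intro mult_right_mono sum_le_infsum_ennreal) (auto dest: closed_upto_closed)
    finally have "xi p N \<le> (ennreal k * ?b2 + ennreal (1 / k) * xi p N) +
        (?g * (ennreal (1 / (1 - s)) * Lp_norm M p (b 0))\<^sup>2 + rho p * xi p N)"
      by (simp add: add_mono add_left_mono)
    also have "\<dots> = A + (ennreal (1 / k) + rho p) * xi p N"
      by (simp add: A_def algebra_simps)
    also have "ennreal (1 / k) + rho p = ennreal ((1 + t) / 2)"
      unfolding k t(3) using t by (simp add: field_simps flip: ennreal_plus)
    finally show "xi p N \<le> ennreal A' + ennreal ((1 + t) / 2) * xi p N" by (simp add: A')
    have "rho p < \<top>" using t by simp
    then show "xi p N < \<top>"
      using moment_X_finite[OF p _ b, of N]
      by (simp add: Lp_norm_less_top_iff moment_power2 X_nonneg)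
  qed (use A' t in auto)
  then show ?thesis by blast
qed

end

section \<open>Stationarity and independence under (A1) and (A2)\<close>

lemma (in prob_space) indep_sets_reindex:
  assumes "indep_sets F UNIV" "inj g"
  shows "indep_sets (\<lambda>i. F (g i)) UNIV"
proof (rule indep_setsI)
  show "F (g i) \<subseteq> events" for i using assms(1) by (auto simp: indep_sets_def)
next
  fix A J assume J: "J \<noteq> {}" "finite J" "\<forall>j\<in>J. A j \<in> F (g j)"
  have inj: "inj_on g J" using assms(2) by (auto intro: inj_on_subset)
  have "prob (\<Inter>i\<in>g ` J. A (inv g i)) = (\<Prod>i\<in>g ` J. prob (A (inv g i)))"
    using J assms(2) by (intro indep_setsD[OF assms(1)]) auto
  then show "prob (\<Inter>j\<in>J. A j) = (\<Prod>j\<in>J. prob (A j))"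
    using assms(2) by (simp add: prod.reindex[OF inj])
qed

lemma (in prob_space) indep_vars_shift:
  fixes Y :: "int \<Rightarrow> 'a \<Rightarrow> 'b"
  assumes "indep_vars (\<lambda>_. T) Y UNIV"
  shows "indep_vars (\<lambda>_. T) (\<lambda>t. Y (t - c)) UNIV"
proof -
  have "inj (\<lambda>t. t - c)" by (auto intro: injI)
  then show ?thesis
    using assms indep_sets_reindex[where g = "\<lambda>t. t - c"] unfolding indep_vars_def2 by auto
qed

text \<open>The joint law is a power of the common law \<open>D\<close>, which does not see the
  shift.\<close>

lemma (in prob_space) distr_iid_shift:
  fixes Y :: "int \<Rightarrow> 'a \<Rightarrow> 'b"
  assumes "indep_vars (\<lambda>_. T) Y UNIV" "\<And>t. distr M T (Y t) = D"
  shows "distr M (PiM UNIV (\<lambda>_. T)) (\<lambda>\<omega>. \<lambda>t\<in>UNIV. Y (t - c) \<omega>) = PiM UNIV (\<lambda>_. D)"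
proof -
  have sh: "indep_vars (\<lambda>_. T) (\<lambda>t. Y (t - c)) UNIV" by (rule indep_vars_shift) fact
  then have "\<And>t. random_variable T (Y (t - c))" by (auto simp: indep_vars_def)
  then have "distr M (PiM UNIV (\<lambda>_. T)) (\<lambda>\<omega>. \<lambda>t\<in>UNIV. Y (t - c) \<omega>) =
      PiM UNIV (\<lambda>t. distr M T (Y (t - c)))"
    using sh by (subst (asm) indep_vars_iff_distr_eq_PiM) auto
  then show ?thesis by (simp add: assms(2))
qed

lemma indep_rv_compose:
  assumes "indep_rv M S X T Y" and "prob_space M"
    and f: "f \<in> measurable S S'" and g: "g \<in> measurable T T'"
  shows "indep_rv M S' (\<lambda>\<omega>. f (X \<omega>)) T' (\<lambda>\<omega>. g (Y \<omega>))"
proof -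
  interpret prob_space M by fact
  have X: "X \<in> measurable M S" and Y: "Y \<in> measurable M T"
    and ind: "indep_set {X -` U \<inter> space M |U. U \<in> sets S} {Y -` V \<inter> space M |V. V \<in> sets T}"
    using assms(1) by (auto simp: indep_rv_def)
  have sub: "{(\<lambda>\<omega>. h (Z \<omega>)) -` U \<inter> space M |U. U \<in> sets R'} \<subseteq> {Z -` U \<inter> space M |U. U \<in> sets R}"
    if Z: "Z \<in> measurable M R" and h: "h \<in> measurable R R'" for Z R h R'
  proof clarify
    fix U assume "U \<in> sets R'"
    then have "h -` U \<inter> space R \<in> sets R" using h by (rule measurable_sets[rotated])
    moreover have "(\<lambda>\<omega>. h (Z \<omega>)) -` U \<inter> space M = Z -` (h -` U \<inter> space R) \<inter> space M"
      using measurable_space[OF Z] by auto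
    ultimately show "\<exists>V. (\<lambda>\<omega>. h (Z \<omega>)) -` U \<inter> space M = Z -` V \<inter> space M \<and> V \<in> sets R" by blast
  qed
  show ?thesis
    unfolding indep_rv_def
  proof (intro conjI)
    show "(\<lambda>\<omega>. f (X \<omega>)) \<in> measurable M S'" "(\<lambda>\<omega>. g (Y \<omega>)) \<in> measurable M T'"
      using measurable_compose[OF X f] measurable_compose[OF Y g] .
    show "indep_set {(\<lambda>\<omega>. f (X \<omega>)) -` U \<inter> space M |U. U \<in> sets S'}
        {(\<lambda>\<omega>. g (Y \<omega>)) -` V \<inter> space M |V. V \<in> sets T'}"
      using ind sub[OF X f] sub[OF Y g] unfolding indep_sets2_eq by (meson subset_iff subset_trans)
  qed
qed

lemma distr_indep_rv:
  assumes "indep_rv M S X T Y" and "prob_space M"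
  shows "distr M (S \<Otimes>\<^sub>M T) (\<lambda>\<omega>. (X \<omega>, Y \<omega>)) = distr M S X \<Otimes>\<^sub>M distr M T Y"
proof -
  interpret prob_space M by fact
  have X: "X \<in> measurable M S" and Y: "Y \<in> measurable M T"
    and ind: "indep_set {X -` U \<inter> space M |U. U \<in> sets S} {Y -` V \<inter> space M |V. V \<in> sets T}"
    using assms(1) by (auto simp: indep_rv_def)
  interpret X: prob_space "distr M S X" by (rule prob_space_distr) fact
  interpret Y: prob_space "distr M T Y" by (rule prob_space_distr) fact
  show ?thesis
  proof (rule pair_measure_eqI[symmetric])
    show "sigma_finite_measure (distr M S X)" "sigma_finite_measure (distr M T Y)" ..
    show "sets (distr M S X \<Otimes>\<^sub>M distr M T Y) = sets (distr M (S \<Otimes>\<^sub>M T) (\<lambda>\<omega>. (X \<omega>, Y \<omega>)))"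
      by (simp cong: sets_pair_measure_cong)
  next
    fix U V assume "U \<in> sets (distr M S X)" "V \<in> sets (distr M T Y)"
    then have UV: "U \<in> sets S" "V \<in> sets T" by auto
    have "prob ((X -` U \<inter> space M) \<inter> (Y -` V \<inter> space M)) = prob (X -` U \<inter> space M) * prob (Y -` V \<inter> space M)"
      using ind UV by (intro indep_setD[OF ind]) auto
    moreover have "(\<lambda>\<omega>. (X \<omega>, Y \<omega>)) -` (U \<times> V) \<inter> space M = (X -` U \<inter> space M) \<inter> (Y -` V \<inter> space M)"
      by auto
    ultimately show "emeasure (distr M S X) U * emeasure (distr M T Y) V =
        emeasure (distr M (S \<Otimes>\<^sub>M T) (\<lambda>\<omega>. (X \<omega>, Y \<omega>))) (U \<times> V)"
      using X Y UV by (simp add: emeasure_distr emeasure_eq_measure ennreal_mult)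
  qed
qed

lemma nn_integral_cong_distr:
  assumes "X \<in> measurable M S" "Y \<in> measurable P S" "distr M S X = distr P S Y"
    and "f \<in> borel_measurable S"
  shows "(\<integral>\<^sup>+\<omega>. f (X \<omega>) \<partial>M) = (\<integral>\<^sup>+\<omega>. f (Y \<omega>) \<partial>P)"
proof -
  have "(\<integral>\<^sup>+x. f x \<partial>distr M S X) = (\<integral>\<^sup>+x. f x \<partial>distr P S Y)" by (simp only: assms(3))
  then show ?thesis
    using assms(4) by (simp add: nn_integral_distr[OF assms(1)] nn_integral_distr[OF assms(2)])
qed

text \<open>Taking powers acts coordinatewise and measurably on the environment, hence respects the
  generating \<sigma>-algebras and stationarity.\<close>

lemma random_env_powr:
  assumes "random_env M S ka kb a b"
  shows "random_env M S ka kb (\<lambda>u j \<omega>. a u j \<omega> powr q) (\<lambda>u \<omega>. b u \<omega> powr q)"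
proof -
  interpret random_env M S ka kb a b by fact
  let ?a = "\<lambda>u j \<omega>. a u j \<omega> powr q" and ?b = "\<lambda>u \<omega>. b u \<omega> powr q"
  let ?h = "\<lambda>z :: (int \<times> nat \<Rightarrow> real) \<times> (int \<Rightarrow> real).
    (\<lambda>k\<in>UNIV \<times> {1..}. fst z k powr q, \<lambda>u\<in>UNIV. snd z u powr q)"
  have h: "?h \<in> measurable env_space env_space"
  proof (intro measurable_Pair measurable_restrict)
    fix k :: "int \<times> nat" assume "k \<in> UNIV \<times> {1..}"
    then show "(\<lambda>z. fst z k powr q) \<in> borel_measurable env_space"
      using env_component_measurable(1)[of "snd k" "fst k"] by auto
  next
    show "(\<lambda>z. snd z u powr q) \<in> borel_measurable env_space" for u :: int
      using env_component_measurable(2)[of u] by auto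
  qed
  have "env a b c \<in> measurable M env_space" for c by (intro env_measurable) auto
  then have eq: "distr M env_space (env ?a ?b c) = distr (distr M env_space (env a b c)) env_space ?h" for c
    by (subst distr_distr[OF h]) (auto intro!: distr_cong simp: env_def fun_eq_iff)
  then have st: "distr M env_space (env ?a ?b c) = distr M env_space (env ?a ?b 0)" for c
    by (simp only: eq[of c] eq[of 0] stationary[of c])
  show ?thesis
  proof
    show "?a u j \<in> borel_measurable (sigma (space M) (S (ka u j)))" if "1 \<le> j" for u j
      using a_S[OF that] by measurable
    show "?b u \<in> borel_measurable (sigma (space M) (S (kb u)))" for u
      using b_S by measurable
  qed (use S_indep S_stable ka_eqD ka_eq_kbD kb_eqD st in auto)
qed

lemma measurable_sigma_vimage:
  assumes "f \<in> \<Omega> \<rightarrow> space N"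
  shows "f \<in> measurable (sigma \<Omega> {f -` U \<inter> \<Omega> |U. U \<in> sets N}) N"
proof (rule measurableI)
  have sp: "{f -` U \<inter> \<Omega> |U. U \<in> sets N} \<subseteq> Pow \<Omega>" by auto
  note [simp] = space_measure_of[OF sp] sets_measure_of[OF sp]
  show "f x \<in> space N" if "x \<in> space (sigma \<Omega> {f -` U \<inter> \<Omega> |U. U \<in> sets N})" for x
    using that assms by auto
  show "f -` A \<inter> space (sigma \<Omega> {f -` U \<inter> \<Omega> |U. U \<in> sets N}) \<in> sets (sigma \<Omega> {f -` U \<inter> \<Omega> |U. U \<in> sets N})"
    if "A \<in> sets N" for A
    using that by auto
qed

lemma Int_stable_vimage: "Int_stable {f -` U \<inter> \<Omega> |U. U \<in> sets N}"
proof (rule Int_stableI)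
  fix a b assume "a \<in> {f -` U \<inter> \<Omega> |U. U \<in> sets N}" "b \<in> {f -` U \<inter> \<Omega> |U. U \<in> sets N}"
  then obtain U V where "a = f -` U \<inter> \<Omega>" "b = f -` V \<inter> \<Omega>" "U \<in> sets N" "V \<in> sets N" by auto
  then show "a \<inter> b \<in> {f -` U \<inter> \<Omega> |U. U \<in> sets N}"
    by (intro CollectI exI[of _ "U \<inter> V"]) auto
qed

locale stochastic_recursion =
  fixes P :: "'a measure" and A :: "nat \<Rightarrow> 'a \<Rightarrow> real" and B :: "'a \<Rightarrow> real"
    and M :: "'b measure" and \<A> :: "int \<Rightarrow> nat \<Rightarrow> 'b \<Rightarrow> real" and \<B> :: "int \<Rightarrow> 'b \<Rightarrow> real"
  assumes P: "prob_space P" and M: "prob_space M"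
    and A_measurable: "\<And>j. j \<ge> 1 \<Longrightarrow> A j \<in> borel_measurable P"
    and B_measurable: "B \<in> borel_measurable P"
    and \<A>_measurable: "\<And>t j. j \<ge> 1 \<Longrightarrow> \<A> t j \<in> borel_measurable M"
    and \<A>_nonneg: "\<And>t j \<omega>. j \<ge> 1 \<Longrightarrow> \<omega> \<in> space M \<Longrightarrow> \<A> t j \<omega> \<ge> 0"
    and \<B>_measurable: "\<And>t. \<B> t \<in> borel_measurable M"
    and \<B>_nonneg: "\<And>t \<omega>. \<omega> \<in> space M \<Longrightarrow> \<B> t \<omega> \<ge> 0"
begin

abbreviation ra :: "int \<Rightarrow> nat \<Rightarrow> 'b \<Rightarrow> real" where "ra u j \<omega> \<equiv> \<A> (- u) j \<omega>"
abbreviation rb :: "int \<Rightarrow> 'b \<Rightarrow> real" where "rb u \<omega> \<equiv> \<B> (- u) \<omega>"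

section \<open>The reversed environment under (A1)\<close>

definition Z :: "int \<Rightarrow> 'b \<Rightarrow> (nat \<Rightarrow> real) \<times> real" where
  "Z t \<omega> = (\<lambda>j\<in>{1..}. \<A> t j \<omega>, \<B> t \<omega>)"

lemma fst_component_measurable:
  "1 \<le> j \<Longrightarrow> (\<lambda>z. fst z j) \<in> borel_measurable (seq_space \<Otimes>\<^sub>M (borel :: real measure))"
  by (rule measurable_compose[OF measurable_fst measurable_component_singleton]) auto

text \<open>The key of an edge is the original time of its start: all weights and the
  \<open>\<B> t\<close> of one time form a single block, inside which any dependence may
  occur.\<close>

lemma A1_random_env:
  assumes "assumption_A1 P A B M \<A> \<B>"
  shows "random_env M (\<lambda>t. {Z t -` U \<inter> space M |U. U \<in> sets (seq_space \<Otimes>\<^sub>M borel)})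
    (\<lambda>u j. - u) uminus ra rb"
proof -
  interpret prob_space M by (rule M)
  let ?Sp = "seq_space \<Otimes>\<^sub>M (borel :: real measure)"
  let ?S = "\<lambda>t. {Z t -` U \<inter> space M |U. U \<in> sets ?Sp}"
  have ind: "indep_vars (\<lambda>_. ?Sp) Z UNIV"
    using assms unfolding assumption_A1_def Z_def[abs_def] by simp
  have law: "distr M ?Sp (Z t) = distr P ?Sp (\<lambda>\<omega>. (\<lambda>j\<in>{1..}. A j \<omega>, B \<omega>))" for t
    using assms unfolding assumption_A1_def Z_def[abs_def] by simp
  have ZS: "Z t \<in> measurable (sigma (space M) (?S t)) ?Sp" for t
  proof (rule measurable_sigma_vimage)
    have "Z t \<in> measurable M ?Sp" using ind by (simp add: indep_vars_def2)
    then show "Z t \<in> space M \<rightarrow> space ?Sp" by (auto dest: measurable_space)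
  qed
  \<comment> \<open>Rebuilds the reversed environment from the blocks; shifting the family of blocks
    shifts the environment, so the law of an i.i.d. family settles stationarity.\<close>
  let ?h = "\<lambda>z. (\<lambda>(u, j)\<in>UNIV \<times> {1..}. fst (z (- u)) j, \<lambda>u\<in>UNIV. snd (z (- u)))
    :: (int \<times> nat \<Rightarrow> real) \<times> (int \<Rightarrow> real)"
  have h: "?h \<in> measurable (PiM UNIV (\<lambda>_. ?Sp)) env_space"
  proof (intro measurable_Pair measurable_restrict)
    fix k :: "int \<times> nat" assume "k \<in> UNIV \<times> {1..}"
    then show "(\<lambda>z. case k of (u, j) \<Rightarrow> fst (z (- u)) j) \<in> borel_measurable (PiM UNIV (\<lambda>_. ?Sp))"
    proof (cases k)
      case (Pair u j)
      have "(\<lambda>z. z (- u)) \<in> measurable (PiM UNIV (\<lambda>_. ?Sp)) ?Sp"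
        by (rule measurable_component_singleton) simp
      moreover have "(\<lambda>z. fst z j) \<in> borel_measurable ?Sp"
        using \<open>k \<in> _\<close> Pair by (intro fst_component_measurable) simp
      ultimately show ?thesis unfolding Pair prod.case by (rule measurable_compose)
    qed
  next
    show "(\<lambda>z. snd (z (- u))) \<in> borel_measurable (PiM UNIV (\<lambda>_. ?Sp))" for u :: int
    proof -
      have "(\<lambda>z. z (- u)) \<in> measurable (PiM UNIV (\<lambda>_. ?Sp)) ?Sp"
        by (rule measurable_component_singleton) simp
      then show ?thesis by (rule measurable_compose[OF _ measurable_snd])
    qed
  qed
  have st: "distr M env_space (env ra rb c) =
      distr (PiM UNIV (\<lambda>_. distr P ?Sp (\<lambda>\<omega>. (\<lambda>j\<in>{1..}. A j \<omega>, B \<omega>)))) env_space ?h" for c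
  proof -
    have "(\<lambda>\<omega>. \<lambda>t\<in>UNIV. Z (t - c) \<omega>) \<in> measurable M (PiM UNIV (\<lambda>_. ?Sp))"
      using ind by (intro measurable_restrict) (auto simp: indep_vars_def2)
    then have "distr (distr M (PiM UNIV (\<lambda>_. ?Sp)) (\<lambda>\<omega>. \<lambda>t\<in>UNIV. Z (t - c) \<omega>)) env_space ?h =
        distr M env_space (env ra rb c)"
      by (subst distr_distr[OF h]) (auto intro!: distr_cong simp: env_def Z_def fun_eq_iff restrict_def algebra_simps)
    then show ?thesis unfolding distr_iid_shift[OF ind law] by (rule sym)
  qed
  show ?thesis
  proof
    show "indep_sets ?S UNIV" using ind by (simp add: indep_vars_def2)
    show "Int_stable (?S t)" for t by (rule Int_stable_vimage)
    show "ra u j \<in> borel_measurable (sigma (space M) (?S (- u)))" if "1 \<le> j" for u j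
      using measurable_compose[OF ZS fst_component_measurable[OF that], of "- u"] that by (simp add: Z_def)
    show "rb u \<in> borel_measurable (sigma (space M) (?S (- u)))" for u
      using measurable_compose[OF ZS measurable_snd, of "- u"] by (simp add: Z_def)
  qed (use st \<A>_nonneg \<B>_nonneg in auto)
qed

lemma A1_nn_integral:
  assumes "assumption_A1 P A B M \<A> \<B>" "f \<in> borel_measurable (seq_space \<Otimes>\<^sub>M borel)"
  shows "(\<integral>\<^sup>+\<omega>. f (Z t \<omega>) \<partial>M) = (\<integral>\<^sup>+\<omega>. f (\<lambda>j\<in>{1..}. A j \<omega>, B \<omega>) \<partial>P)"
proof -
  let ?Sp = "seq_space \<Otimes>\<^sub>M (borel :: real measure)"
  have "Z t \<in> measurable M ?Sp"
    unfolding Z_def[abs_def] by (intro measurable_Pair measurable_restrict \<A>_measurable \<B>_measurable) simp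
  moreover have "(\<lambda>\<omega>. (\<lambda>j\<in>{1..}. A j \<omega>, B \<omega>)) \<in> measurable P ?Sp"
    by (intro measurable_Pair measurable_restrict A_measurable B_measurable) simp
  moreover have "distr M ?Sp (Z t) = distr P ?Sp (\<lambda>\<omega>. (\<lambda>j\<in>{1..}. A j \<omega>, B \<omega>))"
    using assms unfolding assumption_A1_def Z_def[abs_def] by simp
  ultimately show ?thesis using assms(2) by (rule nn_integral_cong_distr)
qed

text \<open>The diagonal sequence of (A2). In reversed time \<open>ra u j\<close> is the component
  \<open>j\<close> of \<open>D (- u - int j)\<close>, so all edges with the same end point belong to
  one diagonal.\<close>

definition D :: "int \<Rightarrow> 'b \<Rightarrow> nat \<Rightarrow> real" where
  "D t \<omega> = (\<lambda>j\<in>{1..}. \<A> (t + int j) j \<omega>)"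

abbreviation S2 :: "int + int \<Rightarrow> 'b set set" where
  "S2 \<equiv> case_sum (\<lambda>t. {D t -` U \<inter> space M |U. U \<in> sets seq_space})
    (\<lambda>t. {\<B> t -` U \<inter> space M |U. U \<in> sets borel})"

text \<open>Three independence statements combine: among the diagonals, among the
  \<open>\<B> t\<close>, and between the two families. A finite intersection splits into one event
  of each family.\<close>

lemma A2_indep_sets:
  assumes "assumption_A2 P A B M \<A> \<B>"
  shows "prob_space.indep_sets M S2 UNIV"
proof -
  interpret prob_space M by (rule M)
  let ?PB = "PiM UNIV (\<lambda>_ :: int. borel :: real measure)"
  let ?PA = "PiM (UNIV \<times> {1..}) (\<lambda>_ :: int \<times> nat. borel :: real measure)"
  let ?fB = "\<lambda>\<omega>. \<lambda>t\<in>UNIV. \<B> t \<omega>" and ?fA = "\<lambda>\<omega>. \<lambda>(t, j)\<in>UNIV \<times> {1..}. \<A> t j \<omega>"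
  \<comment> \<open>The \<sigma>-algebras generated by the two whole families, between which (A2)
    states independence.\<close>
  let ?VB = "vimage_algebra (space M) ?fB ?PB" and ?VA = "vimage_algebra (space M) ?fA ?PA"
  have indD: "indep_sets (\<lambda>t. {D t -` U \<inter> space M |U. U \<in> sets seq_space}) UNIV"
    and indB: "indep_sets (\<lambda>t. {\<B> t -` U \<inter> space M |U. U \<in> sets borel}) UNIV"
    and ind: "indep_rv M ?PB ?fB ?PA ?fA"
    using assms unfolding assumption_A2_def D_def[abs_def] by (auto simp: indep_vars_def2)
  have spB: "?fB \<in> space M \<rightarrow> space ?PB" and spA: "?fA \<in> space M \<rightarrow> space ?PA"
    using ind unfolding indep_rv_def by (auto dest: measurable_space)
  have prod: "prob (b \<inter> a) = prob b * prob a" if "b \<in> sets ?VB" "a \<in> sets ?VA" for a b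
    using ind that unfolding indep_rv_def sets_vimage_algebra2[OF spB] sets_vimage_algebra2[OF spA]
    by (auto intro: indep_setD)
  have DV: "D t -` U \<inter> space M \<in> sets ?VA" if "U \<in> sets seq_space" for t U
  proof -
    have "(\<lambda>x. \<lambda>j\<in>{1..}. x (t + int j, j)) \<in> measurable ?PA seq_space"
      by (intro measurable_restrict measurable_component_singleton) auto
    from measurable_compose[OF measurable_vimage_algebra1[OF spA] this]
    have "D t \<in> measurable ?VA seq_space"
      by (simp add: D_def[abs_def] cong: restrict_cong)
    from measurable_sets[OF this that] show ?thesis by simp
  qed
  have BV: "\<B> t -` U \<inter> space M \<in> sets ?VB" if "U \<in> sets borel" for t U
  proof -
    have "\<B> t \<in> measurable ?VB borel"
      using measurable_compose[OF measurable_vimage_algebra1[OF spB] measurable_component_singleton[of t]]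
      by simp
    from measurable_sets[OF this that] show ?thesis by simp
  qed
  show ?thesis
  proof (rule indep_setsI)
    show "S2 i \<subseteq> events" for i
      using indD indB by (cases i) (auto simp: indep_sets_def)
  next
    fix E and J :: "(int + int) set" assume J: "J \<noteq> {}" "finite J" "\<forall>j\<in>J. E j \<in> S2 j"
    define J1 J2 where "J1 = Inl -` J" and "J2 = Inr -` J"
    have fin: "finite J1" "finite J2"
      using J(2) by (auto simp: J1_def J2_def intro!: finite_vimageI)
    have JJ: "J = Inl ` J1 \<union> Inr ` J2"
      unfolding J1_def J2_def by (auto simp: image_iff) (metis sum.exhaust)
    have E1: "E (Inl t) \<in> {D t -` U \<inter> space M |U. U \<in> sets seq_space}" if "t \<in> J1" for t
      using J(3) that by (force simp: J1_def)
    have E2: "E (Inr t) \<in> {\<B> t -` U \<inter> space M |U. U \<in> sets borel}" if "t \<in> J2" for t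
      using J(3) that by (force simp: J2_def)
    have E1': "E (Inl t) \<in> sets ?VA" if t: "t \<in> J1" for t
    proof -
      obtain U where "U \<in> sets seq_space" "E (Inl t) = D t -` U \<inter> space M"
        using E1[OF t] by auto
      then show ?thesis using DV by (simp only:)
    qed
    have E2': "E (Inr t) \<in> sets ?VB" if t: "t \<in> J2" for t
    proof -
      obtain U where "U \<in> sets borel" "E (Inr t) = \<B> t -` U \<inter> space M"
        using E2[OF t] by auto
      then show ?thesis using BV by (simp only:)
    qed
    \<comment> \<open>Intersecting with \<open>space M\<close> yields the whole space, not
      \<open>UNIV\<close>, when the index set is empty.\<close>
    define EA EB where "EA = space M \<inter> (\<Inter>t\<in>J1. E (Inl t))" and "EB = space M \<inter> (\<Inter>t\<in>J2. E (Inr t))"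
    have "E j \<subseteq> space M" if "j \<in> J" for j
      using bspec[OF J(3) that] by (cases j) auto
    then have "(\<Inter>j\<in>J. E j) \<subseteq> space M" using J(1) by blast
    then have "(\<Inter>j\<in>J. E j) = EB \<inter> EA"
      unfolding JJ EA_def EB_def by auto
    moreover have "EA \<in> sets ?VA"
    proof (cases "J1 = {}")
      case False
      then have "(\<Inter>t\<in>J1. E (Inl t)) \<in> sets ?VA"
        using fin E1' by (intro sets.finite_INT) auto
      then show ?thesis using sets.Int[OF sets.top[of ?VA]] by (simp add: EA_def)
    qed (use sets.top[of ?VA] in \<open>simp add: EA_def\<close>)
    moreover have "EB \<in> sets ?VB"
    proof (cases "J2 = {}")
      case False
      then have "(\<Inter>t\<in>J2. E (Inr t)) \<in> sets ?VB"
        using fin E2' by (intro sets.finite_INT) auto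
      then show ?thesis using sets.Int[OF sets.top[of ?VB]] by (simp add: EB_def)
    qed (use sets.top[of ?VB] in \<open>simp add: EB_def\<close>)
    ultimately have "prob (\<Inter>j\<in>J. E j) = prob EB * prob EA" by (simp add: prod)
    moreover have "prob EA = (\<Prod>t\<in>J1. prob (E (Inl t)))"
    proof (cases "J1 = {}")
      case False
      then have "EA = (\<Inter>t\<in>J1. E (Inl t))" using E1 by (auto simp: EA_def)
      then show ?thesis using indep_setsD[OF indD _ False fin(1), of "\<lambda>t. E (Inl t)"] E1 by auto
    qed (simp add: EA_def prob_space)
    moreover have "prob EB = (\<Prod>t\<in>J2. prob (E (Inr t)))"
    proof (cases "J2 = {}")
      case False
      then have "EB = (\<Inter>t\<in>J2. E (Inr t))" using E2 by (auto simp: EB_def)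
      then show ?thesis using indep_setsD[OF indB _ False fin(2), of "\<lambda>t. E (Inr t)"] E2 by auto
    qed (simp add: EB_def prob_space)
    moreover have "(\<Prod>j\<in>J. prob (E j)) = (\<Prod>t\<in>J1. prob (E (Inl t))) * (\<Prod>t\<in>J2. prob (E (Inr t)))"
      unfolding JJ using fin by (subst prod.union_disjoint) (auto simp: prod.reindex)
    ultimately show "prob (\<Inter>j\<in>J. E j) = (\<Prod>j\<in>J. prob (E j))" by (simp add: mult.commute)
  qed
qed

lemma A2_random_env:
  assumes "assumption_A2 P A B M \<A> \<B>"
  shows "random_env M S2 (\<lambda>u j. Inl (- u - int j)) (\<lambda>u. Inr (- u)) ra rb"
proof -
  interpret prob_space M by (rule M)
  let ?PB = "PiM UNIV (\<lambda>_ :: int. borel :: real measure)"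
  let ?PA = "PiM (UNIV \<times> {1..}) (\<lambda>_ :: int \<times> nat. borel :: real measure)"
  let ?PD = "PiM UNIV (\<lambda>_ :: int. seq_space)"
  let ?fB = "\<lambda>\<omega>. \<lambda>t\<in>UNIV. \<B> t \<omega>" and ?fA = "\<lambda>\<omega>. \<lambda>(t, j)\<in>UNIV \<times> {1..}. \<A> t j \<omega>"
  have ind: "indep_rv M ?PB ?fB ?PA ?fA"
    and indD: "indep_vars (\<lambda>_. seq_space) D UNIV" and indB: "indep_vars (\<lambda>_. borel) \<B> UNIV"
    and lawD: "\<And>t. distr M seq_space (D t) = distr P seq_space (\<lambda>\<omega>. \<lambda>j\<in>{1..}. A j \<omega>)"
    and lawB: "\<And>t. distr M borel (\<B> t) = distr P borel B"
    using assms unfolding assumption_A2_def D_def[abs_def] by auto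
  let ?h = "\<lambda>z. (\<lambda>(u, j)\<in>UNIV \<times> {1..}. snd z (- u - int j) j, \<lambda>u\<in>UNIV. fst z (- u))
    :: (int \<times> nat \<Rightarrow> real) \<times> (int \<Rightarrow> real)"
  have h: "?h \<in> measurable (?PB \<Otimes>\<^sub>M ?PD) env_space"
  proof (intro measurable_Pair measurable_restrict)
    fix k :: "int \<times> nat" assume "k \<in> UNIV \<times> {1..}"
    then show "(\<lambda>z. case k of (u, j) \<Rightarrow> snd z (- u - int j) j) \<in> borel_measurable (?PB \<Otimes>\<^sub>M ?PD)"
    proof (cases k)
      case (Pair u j)
      have "(\<lambda>z. snd z (- u - int j)) \<in> measurable (?PB \<Otimes>\<^sub>M ?PD) seq_space"
        by (rule measurable_compose[OF measurable_snd measurable_component_singleton]) simp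
      moreover have "(\<lambda>x. x j) \<in> borel_measurable seq_space"
        using \<open>k \<in> _\<close> Pair by (intro measurable_component_singleton) simp
      ultimately show ?thesis unfolding Pair prod.case by (rule measurable_compose)
    qed
  next
    show "(\<lambda>z. fst z (- u)) \<in> borel_measurable (?PB \<Otimes>\<^sub>M ?PD)" for u :: int
      by (rule measurable_compose[OF measurable_fst measurable_component_singleton]) auto
  qed
  have st: "distr M env_space (env ra rb c) =
      distr (PiM UNIV (\<lambda>_. distr P borel B) \<Otimes>\<^sub>M
        PiM UNIV (\<lambda>_. distr P seq_space (\<lambda>\<omega>. \<lambda>j\<in>{1..}. A j \<omega>))) env_space ?h" for c
  proof -
    let ?Bc = "\<lambda>\<omega>. \<lambda>t\<in>UNIV. \<B> (t - c) \<omega>" and ?Dc = "\<lambda>\<omega>. \<lambda>t\<in>UNIV. D (t - c) \<omega>"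
    have f: "(\<lambda>x. \<lambda>t\<in>UNIV. x (t - c)) \<in> measurable ?PB ?PB"
      by (intro measurable_restrict measurable_component_singleton) auto
    have g: "(\<lambda>x. \<lambda>t\<in>UNIV. \<lambda>j\<in>{1..}. x (t - c + int j, j)) \<in> measurable ?PA ?PD"
      by (intro measurable_restrict measurable_component_singleton) auto
    \<comment> \<open>The shifted families are functions of the original ones, so they remain
      independent, and their joint law is a product that does not depend on
      \<open>c\<close>.\<close>
    have "indep_rv M ?PB ?Bc ?PD ?Dc"
      using indep_rv_compose[OF ind M f g] by (simp add: D_def cong: restrict_cong)
    then have law: "distr M (?PB \<Otimes>\<^sub>M ?PD) (\<lambda>\<omega>. (?Bc \<omega>, ?Dc \<omega>)) = PiM UNIV (\<lambda>_. distr P borel B) \<Otimes>\<^sub>M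
        PiM UNIV (\<lambda>_. distr P seq_space (\<lambda>\<omega>. \<lambda>j\<in>{1..}. A j \<omega>))"
      by (subst distr_indep_rv[OF _ M])
         (simp_all only: distr_iid_shift[OF indD lawD] distr_iid_shift[OF indB lawB])
    have "?Bc \<in> measurable M ?PB" "?Dc \<in> measurable M ?PD"
      using \<open>indep_rv M ?PB ?Bc ?PD ?Dc\<close> by (auto simp: indep_rv_def)
    then have "distr (distr M (?PB \<Otimes>\<^sub>M ?PD) (\<lambda>\<omega>. (?Bc \<omega>, ?Dc \<omega>))) env_space ?h =
        distr M env_space (env ra rb c)"
      by (subst distr_distr[OF h])
         (auto intro!: distr_cong simp: env_def D_def fun_eq_iff restrict_def algebra_simps)
    then show ?thesis unfolding law by simp
  qed
  show ?thesis
  proof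
    show "indep_sets S2 UNIV" by (rule A2_indep_sets) fact
    show "Int_stable (S2 k)" for k by (cases k) (auto simp del: not_None_eq intro: Int_stable_vimage)
    show "ra u j \<in> borel_measurable (sigma (space M) (S2 (Inl (- u - int j))))" if "1 \<le> j" for u j
    proof -
      have "D t \<in> measurable (sigma (space M) {D t -` U \<inter> space M |U. U \<in> sets seq_space}) seq_space" for t
      proof (rule measurable_sigma_vimage)
        have "D t \<in> measurable M seq_space" using indD by (simp add: indep_vars_def2)
        then show "D t \<in> space M \<rightarrow> space seq_space" by (auto dest: measurable_space)
      qed
      from measurable_compose[OF this measurable_component_singleton[of j], of "- u - int j"] that
      show ?thesis by (simp add: D_def)
    qed
    show "rb u \<in> borel_measurable (sigma (space M) (S2 (Inr (- u))))" for u
      using measurable_sigma_vimage[of "\<B> (- u)" "space M" borel] by simp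
  qed (use st \<A>_nonneg \<B>_nonneg in auto)
qed

lemma A2_nn_integral:
  assumes "assumption_A2 P A B M \<A> \<B>" "f \<in> borel_measurable seq_space"
  shows "(\<integral>\<^sup>+\<omega>. f (D t \<omega>) \<partial>M) = (\<integral>\<^sup>+\<omega>. f (\<lambda>j\<in>{1..}. A j \<omega>) \<partial>P)"
proof -
  have "D t \<in> measurable M seq_space"
    unfolding D_def[abs_def] by (intro measurable_restrict \<A>_measurable) simp
  moreover have "(\<lambda>\<omega>. \<lambda>j\<in>{1..}. A j \<omega>) \<in> measurable P seq_space"
    by (intro measurable_restrict A_measurable) simp
  moreover have "distr M seq_space (D t) = distr P seq_space (\<lambda>\<omega>. \<lambda>j\<in>{1..}. A j \<omega>)"
    using assms unfolding assumption_A2_def D_def[abs_def] by simp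
  ultimately show ?thesis using assms(2) by (rule nn_integral_cong_distr)
qed

lemma nn_integral_\<A>:
  assumes "assumption_A1 P A B M \<A> \<B> \<or> assumption_A2 P A B M \<A> \<B>" "1 \<le> j"
    and f: "f \<in> borel_measurable borel"
  shows "(\<integral>\<^sup>+\<omega>. f (\<A> t j \<omega>) \<partial>M) = (\<integral>\<^sup>+\<omega>. f (A j \<omega>) \<partial>P)"
  using assms(1)
proof
  assume "assumption_A1 P A B M \<A> \<B>"
  from A1_nn_integral[OF this measurable_compose[OF fst_component_measurable f], of j t] assms(2)
  show ?thesis by (simp add: Z_def)
next
  assume "assumption_A2 P A B M \<A> \<B>"
  moreover have "(\<lambda>x. x j) \<in> borel_measurable seq_space"
    using assms(2) by (intro measurable_component_singleton) simp
  \<comment> \<open>The weight \<open>\<A> t j\<close> lies on the diagonal with index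
    \<open>t - int j\<close>.\<close>
  ultimately have "(\<integral>\<^sup>+\<omega>. f (D (t - int j) \<omega> j) \<partial>M) = (\<integral>\<^sup>+\<omega>. f ((\<lambda>j\<in>{1..}. A j \<omega>) j) \<partial>P)"
    using f by (intro A2_nn_integral[where f = "\<lambda>x. f (x j)"]) (auto intro: measurable_compose[where g = f])
  with assms(2) show ?thesis by (simp add: D_def)
qed

lemma nn_integral_\<B>:
  assumes "assumption_A1 P A B M \<A> \<B> \<or> assumption_A2 P A B M \<A> \<B>"
    and f: "f \<in> borel_measurable borel"
  shows "(\<integral>\<^sup>+\<omega>. f (\<B> t \<omega>) \<partial>M) = (\<integral>\<^sup>+\<omega>. f (B \<omega>) \<partial>P)"
  using assms(1)
proof
  assume "assumption_A1 P A B M \<A> \<B>"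
  from A1_nn_integral[OF this measurable_compose[OF measurable_snd f], of t]
  show ?thesis by (simp add: Z_def)
next
  assume "assumption_A2 P A B M \<A> \<B>"
  then have "distr M borel (\<B> t) = distr P borel B" by (simp add: assumption_A2_def)
  then show ?thesis
    by (intro nn_integral_cong_distr[where S = borel] f \<B>_measurable B_measurable)
qed

end

section \<open>Moments of the limit\<close>

text \<open>Sign conditions on \<open>phi1\<close>, \<open>phi2\<close> and their variants become
  comparisons of sums with 1.\<close>

lemma elog_nonneg_iff: "0 \<le> elog x \<longleftrightarrow> 1 \<le> x"
proof (cases x)
  case (real r)
  then show ?thesis
    by (cases "r = 0") (auto simp: elog_def ln_ge_zero_iff simp flip: ennreal_1)
qed (simp add: elog_def)

lemma elog_neg_iff: "elog x < 0 \<longleftrightarrow> x < 1"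
  using elog_nonneg_iff[of x] by (simp add: not_le[symmetric])

lemma infsum_mono_set_ennreal:
  fixes f :: "'a \<Rightarrow> ennreal"
  assumes "A \<subseteq> B"
  shows "infsum f A \<le> infsum f B"
  by (subst (1 2) nonneg_infsum_complete) (use assms in \<open>auto intro!: SUP_subset_mono\<close>)

text \<open>The test functions \<open>x \<mapsto> (min x L) powr \<theta>\<close> are bounded and continuous on \<open>[0,\<infinity>]\<close> and increase
  to \<open>x \<mapsto> x powr \<theta>\<close>.\<close>

definition cutoff :: "real \<Rightarrow> nat \<Rightarrow> ennreal \<Rightarrow> real" where
  "cutoff \<theta> L x = enn2real (min x (of_nat L)) powr \<theta>"

lemma cutoff_eq: "cutoff \<theta> L x = (if x = \<top> then real L powr \<theta> else (min (enn2real x) (real L)) powr \<theta>)"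
  by (cases x) (auto simp: cutoff_def min_def ennreal_of_nat_eq_real_of_nat top_unique)

lemma cutoff_nonneg [simp]: "0 \<le> cutoff \<theta> L x"
  by (simp add: cutoff_def)

lemma cutoff_le: "0 < \<theta> \<Longrightarrow> cutoff \<theta> L x \<le> real L powr \<theta>"
  by (auto simp: cutoff_eq intro!: powr_mono2)

lemma cutoff_mono: "0 < \<theta> \<Longrightarrow> x \<le> y \<Longrightarrow> cutoff \<theta> L x \<le> cutoff \<theta> L y"
  unfolding cutoff_def by (intro powr_mono2 enn2real_mono min.mono) (auto simp: less_top[symmetric] min_def ennreal_of_nat_eq_real_of_nat top_unique)

lemma cutoff_mono_level: "0 < \<theta> \<Longrightarrow> L \<le> L' \<Longrightarrow> cutoff \<theta> L x \<le> cutoff \<theta> L' x"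
  by (auto simp: cutoff_eq intro!: powr_mono2)

lemma continuous_cutoff:
  assumes "0 < \<theta>"
  shows "continuous_on UNIV (cutoff \<theta> L)"
  unfolding continuous_on_def
proof
  fix x :: ennreal
  have "((\<lambda>y. min y (of_nat L)) \<longlongrightarrow> min x (of_nat L)) (at x within UNIV)"
    by (intro tendsto_intros)
  \<comment> \<open>The truncated value is finite, which is where \<open>enn2real\<close> is
    continuous.\<close>
  moreover have "min x (of_nat L) = ennreal (enn2real (min x (of_nat L)))"
    by (cases x) (auto simp: min_def ennreal_of_nat_eq_real_of_nat top_unique)
  ultimately have "((\<lambda>y. enn2real (min y (of_nat L))) \<longlongrightarrow> enn2real (min x (of_nat L))) (at x within UNIV)"
    by (intro tendsto_enn2real) auto
  then show "(cutoff \<theta> L \<longlongrightarrow> cutoff \<theta> L x) (at x within UNIV)"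
    unfolding cutoff_def[abs_def] using assms by (intro tendsto_powr') auto
qed

lemma cutoff_measurable [measurable]: "cutoff \<theta> L \<in> borel_measurable borel"
  unfolding cutoff_def[abs_def] by measurable

lemma SUP_cutoff:
  assumes "0 < \<theta>"
  shows "(SUP L. ennreal (cutoff \<theta> L x)) = epowr x \<theta>"
proof (cases x)
  case (real r)
  have "ennreal (cutoff \<theta> L x) \<le> epowr x \<theta>" for L
    using real assms by (auto simp: cutoff_eq epowr_ennreal intro!: ennreal_leI powr_mono2)
  moreover obtain L where "r \<le> real L" using real_arch_simple by blast
  then have "epowr x \<theta> = ennreal (cutoff \<theta> L x)"
    using real by (simp add: cutoff_eq epowr_ennreal)
  ultimately show ?thesis by (intro antisym SUP_least) (auto intro: SUP_upper)
next
  case top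
  have "(SUP L. ennreal (cutoff \<theta> L x)) = \<top>"
  proof (rule ennreal_SUP_eq_top)
    fix n :: nat
    obtain L where L: "real n powr (1 / \<theta>) \<le> real L" using real_arch_simple by blast
    have "real n = (real n powr (1 / \<theta>)) powr \<theta>" using assms by (simp add: powr_powr)
    also have "\<dots> \<le> real L powr \<theta>" using assms L by (intro powr_mono2) auto
    finally have "of_nat n \<le> ennreal (cutoff \<theta> L x)"
      using top by (simp add: cutoff_eq ennreal_of_nat_eq_real_of_nat ennreal_leI)
    then show "\<exists>i\<in>UNIV. of_nat n \<le> ennreal (cutoff \<theta> i x)" by blast
  qed
  then show ?thesis using top by simp
qed

lemma SUP_nn_integral_cutoff:
  assumes "0 < \<theta>" "Y \<in> borel_measurable M"
  shows "(SUP L. \<integral>\<^sup>+\<omega>. ennreal (cutoff \<theta> L (Y \<omega>)) \<partial>M) = (\<integral>\<^sup>+\<omega>. epowr (Y \<omega>) \<theta> \<partial>M)"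
proof -
  have "incseq (\<lambda>L \<omega>. ennreal (cutoff \<theta> L (Y \<omega>)))"
    using assms(1) by (auto simp: incseq_def le_fun_def intro!: ennreal_leI cutoff_mono_level)
  then have "(\<integral>\<^sup>+\<omega>. (SUP L. ennreal (cutoff \<theta> L (Y \<omega>))) \<partial>M) = (SUP L. \<integral>\<^sup>+\<omega>. ennreal (cutoff \<theta> L (Y \<omega>)) \<partial>M)"
    using assms(2) by (intro nn_integral_monotone_convergence_SUP) measurable
  then show ?thesis by (simp add: SUP_cutoff assms(1))
qed

lemma nn_integral_cutoff_eq:
  assumes "prob_space M" "0 < \<theta>" "Y \<in> borel_measurable M"
  shows "(\<integral>\<^sup>+\<omega>. ennreal (cutoff \<theta> L (Y \<omega>)) \<partial>M) = ennreal (\<integral>\<omega>. cutoff \<theta> L (Y \<omega>) \<partial>M)"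
proof -
  interpret prob_space M by fact
  have "integrable M (\<lambda>\<omega>. cutoff \<theta> L (Y \<omega>))"
    using assms by (intro integrable_const_bound[where B = "real L powr \<theta>"]) (auto intro: cutoff_le)
  then show ?thesis by (intro nn_integral_eq_integral) auto
qed

lemma converges_in_law_cutoff:
  assumes "converges_in_law M Y N X" "0 < \<theta>"
  shows "(\<lambda>n. \<integral>\<omega>. cutoff \<theta> L (Y n \<omega>) \<partial>M) \<longlonglongrightarrow> (\<integral>\<omega>. cutoff \<theta> L (X \<omega>) \<partial>N)"
proof -
  have "bounded (range (cutoff \<theta> L))"
    unfolding bounded_iff using cutoff_le[OF assms(2)] by (auto intro!: exI[of _ "real L powr \<theta>"])
  then show ?thesis
    using assms continuous_cutoff unfolding converges_in_law_def by blast
qed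

text \<open>Both parts pass to the limit at a fixed level \<open>L\<close> and then remove the
  truncation by a supremum over \<open>L\<close>. In the lower bound, monotonicity in
  \<open>n\<close> makes each truncated moment at most its limit.\<close>

lemma
  assumes law: "converges_in_law M Y N X" and M: "prob_space M" and N: "prob_space N"
    and \<theta>: "0 < \<theta>" and X: "X \<in> borel_measurable N" and Y: "\<And>n. Y n \<in> borel_measurable M"
  shows limit_moment_le: "(\<And>n. (\<integral>\<^sup>+\<omega>. epowr (Y n \<omega>) \<theta> \<partial>M) \<le> ennreal C) \<Longrightarrow>
      (\<integral>\<^sup>+\<omega>. epowr (X \<omega>) \<theta> \<partial>N) \<le> ennreal C"
    and moment_le_limit: "(\<And>L m n. m \<le> n \<Longrightarrow> (\<integral>\<^sup>+\<omega>. ennreal (cutoff \<theta> L (Y m \<omega>)) \<partial>M) \<le>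
        (\<integral>\<^sup>+\<omega>. ennreal (cutoff \<theta> L (Y n \<omega>)) \<partial>M)) \<Longrightarrow>
      (\<integral>\<^sup>+\<omega>. epowr (Y n \<omega>) \<theta> \<partial>M) \<le> (\<integral>\<^sup>+\<omega>. epowr (X \<omega>) \<theta> \<partial>N)"
proof -
  note lim = converges_in_law_cutoff[OF law \<theta>]
  note eqY = nn_integral_cutoff_eq[OF M \<theta> Y] and eqX = nn_integral_cutoff_eq[OF N \<theta> X]
  note supY = SUP_nn_integral_cutoff[OF \<theta> Y] and supX = SUP_nn_integral_cutoff[OF \<theta> X]
  show "(\<integral>\<^sup>+\<omega>. epowr (X \<omega>) \<theta> \<partial>N) \<le> ennreal C"
    if C: "\<And>n. (\<integral>\<^sup>+\<omega>. epowr (Y n \<omega>) \<theta> \<partial>M) \<le> ennreal C"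
    unfolding supX[symmetric]
  proof (rule SUP_least)
    fix L
    have "ennreal (\<integral>\<omega>. cutoff \<theta> L (Y n \<omega>) \<partial>M) \<le> ennreal C" for n
      using C[of n] unfolding supY[symmetric] eqY[symmetric] by (simp add: SUP_le_iff)
    then have "ennreal (\<integral>\<omega>. cutoff \<theta> L (X \<omega>) \<partial>N) \<le> ennreal C"
      by (intro LIMSEQ_le_const2[OF tendsto_ennrealI[OF lim]]) auto
    then show "(\<integral>\<^sup>+\<omega>. ennreal (cutoff \<theta> L (X \<omega>)) \<partial>N) \<le> ennreal C" by (simp add: eqX)
  qed
  show "(\<integral>\<^sup>+\<omega>. epowr (Y n \<omega>) \<theta> \<partial>M) \<le> (\<integral>\<^sup>+\<omega>. epowr (X \<omega>) \<theta> \<partial>N)"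
    if mono: "\<And>L m n. m \<le> n \<Longrightarrow> (\<integral>\<^sup>+\<omega>. ennreal (cutoff \<theta> L (Y m \<omega>)) \<partial>M) \<le>
        (\<integral>\<^sup>+\<omega>. ennreal (cutoff \<theta> L (Y n \<omega>)) \<partial>M)"
    unfolding supY[symmetric]
  proof (rule SUP_least)
    fix L
    have "(\<integral>\<^sup>+\<omega>. ennreal (cutoff \<theta> L (Y n \<omega>)) \<partial>M) \<le> (\<integral>\<^sup>+\<omega>. ennreal (cutoff \<theta> L (X \<omega>)) \<partial>N)"
      unfolding eqX
      using mono[of n _ L] unfolding eqY
      by (intro LIMSEQ_le_const[OF tendsto_ennrealI[OF lim]]) auto
    also have "\<dots> \<le> (\<integral>\<^sup>+\<omega>. epowr (X \<omega>) \<theta> \<partial>N)"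
      unfolding supX[symmetric] by (rule SUP_upper) simp
    finally show "(\<integral>\<^sup>+\<omega>. ennreal (cutoff \<theta> L (Y n \<omega>)) \<partial>M) \<le> (\<integral>\<^sup>+\<omega>. epowr (X \<omega>) \<theta> \<partial>N)" .
  qed
qed

text \<open>Time \<open>n\<close> is the point \<open>- int n\<close> in reversed time, and the
  horizon \<open>n\<close> reaches exactly to the point 0, before which in original time
  \<open>Xt\<close> vanishes.\<close>

lemma recursion_path_sum:
  assumes rec: "solves_recursion M \<A> \<B> Xt" and w: "\<omega> \<in> space M"
  shows "Xt (int n) \<omega> = path_sum (\<lambda>u j. \<A> (- u) j \<omega>) (\<lambda>u. \<B> (- u) \<omega>) n (- int n)"
proof (induction n rule: less_induct)
  case (less n)
  have neg: "Xt t \<omega> = 0" if "t < 0" for t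
    using rec w that by (auto simp: solves_recursion_def)
  have "Xt (int n) \<omega> = (\<Sum>\<^sub>\<infinity>j\<in>{1..}. \<A> (int n) j \<omega> * Xt (int n - int j) \<omega>) + \<B> (int n) \<omega>"
    using rec w by (auto simp: solves_recursion_def)
  also have "(\<Sum>\<^sub>\<infinity>j\<in>{1..}. \<A> (int n) j \<omega> * Xt (int n - int j) \<omega>) =
      (\<Sum>\<^sub>\<infinity>j\<in>{1..n}. \<A> (int n) j \<omega> * Xt (int n - int j) \<omega>)"
  proof (rule infsum_cong_neutral)
    fix j assume "j \<in> {1..} - {1..n}"
    then show "\<A> (int n) j \<omega> * Xt (int n - int j) \<omega> = 0" by (subst neg) auto
  qed auto
  also have "\<dots> = (\<Sum>j=1..n. \<A> (int n) j \<omega> * Xt (int n - int j) \<omega>)" by simp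
  also have "\<dots> = (\<Sum>j=1..n. \<A> (int n) j \<omega> *
      path_sum (\<lambda>u j. \<A> (- u) j \<omega>) (\<lambda>u. \<B> (- u) \<omega>) (n - j) (- int n + int j))"
  proof (intro sum.cong refl arg_cong2[where f = "(*)"])
    fix j assume j: "j \<in> {1..n}"
    then have e: "int n - int j = int (n - j)" "- int n + int j = - int (n - j)" by auto
    show "Xt (int n - int j) \<omega> =
        path_sum (\<lambda>u j. \<A> (- u) j \<omega>) (\<lambda>u. \<B> (- u) \<omega>) (n - j) (- int n + int j)"
      unfolding e by (rule less) (use j in auto)
  qed
  finally show ?case by (subst path_sum_eq) (simp add: add.commute)
qed

lemma moment_powr:
  "moment M p (\<lambda>\<omega>. f \<omega> powr q) = moment M (q * p) f"
  by (simp add: moment_def powr_powr)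

context stochastic_recursion
begin

text \<open>The argument of the logarithm in \<open>phi2\<close> for \<open>p = 1\<close> and in
  \<open>phi2_tilde\<close> for \<open>p = \<theta> / 2\<close>.\<close>

definition pair_sum :: "real \<Rightarrow> real \<Rightarrow> ennreal" where
  "pair_sum \<theta> p = (\<Sum>\<^sub>\<infinity>(s, t)\<in>closed_pairs.
     epowr (\<integral>\<^sup>+\<omega>. ennreal (path_prod \<A> s \<omega> powr (\<theta> / 2) * path_prod \<A> t \<omega> powr (\<theta> / 2)) \<partial>M) (1 / p))"

context
  fixes S :: "'k \<Rightarrow> 'b set set" and ka kb
  assumes env: "random_env M S ka kb ra rb"
begin

interpretation R: random_env M S ka kb ra rb
  by (rule env)

lemma nn_integral_Xt:
  fixes g :: "real \<Rightarrow> ennreal"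
  assumes "solves_recursion M \<A> \<B> Xt" "g \<in> borel_measurable borel"
  shows "(\<integral>\<^sup>+\<omega>. g (Xt (int n) \<omega>) \<partial>M) = (\<integral>\<^sup>+\<omega>. g (R.X n 0 \<omega>) \<partial>M)"
proof -
  have "(\<integral>\<^sup>+\<omega>. g (Xt (int n) \<omega>) \<partial>M) = (\<integral>\<^sup>+\<omega>. g (R.X n (- int n) \<omega>) \<partial>M)"
    unfolding R.X_def by (intro nn_integral_cong) (simp add: recursion_path_sum[OF assms(1)])
  also have "\<dots> = (\<integral>\<^sup>+\<omega>. g (R.X n 0 \<omega>) \<partial>M)" by (rule R.X_stationary) fact
  finally show ?thesis .
qed

context
  fixes q p \<theta> :: real
  assumes qp: "0 < q" "0 < p" "q * p = \<theta> / 2"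
begin

interpretation Q: random_env M S ka kb "\<lambda>u j \<omega>. ra u j \<omega> powr q" "\<lambda>u \<omega>. rb u \<omega> powr q"
  by (rule random_env_powr[OF env])

text \<open>Weights raised to the power \<open>q\<close> inside a norm of order \<open>p\<close>
  have the total exponent \<open>q * p = \<theta> / 2\<close>; only the outer exponent
  \<open>1 / p\<close> still depends on \<open>p\<close>.\<close>

lemma rho_eq_pair_sum: "Q.rho p = pair_sum \<theta> p"
proof -
  have "pair_sum \<theta> p = (\<Sum>\<^sub>\<infinity>z\<in>closed_steps. (\<lambda>(s, t).
     epowr (\<integral>\<^sup>+\<omega>. ennreal (path_prod \<A> s \<omega> powr (\<theta> / 2) * path_prod \<A> t \<omega> powr (\<theta> / 2)) \<partial>M) (1 / p))
       (map_prod (points 0) (points 0) z))"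
    unfolding pair_sum_def by (rule infsum_reindex_bij_betw[OF bij_betw_closed, symmetric])
  also have "\<dots> = Q.rho p"
  proof (intro infsum_cong, clarify)
    fix x y assume "(x, y) \<in> closed_steps"
    then have xy: "x \<in> steps" "y \<in> steps" by (auto simp: closed_steps_def)
    have "(\<integral>\<^sup>+\<omega>. ennreal (path_prod \<A> (points 0 x) \<omega> powr (\<theta> / 2) * path_prod \<A> (points 0 y) \<omega> powr (\<theta> / 2)) \<partial>M) =
        moment M p (\<lambda>\<omega>. Q.W 0 x \<omega> * Q.W 0 y \<omega>)"
      unfolding moment_def
    proof (intro nn_integral_cong arg_cong[where f = ennreal])
      fix \<omega> assume w: "\<omega> \<in> space M"
      have W: "Q.W 0 z \<omega> = R.W 0 z \<omega> powr q" if "z \<in> steps" for z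
        unfolding Q.W_def R.W_def using w that by (intro wt_powr R.a_nonneg)
      have PW: "path_prod \<A> (points 0 z) \<omega> = R.W 0 z \<omega>" for z
        by (simp add: path_prod_points R.W_def)
      show "path_prod \<A> (points 0 x) \<omega> powr (\<theta> / 2) * path_prod \<A> (points 0 y) \<omega> powr (\<theta> / 2) =
          (Q.W 0 x \<omega> * Q.W 0 y \<omega>) powr p"
        unfolding PW W[OF xy(1)] W[OF xy(2)] by (simp add: powr_mult powr_powr qp(3))
    qed
    then show "(case map_prod (points 0) (points 0) (x, y) of (s, t) \<Rightarrow>
        epowr (\<integral>\<^sup>+\<omega>. ennreal (path_prod \<A> s \<omega> powr (\<theta> / 2) * path_prod \<A> t \<omega> powr (\<theta> / 2)) \<partial>M) (1 / p)) =
        Lp_norm M p (\<lambda>\<omega>. Q.W 0 x \<omega> * Q.W 0 y \<omega>)"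
      by (simp add: Lp_norm_def)
  qed
  finally show ?thesis by simp
qed

lemma moment_b:
  assumes "assumption_A1 P A B M \<A> \<B> \<or> assumption_A2 P A B M \<A> \<B>"
  shows "moment M (2 * p) (\<lambda>\<omega>. rb 0 \<omega> powr q) = (\<integral>\<^sup>+\<omega>. ennreal (B \<omega> powr \<theta>) \<partial>P)"
proof -
  have "q * (2 * p) = \<theta>" using qp by simp
  then show ?thesis
    unfolding moment_powr moment_def using nn_integral_\<B>[OF assms, of "\<lambda>x. ennreal (x powr \<theta>)" 0] by simp
qed

lemma Lp_norm_a:
  assumes "assumption_A1 P A B M \<A> \<B> \<or> assumption_A2 P A B M \<A> \<B>" "1 \<le> j"
  shows "Lp_norm M p (\<lambda>\<omega>. ra 0 j \<omega> powr q) = epowr (\<integral>\<^sup>+\<omega>. ennreal (A j \<omega> powr (\<theta> / 2)) \<partial>P) (1 / p)"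
  unfolding Lp_norm_def moment_powr moment_def qp(3)
  using nn_integral_\<A>[OF assms, of "\<lambda>x. ennreal (x powr (\<theta> / 2))" 0] by simp

text \<open>For \<open>q \<ge> 1\<close> the path sum of the powered weights is at most
  \<open>R.X\<close> to the power \<open>q\<close>, so its unbounded moments carry over to
  \<open>R.X\<close>.\<close>

lemma moment_X_unbounded:
  assumes q: "1 \<le> q" "p \<le> 1" and rho: "1 \<le> pair_sum \<theta> p" and b: "moment M (2 * p) (\<lambda>\<omega>. rb 0 \<omega> powr q) \<noteq> 0"
  shows "(SUP n. moment M \<theta> (R.X n 0)) = \<top>"
proof (rule ccontr)
  let ?C = "SUP n. moment M \<theta> (R.X n 0)"
  assume "?C \<noteq> \<top>"
  then obtain c where c: "0 \<le> c" "?C = ennreal c" by (cases ?C) auto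
  have th: "q * (2 * p) = \<theta>" using qp by simp
  have "Q.xi p N \<le> epowr ?C (1 / p)" for N
  proof -
    have "moment M p (\<lambda>\<omega>. (Q.X N 0 \<omega>)\<^sup>2) = moment M (2 * p) (Q.X N 0)"
      by (intro moment_power2 Q.X_nonneg)
    also have "\<dots> \<le> moment M (2 * p) (\<lambda>\<omega>. R.X N 0 \<omega> powr q)"
      using qp q
      by (intro moment_mono Q.X_nonneg) (auto simp: Q.X_def R.X_def intro!: path_sum_powr_ge R.a_nonneg R.b_nonneg)
    also have "\<dots> = moment M \<theta> (R.X N 0)" by (simp add: moment_powr th)
    also have "\<dots> \<le> ?C" by (rule SUP_upper) simp
    finally show ?thesis unfolding Lp_norm_def using qp by (intro epowr_mono) auto
  qed
  then have "(SUP N. Q.xi p N) \<le> epowr ?C (1 / p)" by (rule SUP_least)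
  also have "\<dots> < \<top>" using c by (simp add: epowr_ennreal)
  moreover have "(SUP N. Q.xi p N) = \<top>"
  proof (rule Q.SUP_xi_eq_top)
    show "1 \<le> Q.rho p" using rho by (simp only: rho_eq_pair_sum)
    have "moment M p (\<lambda>\<omega>. (rb 0 \<omega> powr q)\<^sup>2) \<noteq> 0"
      using b moment_power2[of M "\<lambda>\<omega>. rb 0 \<omega> powr q" p] by simp
    then show "Lp_norm M p (\<lambda>\<omega>. (rb 0 \<omega> powr q)\<^sup>2) \<noteq> 0"
      unfolding Lp_norm_def using qp
      by (cases "moment M p (\<lambda>\<omega>. (rb 0 \<omega> powr q)\<^sup>2)") (auto simp: epowr_ennreal)
  qed (use qp q in auto)
  ultimately show False by simp
qed

text \<open>For \<open>q \<le> 1\<close> the comparison is reversed, and bounds for the powered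
  weights carry over to \<open>R.X\<close>.\<close>

lemma moment_X_bounded:
  assumes q: "q \<le> 1" "1 \<le> p" and rho: "pair_sum \<theta> p < 1"
    and r: "(\<Sum>\<^sub>\<infinity>j\<in>{1..}. Lp_norm M p (\<lambda>\<omega>. ra 0 j \<omega> powr q)) < 1"
    and g: "(\<Sum>\<^sub>\<infinity>(i, j)\<in>{(i, j). 1 \<le> i \<and> 1 \<le> j \<and> i \<noteq> j}.
      Lp_norm M p (\<lambda>\<omega>. ra 0 i \<omega> powr q * ra 0 j \<omega> powr q)) < \<top>"
    and b: "moment M (2 * p) (\<lambda>\<omega>. rb 0 \<omega> powr q) < \<top>"
  shows "\<exists>C. \<forall>n. moment M \<theta> (R.X n 0) \<le> ennreal C"
proof -
  have th: "q * (2 * p) = \<theta>" using qp by simp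
  have "Q.rho p < 1" using rho by (simp only: rho_eq_pair_sum)
  with Q.xi_bounded[OF q(2) r _ g b] obtain C where C: "\<And>N. Q.xi p N \<le> ennreal C" by blast
  have "moment M \<theta> (R.X n 0) \<le> ennreal (max C 0 powr p)" for n
  proof -
    have "moment M \<theta> (R.X n 0) = moment M (2 * p) (\<lambda>\<omega>. R.X n 0 \<omega> powr q)" by (simp add: moment_powr th)
    also have "\<dots> \<le> moment M (2 * p) (Q.X n 0)"
      using qp q
      by (intro moment_mono) (auto simp: Q.X_def R.X_def intro!: path_sum_powr_le R.a_nonneg R.b_nonneg)
    also have "\<dots> = moment M p (\<lambda>\<omega>. (Q.X n 0 \<omega>)\<^sup>2)"
      by (intro moment_power2[symmetric] Q.X_nonneg)
    also have "\<dots> \<le> ennreal (max C 0 powr p)"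
    proof -
      have "Q.xi p n \<le> ennreal (max C 0)"
        using C[of n] by (rule order_trans) (intro ennreal_leI, simp)
      then show ?thesis
        unfolding Lp_norm_def by (subst (asm) epowr_inverse_le_iff) (use qp in auto)
    qed
    finally show ?thesis .
  qed
  then show ?thesis by blast
qed

text \<open>Both weights come from the block at time 0, whose joint law is that of the generic
  sequence; the diagonal terms of the given sum are dropped.\<close>

lemma pairs_finite_A1:
  assumes A1: "assumption_A1 P A B M \<A> \<B>"
    and fin: "(\<Sum>\<^sub>\<infinity>(i, j)\<in>{1..} \<times> {1..}.
      epowr (\<integral>\<^sup>+\<omega>. ennreal (A i \<omega> powr (\<theta> / 2) * A j \<omega> powr (\<theta> / 2)) \<partial>P) (1 / p)) < \<infinity>"
  shows "(\<Sum>\<^sub>\<infinity>(i, j)\<in>{(i, j). 1 \<le> i \<and> 1 \<le> j \<and> i \<noteq> j}.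
      Lp_norm M p (\<lambda>\<omega>. ra 0 i \<omega> powr q * ra 0 j \<omega> powr q)) < \<top>"
proof -
  let ?f = "\<lambda>(i, j). epowr (\<integral>\<^sup>+\<omega>. ennreal (A i \<omega> powr (\<theta> / 2) * A j \<omega> powr (\<theta> / 2)) \<partial>P) (1 / p)"
  have "(\<Sum>\<^sub>\<infinity>(i, j)\<in>{(i, j). 1 \<le> i \<and> 1 \<le> j \<and> i \<noteq> j}.
      Lp_norm M p (\<lambda>\<omega>. ra 0 i \<omega> powr q * ra 0 j \<omega> powr q)) =
    (\<Sum>\<^sub>\<infinity>z\<in>{(i, j). 1 \<le> i \<and> 1 \<le> j \<and> i \<noteq> j}. ?f z)"
  proof (intro infsum_cong, clarify)
    fix i j :: nat assume ij: "1 \<le> i" "1 \<le> j"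
    let ?h = "\<lambda>z. ennreal (fst z i powr (\<theta> / 2) * fst z j powr (\<theta> / 2))"
    have "?h \<in> borel_measurable (seq_space \<Otimes>\<^sub>M (borel :: real measure))"
      using fst_component_measurable[OF ij(1)] fst_component_measurable[OF ij(2)] by measurable
    from A1_nn_integral[OF A1 this, of 0] ij
    have "(\<integral>\<^sup>+\<omega>. ennreal (\<A> 0 i \<omega> powr (\<theta> / 2) * \<A> 0 j \<omega> powr (\<theta> / 2)) \<partial>M) =
        (\<integral>\<^sup>+\<omega>. ennreal (A i \<omega> powr (\<theta> / 2) * A j \<omega> powr (\<theta> / 2)) \<partial>P)"
      by (simp add: Z_def)
    then show "Lp_norm M p (\<lambda>\<omega>. ra 0 i \<omega> powr q * ra 0 j \<omega> powr q) =
        epowr (\<integral>\<^sup>+\<omega>. ennreal (A i \<omega> powr (\<theta> / 2) * A j \<omega> powr (\<theta> / 2)) \<partial>P) (1 / p)"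
      by (simp add: Lp_norm_def moment_def powr_mult powr_powr qp(3))
  qed
  also have "\<dots> \<le> (\<Sum>\<^sub>\<infinity>z\<in>{1..} \<times> {1..}. ?f z)" by (rule infsum_mono_set_ennreal) auto
  also have "\<dots> < \<top>" using fin by simp
  finally show ?thesis .
qed

text \<open>Distinct keys make the two first weights independent, so the double sum is at most the
  square of the single one.\<close>

lemma pairs_finite_A2:
  assumes inj: "\<And>i j. 1 \<le> i \<Longrightarrow> 1 \<le> j \<Longrightarrow> i \<noteq> j \<Longrightarrow> ka 0 i \<noteq> ka 0 j"
    and r: "(\<Sum>\<^sub>\<infinity>j\<in>{1..}. Lp_norm M p (\<lambda>\<omega>. ra 0 j \<omega> powr q)) < 1"
  shows "(\<Sum>\<^sub>\<infinity>(i, j)\<in>{(i, j). 1 \<le> i \<and> 1 \<le> j \<and> i \<noteq> j}.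
      Lp_norm M p (\<lambda>\<omega>. ra 0 i \<omega> powr q * ra 0 j \<omega> powr q)) < \<top>"
proof -
  let ?r = "\<lambda>j. Lp_norm M p (\<lambda>\<omega>. ra 0 j \<omega> powr q)"
  let ?I = "{(i, j). 1 \<le> i \<and> 1 \<le> j \<and> i \<noteq> j} :: (nat \<times> nat) set"
  have prod: "Lp_norm M p (\<lambda>\<omega>. ra 0 i \<omega> powr q * ra 0 j \<omega> powr q) = ?r i * ?r j"
    if ij: "1 \<le> i" "1 \<le> j" "i \<noteq> j" for i j
  proof -
    have m: "(\<lambda>\<omega>. ennreal ((ra 0 k \<omega> powr q) powr p)) \<in> borel_measurable (R.info {ka 0 k})" if "1 \<le> k" for k
      by (rule measurable_compose[OF R.a_info[OF that], where g = "\<lambda>x. ennreal ((x powr q) powr p)"]) auto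
    have "moment M p (\<lambda>\<omega>. ra 0 i \<omega> powr q * ra 0 j \<omega> powr q) =
        (\<integral>\<^sup>+\<omega>. ennreal ((ra 0 i \<omega> powr q) powr p) * ennreal ((ra 0 j \<omega> powr q) powr p) \<partial>M)"
      by (simp add: moment_def powr_mult ennreal_mult)
    also have "\<dots> = moment M p (\<lambda>\<omega>. ra 0 i \<omega> powr q) * moment M p (\<lambda>\<omega>. ra 0 j \<omega> powr q)"
      unfolding moment_def using inj[OF ij] by (intro R.nn_integral_indep[OF m[OF ij(1)] m[OF ij(2)]]) auto
    finally show ?thesis by (simp add: Lp_norm_def epowr_mult)
  qed
  have "(\<Sum>\<^sub>\<infinity>(i, j)\<in>?I. Lp_norm M p (\<lambda>\<omega>. ra 0 i \<omega> powr q * ra 0 j \<omega> powr q)) =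
      (\<Sum>\<^sub>\<infinity>(i, j)\<in>?I. ?r i * ?r j)"
  proof (intro infsum_cong, clarify)
    fix i j :: nat assume "1 \<le> i" "1 \<le> j" "i \<noteq> j"
    then show "Lp_norm M p (\<lambda>\<omega>. ra 0 i \<omega> powr q * ra 0 j \<omega> powr q) = ?r i * ?r j" by (rule prod)
  qed
  also have "\<dots> \<le> 1"
  proof (subst nonneg_infsum_complete, simp, rule SUP_least)
    fix F assume "F \<in> {F. finite F \<and> F \<subseteq> ?I}"
    then have F: "finite F" "F \<subseteq> ?I" by auto
    \<comment> \<open>A finite set of pairs is enclosed in a rectangle, on which the sum
      factorises.\<close>
    have sub: "F \<subseteq> fst ` F \<times> snd ` F" by (auto simp: rev_image_eqI)
    have "(\<Sum>(i, j)\<in>F. ?r i * ?r j) \<le> (\<Sum>(i, j)\<in>fst ` F \<times> snd ` F. ?r i * ?r j)"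
      using F sub by (intro sum_mono2) auto
    also have "\<dots> = (\<Sum>i\<in>fst ` F. ?r i) * (\<Sum>j\<in>snd ` F. ?r j)"
      by (simp add: sum_product sum.cartesian_product)
    also have "\<dots> \<le> 1 * 1"
    proof (intro mult_mono)
      have le: "(\<Sum>j\<in>J. ?r j) \<le> 1" if "finite J" "J \<subseteq> {1..}" for J
        using sum_le_infsum_ennreal[OF that, of ?r] r by (simp add: order.strict_implies_order order_trans)
      show "(\<Sum>i\<in>fst ` F. ?r i) \<le> 1" by (rule le) (use F in force)+
      show "(\<Sum>j\<in>snd ` F. ?r j) \<le> 1" by (rule le) (use F in force)+
    qed auto
    finally show "(\<Sum>(i, j)\<in>F. ?r i * ?r j) \<le> 1" by simp
  qed
  also have "\<dots> < \<top>" by simp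
  finally show ?thesis .
qed

end

text \<open>\<open>solves_recursion\<close> is a pointwise identity; measurability and sign are read
  off the representation of \<open>Xt\<close> as a path sum.\<close>

lemma Xt_facts:
  assumes "solves_recursion M \<A> \<B> Xt"
  shows Xt_measurable: "Xt (int n) \<in> borel_measurable M"
    and Xt_nonneg: "\<omega> \<in> space M \<Longrightarrow> 0 \<le> Xt (int n) \<omega>"
proof -
  have eq: "Xt (int n) \<omega> = R.X n (- int n) \<omega>" if "\<omega> \<in> space M" for \<omega>
    unfolding R.X_def by (rule recursion_path_sum[OF assms that])
  show "Xt (int n) \<in> borel_measurable M"
    using R.X_measurable[of n "- int n"] by (subst measurable_cong[OF eq])
  show "0 \<le> Xt (int n) \<omega>" if "\<omega> \<in> space M"
    using R.X_nonneg[OF that, of n "- int n"] by (simp add: eq[OF that])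
qed

context
  fixes Xt :: "int \<Rightarrow> 'b \<Rightarrow> real" and N :: "'c measure" and X :: "'c \<Rightarrow> ennreal" and \<theta> :: real
  assumes rec: "solves_recursion M \<A> \<B> Xt" and N: "prob_space N"
    and X: "X \<in> borel_measurable N"
    and law: "converges_in_law M (\<lambda>n \<omega>. ennreal (Xt (int n) \<omega>)) N X"
    and \<theta>: "0 < \<theta>"
begin

lemma epowr_Xt: "(\<integral>\<^sup>+\<omega>. epowr (ennreal (Xt (int n) \<omega>)) \<theta> \<partial>M) = moment M \<theta> (R.X n 0)"
proof -
  have "(\<integral>\<^sup>+\<omega>. epowr (ennreal (Xt (int n) \<omega>)) \<theta> \<partial>M) = (\<integral>\<^sup>+\<omega>. ennreal (Xt (int n) \<omega> powr \<theta>) \<partial>M)"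
    by (intro nn_integral_cong epowr_ennreal Xt_nonneg[OF rec])
  then show ?thesis
    unfolding moment_def using nn_integral_Xt[OF rec, of "\<lambda>x. ennreal (x powr \<theta>)" n] by simp
qed

lemma limit_moment_eq_top:
  assumes "(SUP n. moment M \<theta> (R.X n 0)) = \<top>"
  shows "(\<integral>\<^sup>+\<omega>. epowr (X \<omega>) \<theta> \<partial>N) = \<infinity>"
proof -
  have "moment M \<theta> (R.X n 0) \<le> (\<integral>\<^sup>+\<omega>. epowr (X \<omega>) \<theta> \<partial>N)" for n
    unfolding epowr_Xt[symmetric]
  proof (rule moment_le_limit[OF law M N \<theta> X])
    show "(\<lambda>\<omega>. ennreal (Xt (int n) \<omega>)) \<in> borel_measurable M" for n
      using Xt_measurable[OF rec] by measurable
    fix L m n :: nat assume "m \<le> n"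
    \<comment> \<open>Monotonicity holds pointwise for \<open>R.X n 0\<close> and is transferred to
      \<open>Xt\<close> only through equality of laws.\<close>
    then have "(\<integral>\<^sup>+\<omega>. ennreal (cutoff \<theta> L (ennreal (R.X m 0 \<omega>))) \<partial>M) \<le>
        (\<integral>\<^sup>+\<omega>. ennreal (cutoff \<theta> L (ennreal (R.X n 0 \<omega>))) \<partial>M)"
      by (intro nn_integral_mono ennreal_leI cutoff_mono \<theta> R.X_mono)
    then show "(\<integral>\<^sup>+\<omega>. ennreal (cutoff \<theta> L (ennreal (Xt (int m) \<omega>))) \<partial>M) \<le>
        (\<integral>\<^sup>+\<omega>. ennreal (cutoff \<theta> L (ennreal (Xt (int n) \<omega>))) \<partial>M)"
      using nn_integral_Xt[OF rec, of "\<lambda>x. ennreal (cutoff \<theta> L (ennreal x))"] by simp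
  qed
  then have "\<top> \<le> (\<integral>\<^sup>+\<omega>. epowr (X \<omega>) \<theta> \<partial>N)"
    unfolding assms[symmetric] by (rule SUP_least)
  then show ?thesis by (simp add: top_unique)
qed

lemma limit_moment_finite:
  assumes "\<exists>C. \<forall>n. moment M \<theta> (R.X n 0) \<le> ennreal C"
  shows "(\<integral>\<^sup>+\<omega>. epowr (X \<omega>) \<theta> \<partial>N) < \<infinity>"
proof -
  obtain C where C: "\<And>n. moment M \<theta> (R.X n 0) \<le> ennreal C" using assms by blast
  have "(\<integral>\<^sup>+\<omega>. epowr (X \<omega>) \<theta> \<partial>N) \<le> ennreal C"
  proof (rule limit_moment_le[OF law M N \<theta> X])
    show "(\<lambda>\<omega>. ennreal (Xt (int n) \<omega>)) \<in> borel_measurable M" for n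
      using Xt_measurable[OF rec] by measurable
    show "(\<integral>\<^sup>+\<omega>. epowr (ennreal (Xt (int n) \<omega>)) \<theta> \<partial>M) \<le> ennreal C" for n
      unfolding epowr_Xt by (rule C)
  qed
  also have "\<dots> < \<infinity>" by simp
  finally show ?thesis .
qed

text \<open>Replacing \<open>A\<close> and \<open>B\<close> by their powers with exponent \<open>\<theta> / 2\<close> reduces one of the two ranges of
  \<open>\<theta>\<close> in each part to \<open>\<theta> = 2\<close>: the pair \<open>(q, p)\<close> of this exponent and the order of the norm is
  \<open>(\<theta> / 2, 1)\<close> or \<open>(1, \<theta> / 2)\<close>.\<close>

lemma infinite_moment:
  assumes A12: "assumption_A1 P A B M \<A> \<B> \<or> assumption_A2 P A B M \<A> \<B>"
    and B: "\<And>\<omega>. \<omega> \<in> space P \<Longrightarrow> B \<omega> \<ge> 0" "measure P {\<omega> \<in> space P. B \<omega> = 0} < 1"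
    and phi: "\<theta> \<ge> 2 \<and> phi2 M \<A> \<theta> \<ge> 0 \<or> \<theta> \<le> 2 \<and> phi2_tilde M \<A> \<theta> \<ge> 0"
  shows "(\<integral>\<^sup>+\<omega>. epowr (X \<omega>) \<theta> \<partial>N) = \<infinity>"
proof (rule limit_moment_eq_top)
  \<comment> \<open>A vanishing moment would make \<open>B\<close> zero almost surely, against the
    assumption that this event has probability below 1.\<close>
  have B0: "(\<integral>\<^sup>+\<omega>. ennreal (B \<omega> powr \<theta>) \<partial>P) \<noteq> 0"
  proof
    assume "(\<integral>\<^sup>+\<omega>. ennreal (B \<omega> powr \<theta>) \<partial>P) = 0"
    then have "AE \<omega> in P. ennreal (B \<omega> powr \<theta>) = 0"
      using B_measurable by (subst (asm) nn_integral_0_iff_AE) auto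
    then have ae: "AE \<omega> in P. B \<omega> = 0"
      by eventually_elim (simp add: ennreal_eq_0_iff)
    have "{\<omega> \<in> space P. B \<omega> = 0} \<in> sets P" using B_measurable by measurable
    then have "measure P {\<omega> \<in> space P. B \<omega> = 0} = 1"
      using prob_space.prob_Collect_eq_1[OF P, of "\<lambda>\<omega>. B \<omega> = 0"] ae by simp
    then show False using B(2) by simp
  qed
  have main: "(SUP n. moment M \<theta> (R.X n 0)) = \<top>"
    if qp: "0 < q" "0 < p" "q * p = \<theta> / 2" "1 \<le> q" "p \<le> 1" "1 \<le> pair_sum \<theta> p" for q p
    using B0 moment_b[OF qp(1-3) A12] by (intro moment_X_unbounded[OF qp]) simp
  from phi show "(SUP n. moment M \<theta> (R.X n 0)) = \<top>"
  proof
    assume h: "\<theta> \<ge> 2 \<and> phi2 M \<A> \<theta> \<ge> 0"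
    then have "1 \<le> pair_sum \<theta> 1" by (simp add: phi2_def elog_nonneg_iff pair_sum_def)
    then show ?thesis using h by (intro main[of "\<theta> / 2" 1]) auto
  next
    assume h: "\<theta> \<le> 2 \<and> phi2_tilde M \<A> \<theta> \<ge> 0"
    then have "1 \<le> pair_sum \<theta> (\<theta> / 2)" by (simp add: phi2_tilde_def elog_nonneg_iff pair_sum_def)
    then show ?thesis using h \<theta> by (intro main[of 1 "\<theta> / 2"]) auto
  qed
qed

text \<open>The alternatives in \<open>g\<close> are what the two cases provide for the first
  weights: distinct first steps have distinct keys under (A2), and the sum in (b) is finite under
  (A1).\<close>

lemma finite_moment:
  assumes A12: "assumption_A1 P A B M \<A> \<B> \<or> assumption_A2 P A B M \<A> \<B>"
    and phi: "\<theta> \<le> 2 \<and> phi1 P A (\<theta> / 2) < 0 \<and> phi2 M \<A> \<theta> < 0 \<or>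
       \<theta> \<ge> 2 \<and> phi1_tilde P A (\<theta> / 2) < 0 \<and> phi2_tilde M \<A> \<theta> < 0"
    and g: "(\<forall>i j. 1 \<le> i \<longrightarrow> 1 \<le> j \<longrightarrow> i \<noteq> j \<longrightarrow> ka 0 i \<noteq> ka 0 j) \<or>
      assumption_A1 P A B M \<A> \<B> \<and> (\<Sum>\<^sub>\<infinity>(i, j)\<in>{1..} \<times> {1..}.
            epowr (\<integral>\<^sup>+\<omega>. ennreal (A i \<omega> powr (\<theta> / 2) * A j \<omega> powr (\<theta> / 2)) \<partial>P)
              (min 1 (2 / \<theta>))) < \<infinity>"
    and B: "(\<integral>\<^sup>+\<omega>. ennreal (B \<omega> powr \<theta>) \<partial>P) < \<infinity>"
  shows "(\<integral>\<^sup>+\<omega>. epowr (X \<omega>) \<theta> \<partial>N) < \<infinity>"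
proof (rule limit_moment_finite)
  have main: "\<exists>C. \<forall>n. moment M \<theta> (R.X n 0) \<le> ennreal C"
    if qp: "0 < q" "0 < p" "q * p = \<theta> / 2" "q \<le> 1" "1 \<le> p" "pair_sum \<theta> p < 1"
      and r: "(\<Sum>\<^sub>\<infinity>j\<in>{1..}. epowr (\<integral>\<^sup>+\<omega>. ennreal (A j \<omega> powr (\<theta> / 2)) \<partial>P) (1 / p)) < 1"
      \<comment> \<open>The exponent in (b) equals \<open>1 / p\<close> in both ranges:
        \<open>p = 1\<close> for \<open>\<theta> \<le> 2\<close> and \<open>p = \<theta> / 2\<close>
        for \<open>\<theta> \<ge> 2\<close>.\<close>
      and min: "min 1 (2 / \<theta>) = 1 / p" for q p
  proof (rule moment_X_bounded[OF qp])
    show r': "(\<Sum>\<^sub>\<infinity>j\<in>{1..}. Lp_norm M p (\<lambda>\<omega>. ra 0 j \<omega> powr q)) < 1"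
      using r by (subst infsum_cong[OF Lp_norm_a[OF qp(1-3) A12]]) auto
    show "moment M (2 * p) (\<lambda>\<omega>. rb 0 \<omega> powr q) < \<top>"
      using B moment_b[OF qp(1-3) A12] by simp
    show "(\<Sum>\<^sub>\<infinity>(i, j)\<in>{(i, j). 1 \<le> i \<and> 1 \<le> j \<and> i \<noteq> j}.
      Lp_norm M p (\<lambda>\<omega>. ra 0 i \<omega> powr q * ra 0 j \<omega> powr q)) < \<top>"
    proof (cases "\<forall>i j. 1 \<le> i \<longrightarrow> 1 \<le> j \<longrightarrow> i \<noteq> j \<longrightarrow> ka 0 i \<noteq> ka 0 j")
      case True
      then show ?thesis by (intro pairs_finite_A2[OF qp(1-3) _ r']) blast
    next
      case False
      with g show ?thesis
        unfolding min by (intro pairs_finite_A1[OF qp(1-3)]) blast+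
    qed
  qed
  from phi show "\<exists>C. \<forall>n. moment M \<theta> (R.X n 0) \<le> ennreal C"
  proof
    assume h: "\<theta> \<le> 2 \<and> phi1 P A (\<theta> / 2) < 0 \<and> phi2 M \<A> \<theta> < 0"
    then have "pair_sum \<theta> 1 < 1" "(\<Sum>\<^sub>\<infinity>j\<in>{1..}. epowr (\<integral>\<^sup>+\<omega>. ennreal (A j \<omega> powr (\<theta> / 2)) \<partial>P) (1 / 1)) < 1"
      by (simp_all add: phi1_def phi2_def elog_neg_iff pair_sum_def)
    then show ?thesis using h \<theta> by (intro main[of "\<theta> / 2" 1]) auto
  next
    assume h: "\<theta> \<ge> 2 \<and> phi1_tilde P A (\<theta> / 2) < 0 \<and> phi2_tilde M \<A> \<theta> < 0"
    then have "pair_sum \<theta> (\<theta> / 2) < 1"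
      "(\<Sum>\<^sub>\<infinity>j\<in>{1..}. epowr (\<integral>\<^sup>+\<omega>. ennreal (A j \<omega> powr (\<theta> / 2)) \<partial>P) (1 / (\<theta> / 2))) < 1"
      by (simp_all add: phi1_tilde_def phi2_tilde_def elog_neg_iff pair_sum_def)
    then show ?thesis using h \<theta> by (intro main[of 1 "\<theta> / 2"]) auto
  qed
qed

end

end

end

theorem theorem2p1:
  fixes P :: "'a measure" and A :: "nat \<Rightarrow> 'a \<Rightarrow> real" and B :: "'a \<Rightarrow> real"
    and M :: "'b measure" and \<A> :: "int \<Rightarrow> nat \<Rightarrow> 'b \<Rightarrow> real" and \<B> :: "int \<Rightarrow> 'b \<Rightarrow> real"
    and Xt :: "int \<Rightarrow> 'b \<Rightarrow> real"
    and N :: "'c measure" and X :: "'c \<Rightarrow> ennreal"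
    and \<theta> :: real
  assumes "prob_space P" and "prob_space M" and "prob_space N"
    and "\<And>j. j \<ge> 1 \<Longrightarrow> A j \<in> borel_measurable P"
    and "\<And>j \<omega>. j \<ge> 1 \<Longrightarrow> \<omega> \<in> space P \<Longrightarrow> A j \<omega> \<ge> 0"
    and "B \<in> borel_measurable P"
    and "\<And>\<omega>. \<omega> \<in> space P \<Longrightarrow> B \<omega> \<ge> 0"
    and "measure P {\<omega> \<in> space P. B \<omega> = 0} < 1"
    and "\<And>t j. j \<ge> 1 \<Longrightarrow> \<A> t j \<in> borel_measurable M"
    and "\<And>t j \<omega>. j \<ge> 1 \<Longrightarrow> \<omega> \<in> space M \<Longrightarrow> \<A> t j \<omega> \<ge> 0"
    and "\<And>t. \<B> t \<in> borel_measurable M"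
    and "\<And>t \<omega>. \<omega> \<in> space M \<Longrightarrow> \<B> t \<omega> \<ge> 0"
    and "assumption_A1 P A B M \<A> \<B> \<or> assumption_A2 P A B M \<A> \<B>"
    and "solves_recursion M \<A> \<B> Xt"
    and "X \<in> borel_measurable N"
    and "converges_in_law M (\<lambda>n \<omega>. ennreal (Xt (int n) \<omega>)) N X"
    and "\<theta> > 0"
  shows
    "((\<theta> \<ge> 2 \<and> phi2 M \<A> \<theta> \<ge> 0 \<or> \<theta> \<le> 2 \<and> phi2_tilde M \<A> \<theta> \<ge> 0)
        \<longrightarrow> (\<integral>\<^sup>+\<omega>. epowr (X \<omega>) \<theta> \<partial>N) = \<infinity>)
     \<and>
     ((\<theta> \<le> 2 \<and> phi1 P A (\<theta> / 2) < 0 \<and> phi2 M \<A> \<theta> < 0 \<or>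
       \<theta> \<ge> 2 \<and> phi1_tilde P A (\<theta> / 2) < 0 \<and> phi2_tilde M \<A> \<theta> < 0)
      \<and> (assumption_A2 P A B M \<A> \<B> \<or>
         (\<Sum>\<^sub>\<infinity>(i, j)\<in>{1..} \<times> {1..}.
            epowr (\<integral>\<^sup>+\<omega>. ennreal (A i \<omega> powr (\<theta> / 2) * A j \<omega> powr (\<theta> / 2)) \<partial>P)
              (min 1 (2 / \<theta>))) < \<infinity>)
      \<and> (\<integral>\<^sup>+\<omega>. ennreal (B \<omega> powr \<theta>) \<partial>P) < \<infinity>
        \<longrightarrow> (\<integral>\<^sup>+\<omega>. epowr (X \<omega>) \<theta> \<partial>N) < \<infinity>)"
proof -
  interpret stochastic_recursion P A B M \<A> \<B>
    by (rule stochastic_recursion.intro) fact+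
  note limit = assms(14) assms(3) assms(15) assms(16) assms(17)
  show ?thesis
  \<comment> \<open>The split is on (A2): if it holds, distinct keys handle the first weights; if it
    fails, (A1) holds and the disjunction for (b) supplies the finite sum.\<close>
  proof (cases "assumption_A2 P A B M \<A> \<B>")
    case True
    note env = A2_random_env[OF True]
    show ?thesis
      using infinite_moment[OF env limit assms(13,7,8)] finite_moment[OF env limit assms(13)] by auto
  next
    case False
    with assms(13) have A1: "assumption_A1 P A B M \<A> \<B>" by blast
    note env = A1_random_env[OF A1]
    show ?thesis
      using infinite_moment[OF env limit assms(13,7,8)] finite_moment[OF env limit assms(13)] A1 False by auto
  qed
qed

end
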